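(* Let $\beta\in C^1([0,+\infty))$ be (strictly) increasing with $\beta(0)=0$ and $\beta^\infty:=\lim_{r\to+\infty}\beta(r)<+\infty$. Let $V\in C^2(\mathbb R)$ and $\lambda\in\mathbb R$ satisfy $V''\ge\lambda$ on $\mathbb R$ and $\liminf_{|x|\to+\infty}V(x)/|x|^2\ge 0$. Suppose that $\lim_{|x|\to+\infty}V(x)=+\infty$ and that $\int_{\mathbb R\setminus\tilde Q}H(V(x)-V_{\min})\,dx<+\infty$ for some bounded open neighborhood $\tilde Q$ of $Q$. Let $\mathfrak m>0$. If $\mathfrak d=+\infty$, then for every $\rho\in\mathscr M_+(\mathbb R,\mathfrak m)$ $$\mathcal I(\rho)=0\quad\Longleftrightarrow\quad\rho\text{ is a minimizer of }\mathcal F\text{ in }\mathscr M_+(\mathbb R,\mathfrak m).$$ In particular, a measure $\rho\in\mathscr M_2(\mathbb R,\mathfrak m)$ is a stationary (Wasserstein) solution of $\partial_t\rho-\partial_x(\partial_x(\beta(\rho))+V'\rho)=0$ if and only if it is a minimizer of $\mathcal F$.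
   Context: $\mathscr M_+(\mathbb R)$ is the set of finite nonnegative Borel measures on $\mathbb R$, $\mathscr M_+(\mathbb R,\mathfrak m)$ those with mass $\mathfrak m$, $\mathscr M_2(\mathbb R,\mathfrak m)$ those with mass $\mathfrak m$ and finite second moment (endowed with the $L^2$-Wasserstein distance); $\mathscr L^1$ is Lebesgue measure; $\rho=u\mathscr L^1+\rho^\perp$ is the Lebesgue decomposition. $\rho\in\mathscr M_+(\mathbb R)$ belongs to $\mathscr M_+^c(\mathbb R)$ if its Lebesgue density has a representative $u\in C^0(\mathbb R;[0,+\infty])$ (with which $u$ is identified) such that $\rho^\perp(\{u<+\infty\})=0$ and $\mathscr L^1(\{u=+\infty\})=0$. $\mathsf D_+(u):=\{0<u<+\infty\}$, $\beta(+\infty):=\beta^\infty$. If $\rho\in\mathscr M_+^c(\mathbb R)$ and $\beta\circ u\in W^{1,1}_{\rm loc}(\mathbb R)$, $\mathcal I(\rho):=\int_{\mathsf D_+(u)}|\frac{\partial_x\beta(u)}{u}+V'|^2u\,dx+\int_{\mathbb R}|V'|^2d\rho^\perp$; otherwise $\mathcal I(\rho):=+\infty$. $E(r):=-\beta(r)-r\int_r^{+\infty}\frac{\beta'(s)}s\,ds$, $E(0)=0$, $E'(r)=-\int_r^{+\infty}\frac{\beta'(s)}sds$; $\mathcal F:\mathscr M_+(\mathbb R)\to(-\infty,+\infty]$, $\mathcal F(\rho):=\int_{\mathbb R}E(u)\,dx+\int_{\mathbb R}V\,d\rho$. $V_{\min}:=\min_{\mathbb R}V$, $Q:=\{V=V_{\min}\}$,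 $\mathfrak d:=-\lim_{r\to0^+}E'(r)=\int_0^{+\infty}\frac{\beta'(s)}sds\in(0,+\infty]$; $H(v):=(E')^{-1}(-v)$ for $v\in(0,\mathfrak d)$, and $H(v):=0$ if $\mathfrak d<+\infty$ and $v\ge\mathfrak d$. Wasserstein solution: $\rho\in C^0([0,+\infty);\mathscr M_2(\mathbb R,\mathfrak m))$ such that $\rho_t\in\mathscr M_+^c(\mathbb R)$ for a.e. $t>0$, $\int_{T_0}^{T_1}\mathcal I(\rho_t)\,dt<+\infty$ for all $0<T_0<T_1<+\infty$, and $\int_0^{+\infty}\int_{\mathbb R}(-\partial_t\varphi+\partial_x\varphi V')\,d\rho_t\,dt+\int_0^{+\infty}\int_{\mathbb R}\partial_x\varphi\,\partial_x\beta(u_t)\,dx\,dt=0$ for all $\varphi\in C_c^\infty((0,+\infty)\times\mathbb R)$. $\rho$ is stationary if the constant curve $\rho_t\equiv\rho$ is a Wasserstein solution.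
   Formalization: F(ρ) is read as ∫(E(u)+Vu)dx + ∫V dρ^⊥ instead of ∫E(u)dx + ∫V dρ, since the latter can be ∞−∞ under the hypotheses (β(r)=r near 0, V=ln|x|+2 ln ln|x| at infinity, u=H(V−C)); the two agree whenever the original sum is defined. *)

theory Defs
  imports "HOL-Analysis.Analysis"
begin

text \<open>\<open>Ck k f\<close>: \<open>f\<close> is of class \<open>C\<^sup>k\<close> on the whole space, by recursion on its partial
  derivatives along the standard basis.\<close>

primrec Ck :: "nat \<Rightarrow> ('a::euclidean_space \<Rightarrow> real) \<Rightarrow> bool" where
  "Ck 0 f \<longleftrightarrow> continuous_on UNIV f"
| "Ck (Suc k) f \<longleftrightarrow> (\<forall>x. f differentiable (at x)) \<and>
     (\<forall>b\<in>Basis. Ck k (\<lambda>x. frechet_derivative f (at x) b))"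

text \<open>An element of \<open>C\<^sub>c\<^sup>\<infinity>(\<Omega>)\<close> is represented by its extension by zero to the whole space.\<close>

definition test_function :: "'a::euclidean_space set \<Rightarrow> ('a \<Rightarrow> real) \<Rightarrow> bool" where
  "test_function \<Omega> \<phi> \<longleftrightarrow> (\<forall>k. Ck k \<phi>) \<and>
     compact (closure {x. \<phi> x \<noteq> 0}) \<and> closure {x. \<phi> x \<noteq> 0} \<subseteq> \<Omega>"

definition locally_integrable :: "(real \<Rightarrow> real) \<Rightarrow> bool" where
  "locally_integrable f \<longleftrightarrow> (\<forall>a b. set_integrable lborel {a..b} f)"

definition has_weak_deriv :: "(real \<Rightarrow> real) \<Rightarrow> (real \<Rightarrow> real) \<Rightarrow> bool" where
  "has_weak_deriv f g \<longleftrightarrow> locally_integrable f \<and> locally_integrable g \<and>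
     (\<forall>\<phi>. test_function UNIV \<phi> \<longrightarrow>
        (LINT x|lborel. f x * deriv \<phi> x) = - (LINT x|lborel. g x * \<phi> x))"

definition W11_loc :: "(real \<Rightarrow> real) set" where
  "W11_loc = {f. \<exists>g. has_weak_deriv f g}"

text \<open>A representative of the weak derivative, which is unique up to a Lebesgue null set.\<close>

definition weak_deriv :: "(real \<Rightarrow> real) \<Rightarrow> real \<Rightarrow> real" where
  "weak_deriv f = (SOME g. has_weak_deriv f g)"

definition Mplus :: "real measure set" where
  "Mplus = {\<rho>. sets \<rho> = sets borel \<and> finite_measure \<rho>}"

definition Mplus_mass :: "real \<Rightarrow> real measure set" where
  "Mplus_mass m = {\<rho> \<in> Mplus. measure \<rho> UNIV = m}"

definition M2 :: "real \<Rightarrow> real measure set" where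
  "M2 m = {\<rho> \<in> Mplus_mass m. integrable \<rho> (\<lambda>x. x\<^sup>2)}"

definition couplings :: "real measure \<Rightarrow> real measure \<Rightarrow> (real \<times> real) measure set" where
  "couplings \<mu> \<nu> = {\<gamma>. sets \<gamma> = sets (borel \<Otimes>\<^sub>M borel) \<and>
     distr \<gamma> borel fst = \<mu> \<and> distr \<gamma> borel snd = \<nu>}"

text \<open>For two measures in \<open>M2 m\<close> the infimum is finite (take a multiple of the product measure),
  so that the conversion to a real number is harmless.\<close>

definition wasserstein2 :: "real measure \<Rightarrow> real measure \<Rightarrow> real" where
  "wasserstein2 \<mu> \<nu> =
     sqrt (enn2real (INF \<gamma>\<in>couplings \<mu> \<nu>. \<integral>\<^sup>+p. ennreal ((fst p - snd p)\<^sup>2) \<partial>\<gamma>))"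

text \<open>\<open>\<rho> = u \<L>\<^sup>1 + \<sigma>\<close> with \<open>\<sigma>\<close> singular with respect to Lebesgue measure \<open>\<L>\<^sup>1\<close>.\<close>

definition lebesgue_decomposition ::
    "real measure \<Rightarrow> (real \<Rightarrow> ennreal) \<Rightarrow> real measure \<Rightarrow> bool" where
  "lebesgue_decomposition \<rho> u \<sigma> \<longleftrightarrow>
     u \<in> borel_measurable borel \<and> sets \<sigma> = sets borel \<and>
     (\<exists>N\<in>null_sets lborel. emeasure \<sigma> (- N) = 0) \<and>
     (\<forall>A\<in>sets borel. emeasure \<rho> A = (\<integral>\<^sup>+x\<in>A. u x \<partial>lborel) + emeasure \<sigma> A)"

definition ac_density :: "real measure \<Rightarrow> real \<Rightarrow> ennreal" where
  "ac_density \<rho> = (SOME u. \<exists>\<sigma>. lebesgue_decomposition \<rho> u \<sigma>)"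

definition singular_part :: "real measure \<Rightarrow> real measure" where
  "singular_part \<rho> = (THE \<sigma>. \<exists>u. lebesgue_decomposition \<rho> u \<sigma>)"

definition Mplus_c :: "real measure set" where
  "Mplus_c = {\<rho> \<in> Mplus. \<exists>u. continuous_on UNIV u \<and>
     lebesgue_decomposition \<rho> u (singular_part \<rho>) \<and>
     emeasure (singular_part \<rho>) {x. u x < \<infinity>} = 0 \<and> emeasure lborel {x. u x = \<infinity>} = 0}"

text \<open>The continuous representative of the density; it is unique because continuous functions that
  agree almost everywhere are equal.\<close>

definition cont_density :: "real measure \<Rightarrow> real \<Rightarrow> ennreal" where
  "cont_density \<rho> = (THE u. continuous_on UNIV u \<and> lebesgue_decomposition \<rho> u (singular_part \<rho>))"

text \<open>\<open>\<beta>\<close> extended to \<open>[0,+\<infinity>]\<close> by its limit at infinity.\<close>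

definition beta_ext :: "(real \<Rightarrow> real) \<Rightarrow> ennreal \<Rightarrow> real" where
  "beta_ext \<beta> r = (if r = \<infinity> then Lim at_top \<beta> else \<beta> (enn2real r))"

definition D_plus :: "(real \<Rightarrow> ennreal) \<Rightarrow> real set" where
  "D_plus u = {x. 0 < u x \<and> u x < \<infinity>}"

definition dissipation :: "(real \<Rightarrow> real) \<Rightarrow> (real \<Rightarrow> real) \<Rightarrow> real measure \<Rightarrow> ennreal" where
  "dissipation \<beta> V \<rho> =
     (let u = cont_density \<rho>; b = (\<lambda>x. beta_ext \<beta> (u x)) in
      if \<rho> \<in> Mplus_c \<and> b \<in> W11_loc
      then (\<integral>\<^sup>+x\<in>D_plus u.
              ennreal ((weak_deriv b x / enn2real (u x) + deriv V x)\<^sup>2 * enn2real (u x)) \<partial>lborel)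
           + (\<integral>\<^sup>+x. ennreal ((deriv V x)\<^sup>2) \<partial>singular_part \<rho>)
      else \<infinity>)"

definition E_prime :: "(real \<Rightarrow> real) \<Rightarrow> real \<Rightarrow> real" where
  "E_prime \<beta> r = - (LINT s:{r<..}|lborel. deriv \<beta> s / s)"

definition E_fun :: "(real \<Rightarrow> real) \<Rightarrow> real \<Rightarrow> real" where
  "E_fun \<beta> r = (if r = 0 then 0 else - \<beta> r - r * (LINT s:{r<..}|lborel. deriv \<beta> s / s))"

definition d_threshold :: "(real \<Rightarrow> real) \<Rightarrow> ennreal" where
  "d_threshold \<beta> = (\<integral>\<^sup>+s\<in>{0<..}. ennreal (deriv \<beta> s / s) \<partial>lborel)"

text \<open>Only arguments \<open>v > 0\<close> are meaningful.\<close>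

definition H_fun :: "(real \<Rightarrow> real) \<Rightarrow> real \<Rightarrow> real" where
  "H_fun \<beta> v = (if ennreal v < d_threshold \<beta> then the_inv_into {0<..} (E_prime \<beta>) (- v) else 0)"

definition V_min :: "(real \<Rightarrow> real) \<Rightarrow> real" where
  "V_min V = Inf (range V)"

definition Q_set :: "(real \<Rightarrow> real) \<Rightarrow> real set" where
  "Q_set V = {x. V x = V_min V}"

text \<open>Integral of a function whose negative part has finite integral, with values in
  \<open>(-\<infinity>,+\<infinity>]\<close>.\<close>

definition ext_integral :: "'a measure \<Rightarrow> ('a \<Rightarrow> real) \<Rightarrow> ereal" where
  "ext_integral M f =
     enn2ereal (\<integral>\<^sup>+x. ennreal (f x) \<partial>M) - enn2ereal (\<integral>\<^sup>+x. ennreal (- f x) \<partial>M)"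

text \<open>The functional \<open>\<integral> E(u) dx + \<integral> V d\<rho>\<close>. For measures without moments the first integral may be
  \<open>-\<infinity>\<close> and the second \<open>+\<infinity>\<close>: for \<open>\<beta>(r) = r\<close> near \<open>0\<close> and \<open>V(x) = ln \<bar>x\<bar> + 2 ln (ln \<bar>x\<bar>)\<close>
  for large \<open>\<bar>x\<bar>\<close> this even happens for \<open>u = H(V - c)\<close>. Therefore \<open>V d\<rho>\<close> is split into
  \<open>V u dx\<close> and the singular contribution, and \<open>E(u) + V u\<close> is integrated as one function; its
  negative part is integrable as soon as \<open>\<beta>(H(V - V\<^sub>m\<^sub>i\<^sub>n))\<close> is, because
  \<open>E(u) + v u \<ge> - \<beta>(H(v))\<close>. The value is that of \<open>\<integral> E(u) dx + \<integral> V d\<rho>\<close> whenever the latter is not of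
  the form \<open>\<infinity> - \<infinity>\<close>.\<close>

definition F_functional :: "(real \<Rightarrow> real) \<Rightarrow> (real \<Rightarrow> real) \<Rightarrow> real measure \<Rightarrow> ereal" where
  "F_functional \<beta> V \<rho> =
     (let u = (\<lambda>x. enn2real (ac_density \<rho> x)) in
      ext_integral lborel (\<lambda>x. E_fun \<beta> (u x) + V x * u x) + ext_integral (singular_part \<rho>) V)"

definition minimizer_F :: "(real \<Rightarrow> real) \<Rightarrow> (real \<Rightarrow> real) \<Rightarrow> real \<Rightarrow> real measure \<Rightarrow> bool" where
  "minimizer_F \<beta> V m \<rho> \<longleftrightarrow> is_arg_min (F_functional \<beta> V) (\<lambda>\<mu>. \<mu> \<in> Mplus_mass m) \<rho>"

text \<open>Points of \<open>(0,+\<infinity>) \<times> \<real>\<close> are pairs \<open>(t, x)\<close>; the directions \<open>(1, 0)\<close> and \<open>(0, 1)\<close> give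
  \<open>\<partial>\<^sub>t\<close> and \<open>\<partial>\<^sub>x\<close>.\<close>

definition wasserstein_solution ::
    "(real \<Rightarrow> real) \<Rightarrow> (real \<Rightarrow> real) \<Rightarrow> real \<Rightarrow> (real \<Rightarrow> real measure) \<Rightarrow> bool" where
  "wasserstein_solution \<beta> V m \<rho> \<longleftrightarrow>
     (\<forall>t\<ge>0. \<rho> t \<in> M2 m) \<and>
     (\<forall>t\<ge>0. ((\<lambda>s. wasserstein2 (\<rho> s) (\<rho> t)) \<longlongrightarrow> 0) (at t within {0..})) \<and>
     (AE t in lborel. t > 0 \<longrightarrow> \<rho> t \<in> Mplus_c) \<and>
     (\<forall>T0 T1. 0 < T0 \<and> T0 < T1 \<longrightarrow> (\<integral>\<^sup>+t\<in>{T0..T1}. dissipation \<beta> V (\<rho> t) \<partial>lborel) < \<infinity>) \<and>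
     (\<forall>\<phi>. test_function ({0<..} \<times> UNIV) \<phi> \<longrightarrow>
        (LINT t:{0<..}|lborel. LINT x|\<rho> t.
           - frechet_derivative \<phi> (at (t, x)) (1, 0)
           + frechet_derivative \<phi> (at (t, x)) (0, 1) * deriv V x)
        + (LINT t:{0<..}|lborel. LINT x|lborel.
             frechet_derivative \<phi> (at (t, x)) (0, 1)
             * weak_deriv (\<lambda>y. beta_ext \<beta> (cont_density (\<rho> t) y)) x) = 0)"

definition stationary_solution ::
    "(real \<Rightarrow> real) \<Rightarrow> (real \<Rightarrow> real) \<Rightarrow> real \<Rightarrow> real measure \<Rightarrow> bool" where
  "stationary_solution \<beta> V m \<rho> \<longleftrightarrow> wasserstein_solution \<beta> V m (\<lambda>t. \<rho>)"

end

theory Submission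
  imports Defs
begin

text \<open>Put \<open>P = - E'\<close>, that is \<open>P(r) = \<integral>\<^sub>r\<^sup>\<infinity> \<beta>'(s)/s ds\<close>, and let \<open>H\<close> be the inverse of \<open>P\<close>. A measure is
called an equilibrium at level \<open>C \<le> min V\<close> if its density is \<open>H(V - C)\<close>, with the value \<open>+\<infinity>\<close> on
the null set \<open>{V = C}\<close>, and if its singular part is carried by \<open>{V = C}\<close>. Vanishing dissipation,
stationarity and minimality are each shown to mean being an equilibrium at some level.

Apart from bounds on its size, all that has to be known about \<open>\<beta>\<close> is the inequality
\<open>(\<beta>(b) - \<beta>(a))/b < P(a) - P(b) < (\<beta>(b) - \<beta>(a))/a\<close> for \<open>0 < a < b\<close> (\<open>P_increment\<close>) and the divergence
of \<open>P\<close> at \<open>0\<close>. The inequality says that \<open>P\<close>, seen as a function of \<open>\<beta>\<close>, has the derivative \<open>-1/r\<close>, also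
where \<open>\<beta>'\<close> vanishes and a chain rule through \<open>r\<close> is impossible. It yields the derivative \<open>-H\<close> of
\<open>\<beta> \<circ> H\<close>, the derivative of \<open>P(u)\<close> from that of \<open>\<beta>(u)\<close>, and the Legendre inequality
\<open>E(r) + v r \<ge> - \<beta>(H(v))\<close> with equality only at \<open>r = H(v)\<close>.

If the dissipation vanishes, then \<open>\<beta>(u)' = - u V'\<close> on \<open>{0 < u < \<infinity>}\<close>, hence \<open>P(u) - V\<close> is locally
constant there. As \<open>P\<close> blows up at \<open>0\<close> while \<open>V\<close> is locally bounded, \<open>u\<close> cannot vanish at an end point
of a component, so it is positive everywhere (\<open>zero_flux_no_zero\<close>). With \<open>P(\<infinity>) = 0\<close> the function
\<open>V - P(u)\<close> is continuous on the line, locally constant off the null set \<open>{u = \<infinity>}\<close>, and equal to the \<open>C\<^sup>1\<close> function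
\<open>V\<close> on that set. Its range is therefore both null and connected, hence a point
(\<open>zero_flux_imp_profile\<close>); this is what excludes different levels on different components.
Conversely, \<open>\<beta>(H(V - C))\<close> has the weak derivative \<open>- H(V - C) V'\<close>, by approximation of \<open>C\<close> from below,
and \<open>V' = 0\<close> where the singular part lives, as the minimum of \<open>V\<close> is attained there.

If the constant curve solves the equation, products of a function of \<open>t\<close> and one of \<open>x\<close> as test
functions show that \<open>V' \<rho> + \<beta>(u)'\<close> is a multiple \<open>c\<close> of Lebesgue measure. Its singular part gives
\<open>V' = 0\<close> almost everywhere for \<open>\<rho>\<^sup>\<bottom>\<close>, and the dissipation becomes \<open>\<integral> c\<^sup>2/u\<close>. At a zero of \<open>u\<close> the
function \<open>\<beta>(u)\<close> is minimal and has the derivative \<open>c\<close>, so \<open>c = 0\<close>; without zeros,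
\<open>2 \<bar>c\<bar> \<le> c\<^sup>2/u + u\<close> is integrable on the line, so again \<open>c = 0\<close>
(\<open>stationary_imp_dissipation_zero\<close>).

Integration of the Legendre inequality with \<open>v = V - C\<close> bounds the free energy of a measure of mass
\<open>m\<close> from below by \<open>C m - \<integral> \<beta>(H(V - C)) dx\<close>, with equality exactly for the equilibria at level \<open>C\<close>
(\<open>equilibrium_minimality\<close>). That all minimizers are equilibria then follows once some equilibrium has
mass \<open>m\<close> (\<open>ex_equilibrium\<close>): the mass of \<open>H(V - C)\<close> grows continuously from \<open>0\<close> as \<open>C\<close> increases to
\<open>min V\<close>, and if it stays below \<open>m\<close>, a point mass at a minimum point of \<open>V\<close> makes up for the rest.\<close>

section \<open>Smooth test functions on the line\<close>

lemma Ck_real_Suc: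
  fixes f :: "real \<Rightarrow> real"
  shows "Ck (Suc k) f \<longleftrightarrow> (\<forall>x. f differentiable (at x)) \<and> Ck k (deriv f)"
proof -
  have "frechet_derivative f (at x) 1 = deriv f x" if "f differentiable (at x)" for x
  proof -
    have "(f has_real_derivative deriv f x) (at x)"
      using that DERIV_deriv_iff_real_differentiable by blast
    then show ?thesis
      using frechet_derivative_at[of f "(*) (deriv f x)" x]
      by (metis has_field_derivative_def mult.right_neutral)
  qed
  then have "(\<lambda>x. frechet_derivative f (at x) 1) = deriv f" if "\<forall>x. f differentiable (at x)"
    using that by auto
  then show ?thesis by auto
qed

text \<open>For functions of one variable the recursion defining \<open>Ck\<close> runs through the ordinary derivative,
so that closure properties follow by induction from the differentiation rules.\<close>

lemma Ck_SucI:
  fixes f :: "real \<Rightarrow> real"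
  assumes "\<And>x. (f has_real_derivative f' x) (at x)" "Ck k f'"
  shows "Ck (Suc k) f"
proof -
  have "deriv f = f'" using assms(1) DERIV_imp_deriv by blast
  then show ?thesis
    using assms real_differentiable_def unfolding Ck_real_Suc by metis
qed

lemma Ck_SucD:
  fixes f :: "real \<Rightarrow> real"
  assumes "Ck (Suc k) f"
  shows "(f has_real_derivative deriv f x) (at x)" "Ck k (deriv f)"
  using assms DERIV_deriv_iff_real_differentiable unfolding Ck_real_Suc by blast+

lemma Ck_Suc_imp:
  fixes f :: "real \<Rightarrow> real"
  shows "Ck (Suc k) f \<Longrightarrow> Ck k f"
proof (induction k arbitrary: f)
  case 0
  then show ?case
    by (auto intro!: continuous_at_imp_continuous_on DERIV_isCont[OF Ck_SucD(1)] simp del: Ck.simps(2))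
next
  case (Suc k)
  show ?case
    by (rule Ck_SucI[OF Ck_SucD(1)[OF Suc(2)]]) (rule Suc(1)[OF Ck_SucD(2)[OF Suc(2)]])
qed

lemma Ck_continuous:
  fixes f :: "real \<Rightarrow> real"
  shows "Ck k f \<Longrightarrow> continuous_on UNIV f"
proof (induction k)
  case (Suc k)
  then show ?case using Ck_Suc_imp by blast
qed simp

lemma Ck_const: "Ck k (\<lambda>x::real. c)"
proof (induction k arbitrary: c)
  case (Suc k)
  show ?case by (rule Ck_SucI[where f'="\<lambda>x. 0"]) (auto intro: Suc)
qed simp

lemma Ck_id: "Ck k (\<lambda>x::real. x)"
proof (cases k)
  case (Suc k)
  show ?thesis unfolding Suc by (rule Ck_SucI[where f'="\<lambda>x. 1"]) (auto intro: Ck_const)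
qed simp

lemma Ck_add:
  fixes f g :: "real \<Rightarrow> real"
  shows "Ck k f \<Longrightarrow> Ck k g \<Longrightarrow> Ck k (\<lambda>x. f x + g x)"
proof (induction k arbitrary: f g)
  case (Suc k)
  show ?case
    by (rule Ck_SucI[where f'="\<lambda>x. deriv f x + deriv g x"])
       (use Suc(1)[OF Ck_SucD(2)[OF Suc(2)] Ck_SucD(2)[OF Suc(3)]]
          DERIV_add[OF Ck_SucD(1)[OF Suc(2)] Ck_SucD(1)[OF Suc(3)]] in auto)
qed (auto intro!: continuous_intros)

lemma Ck_mult:
  fixes f g :: "real \<Rightarrow> real"
  shows "Ck k f \<Longrightarrow> Ck k g \<Longrightarrow> Ck k (\<lambda>x. f x * g x)"
proof (induction k arbitrary: f g)
  case (Suc k)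
  have "Ck k (\<lambda>x. deriv f x * g x + f x * deriv g x)"
    using Suc Ck_SucD Ck_Suc_imp by (intro Ck_add) blast+
  moreover have "((\<lambda>x. f x * g x) has_real_derivative deriv f x * g x + f x * deriv g x) (at x)" for x
    using DERIV_mult[OF Ck_SucD(1)[OF Suc(2)] Ck_SucD(1)[OF Suc(3)]] by (simp add: algebra_simps)
  ultimately show ?case by (rule Ck_SucI[rotated])
qed (auto intro!: continuous_intros)

lemma Ck_diff:
  fixes f g :: "real \<Rightarrow> real"
  shows "Ck k f \<Longrightarrow> Ck k g \<Longrightarrow> Ck k (\<lambda>x. f x - g x)"
  using Ck_add[of k f "\<lambda>x. (-1) * g x"] Ck_mult[OF Ck_const[of k "-1"], of g] by simp

lemma Ck_inverse:
  fixes f :: "real \<Rightarrow> real"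
  assumes "\<And>x. f x \<noteq> 0"
  shows "Ck k f \<Longrightarrow> Ck k (\<lambda>x. inverse (f x))"
proof (induction k)
  case 0
  then show ?case using assms by (auto intro!: continuous_intros)
next
  case (Suc k)
  have 1: "Ck k (\<lambda>x. inverse (f x))" "Ck k (deriv f)"
    using Suc Ck_SucD Ck_Suc_imp by blast+
  show ?case
  proof (rule Ck_SucI)
    show "Ck k (\<lambda>x. (-1) * (deriv f x * (inverse (f x) * inverse (f x))))"
      by (intro Ck_mult Ck_const 1)
    show "((\<lambda>x. inverse (f x)) has_real_derivative (-1) * (deriv f x * (inverse (f x) * inverse (f x)))) (at x)" for x
      using DERIV_inverse_fun[OF Ck_SucD(1)[OF Suc(2)] assms, of x] by (simp add: algebra_simps)
  qed
qed

lemma Ck_affine: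
  fixes f :: "real \<Rightarrow> real"
  shows "Ck k f \<Longrightarrow> Ck k (\<lambda>x. f (a * x + b))"
proof (induction k arbitrary: f)
  case 0
  then show ?case by (auto intro!: continuous_on_compose2[of UNIV f] continuous_intros)
next
  case (Suc k)
  show ?case
  proof (rule Ck_SucI)
    show "Ck k (\<lambda>x. a * deriv f (a * x + b))"
      using Suc Ck_SucD by (intro Ck_mult Ck_const) blast
    show "((\<lambda>x. f (a * x + b)) has_real_derivative a * deriv f (a * x + b)) (at x)" for x
      by (rule DERIV_chain2[OF Ck_SucD(1)[OF Suc(2)], THEN DERIV_cong])
         (auto intro!: derivative_eq_intros)
  qed
qed

text \<open>The powers in the denominator make this family closed under differentiation up to linear
combinations, so that smoothness of all members is a single induction.\<close>

definition flat :: "nat \<Rightarrow> real \<Rightarrow> real" where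
  "flat n x = (if x > 0 then exp (- (1 / x)) / x ^ n else 0)"

lemma flat_tendsto_0: "(flat n \<longlongrightarrow> 0) (at_right 0)"
proof -
  have "((\<lambda>y::real. y ^ n / exp y) \<longlongrightarrow> 0) at_top" by (rule tendsto_power_div_exp_0)
  then have "((\<lambda>x::real. (inverse x) ^ n / exp (inverse x)) \<longlongrightarrow> 0) (at_right 0)"
    by (rule filterlim_compose[OF _ filterlim_inverse_at_top_right])
  then show ?thesis
  proof (rule Lim_transform_eventually)
    show "\<forall>\<^sub>F x in at_right 0. (inverse x) ^ n / exp (inverse x) = flat n x"
      by (auto simp: eventually_at_filter flat_def exp_minus field_simps)
  qed
qed

lemma flat_has_deriv:
  "(flat n has_real_derivative flat (n + 2) x - real n * flat (n + 1) x) (at x)"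
proof -
  consider "x > 0" | "x < 0" | "x = 0" by linarith
  then show ?thesis
  proof cases
    case 1
    have "((\<lambda>x. exp (- (1 / x)) / x ^ n) has_real_derivative flat (n + 2) x - real n * flat (n + 1) x) (at x)"
      using 1 power_minus_mult[of n x]
      by (cases "n = 0") (auto intro!: derivative_eq_intros simp: flat_def field_simps power2_eq_square)
    then show ?thesis
    proof (rule has_field_derivative_transform_within_open[where S="{0<..}"])
    qed (use 1 in \<open>auto simp: flat_def\<close>)
  next
    case 2
    have "((\<lambda>x. 0) has_real_derivative 0) (at x)" by simp
    then have "(flat n has_real_derivative 0) (at x)"
      by (rule has_field_derivative_transform_within_open[where S="{..<0}"]) (use 2 in \<open>auto simp: flat_def\<close>)
    then show ?thesis using 2 by (simp add: flat_def)
  next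
    case 3
    have r: "((\<lambda>y. (flat n y - flat n 0) / (y - 0)) \<longlongrightarrow> 0) (at_right 0)"
      by (rule Lim_transform_eventually[OF flat_tendsto_0[of "Suc n"]])
         (auto simp: eventually_at_filter flat_def)
    have l: "((\<lambda>y. (flat n y - flat n 0) / (y - 0)) \<longlongrightarrow> 0) (at_left 0)"
      by (rule tendsto_eventually) (auto simp: eventually_at_filter flat_def)
    have "(flat n has_real_derivative 0) (at 0)"
      unfolding has_field_derivative_iff using r l by (simp add: filterlim_split_at)
    then show ?thesis using 3 by (simp add: flat_def)
  qed
qed

lemma Ck_flat: "Ck k (flat n)"
proof (induction k arbitrary: n)
  case 0
  show ?case by (auto intro!: continuous_at_imp_continuous_on DERIV_isCont[OF flat_has_deriv])
next
  case (Suc k)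
  show ?case
    by (rule Ck_SucI[OF flat_has_deriv]) (intro Ck_diff Ck_mult Ck_const Suc)
qed

text \<open>The usual smooth transition from \<open>0\<close> to \<open>1\<close> on \<open>[0,1]\<close>. Rescaled, its derivative is an
approximate identity, and differences of its translates approximate indicators of intervals.\<close>

definition smooth_step :: "real \<Rightarrow> real" where
  "smooth_step x = flat 0 x * inverse (flat 0 x + flat 0 (1 - x))"

lemma flat_0_nonneg: "flat 0 x \<ge> 0" by (simp add: flat_def)

lemma flat_0_sum_pos: "flat 0 x + flat 0 (1 - x) > 0"
  by (cases "x > 0") (auto simp: flat_def add_pos_pos)

lemma Ck_smooth_step: "Ck k smooth_step"
proof -
  have "Ck k (\<lambda>x. flat 0 x * inverse (flat 0 x + flat 0 ((-1) * x + 1)))"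
    using flat_0_sum_pos
    by (intro Ck_mult Ck_inverse Ck_add Ck_flat Ck_affine[OF Ck_flat]) (smt (verit))
  then show ?thesis by (simp add: smooth_step_def[abs_def])
qed

lemma smooth_step_0: "x \<le> 0 \<Longrightarrow> smooth_step x = 0"
  by (simp add: smooth_step_def flat_def)

lemma smooth_step_1: "x \<ge> 1 \<Longrightarrow> smooth_step x = 1"
  by (simp add: smooth_step_def flat_def)

lemma smooth_step_bounds: "0 \<le> smooth_step x" "smooth_step x \<le> 1"
  using flat_0_nonneg[of x] flat_0_nonneg[of "1 - x"] flat_0_sum_pos[of x]
  by (auto simp: smooth_step_def field_simps)

lemma smooth_step_deriv: "(smooth_step has_real_derivative deriv smooth_step x) (at x)"
  using Ck_SucD(1)[OF Ck_smooth_step] .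

lemma continuous_deriv_smooth_step: "continuous_on A (deriv smooth_step)"
  using Ck_continuous[OF Ck_SucD(2)[OF Ck_smooth_step]] continuous_on_subset by blast

text \<open>Outside \<open>(0,1)\<close> the step attains its minimum \<open>0\<close> or its maximum \<open>1\<close>; this includes the two end
points.\<close>

lemma deriv_smooth_step_outside:
  assumes "x \<notin> {0<..<1}" shows "deriv smooth_step x = 0"
proof (cases "x \<le> 0")
  case True
  then show ?thesis
    using DERIV_local_min[OF smooth_step_deriv, of 1 x] smooth_step_bounds by (simp add: smooth_step_0)
next
  case False
  then show ?thesis
    using DERIV_local_max[OF smooth_step_deriv, of 1 x] smooth_step_bounds assms by (simp add: smooth_step_1)
qed

section \<open>Weak derivatives of continuous functions\<close>

lemma continuous_bounded_on_interval:
  fixes f :: "real \<Rightarrow> real"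
  assumes "continuous_on UNIV f"
  obtains B where "\<And>x. x \<in> {a..b} \<Longrightarrow> \<bar>f x\<bar> \<le> B"
proof -
  have "bounded (f ` {a..b})"
    using assms by (intro compact_imp_bounded compact_continuous_image) (auto intro: continuous_on_subset)
  then obtain B where "\<forall>y\<in>f ` {a..b}. norm y \<le> B" unfolding bounded_iff by blast
  then show thesis by (intro that[of B]) auto
qed

lemma test_function_UNIV_I:
  fixes \<phi> :: "real \<Rightarrow> real"
  assumes "\<And>k. Ck k \<phi>" and "\<And>x. x \<notin> {a..b} \<Longrightarrow> \<phi> x = 0"
  shows "test_function UNIV \<phi>"
proof -
  have "closure {x. \<phi> x \<noteq> 0} \<subseteq> {a..b}"
    using assms(2) by (intro closure_minimal subsetI) (blast, simp)
  then have "compact (closure {x. \<phi> x \<noteq> 0})"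
    using bounded_subset[OF bounded_closed_interval] by (auto simp: compact_eq_bounded_closed)
  then show ?thesis using assms(1) by (simp add: test_function_def)
qed

lemma test_functionD:
  fixes \<phi> :: "real \<Rightarrow> real"
  assumes "test_function UNIV \<phi>"
  obtains a b where "a < b" and "\<And>x. x \<notin> {a..b} \<Longrightarrow> \<phi> x = 0" and "\<And>x. x \<notin> {a..b} \<Longrightarrow> deriv \<phi> x = 0"
    and "\<And>x. (\<phi> has_real_derivative deriv \<phi> x) (at x)" and "continuous_on UNIV \<phi>" and "continuous_on UNIV (deriv \<phi>)"
proof -
  let ?S = "closure {x. \<phi> x \<noteq> 0}"
  have C: "Ck k \<phi>" for k using assms by (auto simp: test_function_def)
  have c: "compact ?S" using assms by (auto simp: test_function_def)
  obtain a where "\<forall>x\<in>?S. norm x \<le> a"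
    using compact_imp_bounded[OF c] unfolding bounded_iff by blast
  then have a: "x \<in> {-a..a}" if "x \<in> ?S" for x using that by (auto simp: abs_le_iff)
  define A where "A = max a 1"
  have z: "\<phi> x = 0" if "x \<notin> ?S" for x using that closure_subset[of "{x. \<phi> x \<noteq> 0}"] by auto
  have d: "(\<phi> has_real_derivative deriv \<phi> x) (at x)" for x using Ck_SucD(1)[OF C] .
  have dz: "deriv \<phi> x = 0" if "x \<notin> ?S" for x
  proof (rule DERIV_imp_deriv, rule has_field_derivative_transform_within_open[where S="- ?S"])
    show "((\<lambda>x. 0) has_real_derivative 0) (at x)" by simp
    show "open (- ?S)" by (rule open_Compl) simp
    show "x \<in> - ?S" using that by simp
    show "0 = \<phi> y" if "y \<in> - ?S" for y using z[of y] that by simp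
  qed
  show thesis
  proof (rule that)
    show "- A < A" by (simp add: A_def)
    have "x \<notin> ?S" if "x \<notin> {-A..A}" for x using that a[of x] by (auto simp: A_def)
    then show "x \<notin> {-A..A} \<Longrightarrow> \<phi> x = 0" "x \<notin> {-A..A} \<Longrightarrow> deriv \<phi> x = 0" for x
      by (blast intro: z dz)+
    show "continuous_on UNIV \<phi>" "continuous_on UNIV (deriv \<phi>)"
      by (rule Ck_continuous[OF C[of 0]], rule Ck_continuous[OF Ck_SucD(2)[OF C[of "Suc 0"]]])
  qed (rule d)
qed

lemma set_integrable_continuous_finite:
  fixes f :: "real \<Rightarrow> real"
  assumes "sets M = sets borel" "finite_measure M" "continuous_on UNIV f"
  shows "set_integrable M {a..b} f"
proof -
  obtain B where B: "\<And>x. x \<in> {a..b} \<Longrightarrow> \<bar>f x\<bar> \<le> B"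
    using continuous_bounded_on_interval[OF assms(3)] by blast
  interpret finite_measure M by fact
  have m: "f \<in> borel_measurable M"
    using borel_measurable_continuous_onI[OF assms(3)] measurable_cong_sets[OF assms(1)] by blast
  have "{a..b} \<in> sets M" using assms(1) by simp
  with m have "(\<lambda>x. indicat_real {a..b} x *\<^sub>R f x) \<in> borel_measurable M"
    by (intro borel_measurable_scaleR borel_measurable_indicator)
  then show ?thesis unfolding set_integrable_def
    by (rule integrable_const_bound[where B="\<bar>B\<bar>", rotated]) (use B in \<open>force simp: indicator_def\<close>)
qed

lemma locally_integrable_continuous:
  fixes f :: "real \<Rightarrow> real"
  assumes "continuous_on UNIV f"
  shows "locally_integrable f"
  unfolding locally_integrable_def using assms
  by (auto intro!: borel_integrable_atLeastAtMost' continuous_on_subset[OF assms])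

lemma integrable_locally_supported:
  fixes f :: "real \<Rightarrow> real"
  assumes "set_integrable M {a..b} f" "\<And>x. x \<notin> {a..b} \<Longrightarrow> f x = 0"
  shows "integrable M f" "(LINT x:{a..b}|M. f x) = (LINT x|M. f x)"
proof -
  have "(\<lambda>x. indicat_real {a..b} x *\<^sub>R f x) = f" using assms(2) by (force simp: indicator_def)
  then show "integrable M f" "(LINT x:{a..b}|M. f x) = (LINT x|M. f x)"
    using assms(1) by (simp_all add: set_integrable_def set_lebesgue_integral_def)
qed

lemma set_integrable_times_continuous:
  fixes f \<phi> :: "real \<Rightarrow> real"
  assumes M: "sets M = sets borel" and f: "set_integrable M {a..b} f" and c: "continuous_on UNIV \<phi>"
  shows "set_integrable M {a..b} (\<lambda>x. \<phi> x * f x)"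
proof -
  obtain B where B: "\<And>x. x \<in> {a..b} \<Longrightarrow> \<bar>\<phi> x\<bar> \<le> B"
    using continuous_bounded_on_interval[OF c] by blast
  have m: "\<phi> \<in> borel_measurable M"
    using borel_measurable_continuous_onI[OF c] measurable_cong_sets[OF M] by blast
  have e: "indicat_real {a..b} x *\<^sub>R (\<phi> x * f x) = \<phi> x * (indicat_real {a..b} x *\<^sub>R f x)" for x by simp
  have fm: "(\<lambda>x. indicat_real {a..b} x *\<^sub>R f x) \<in> borel_measurable M"
    using f by (simp add: set_integrable_def)
  show ?thesis unfolding set_integrable_def e
  proof (rule Bochner_Integration.integrable_bound)
    show "integrable M (\<lambda>x. B * (indicat_real {a..b} x *\<^sub>R f x))"
      using f by (simp add: set_integrable_def)
    show "(\<lambda>x. \<phi> x * (indicat_real {a..b} x *\<^sub>R f x)) \<in> borel_measurable M" using m fm by measurable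
    show "AE x in M. norm (\<phi> x * (indicat_real {a..b} x *\<^sub>R f x)) \<le> norm (B * (indicat_real {a..b} x *\<^sub>R f x))"
    proof (rule AE_I2)
      fix x show "norm (\<phi> x * (indicat_real {a..b} x *\<^sub>R f x)) \<le> norm (B * (indicat_real {a..b} x *\<^sub>R f x))"
        using B[of x] by (cases "x \<in> {a..b}") (auto simp: abs_mult intro!: mult_right_mono)
    qed
  qed
qed

lemma integrable_times_continuous_supported:
  fixes f \<phi> :: "real \<Rightarrow> real"
  assumes "sets M = sets borel" "set_integrable M {a..b} f" "continuous_on UNIV \<phi>"
    and z: "\<And>x. x \<notin> {a..b} \<Longrightarrow> \<phi> x = 0"
  shows "integrable M (\<lambda>x. \<phi> x * f x)"
  by (rule integrable_locally_supported(1)[OF set_integrable_times_continuous[OF assms(1-3)]]) (simp add: z)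

lemma set_integral_deriv:
  fixes f f' :: "real \<Rightarrow> real"
  assumes "\<And>x. (f has_real_derivative f' x) (at x)" "continuous_on UNIV f'" "a \<le> b"
  shows "(LINT x:{a..b}|lborel. f' x) = f b - f a"
  unfolding set_lebesgue_integral_def
proof (rule integral_FTC_atLeastAtMost[OF assms(3)])
  show "(f has_vector_derivative f' x) (at x within {a..b})" for x
    using assms(1) by (simp add: has_real_derivative_iff_has_vector_derivative has_vector_derivative_at_within)
  show "continuous_on {a..b} f'" using assms(2) continuous_on_subset by blast
qed

text \<open>Apart from \<open>smooth_step\<close> this covers the derivative of \<open>x * smooth_step x\<close>, which need not stay in
\<open>[0,1]\<close>.\<close>

definition step_like :: "(real \<Rightarrow> real) \<Rightarrow> bool" where
  "step_like s \<longleftrightarrow> continuous_on UNIV s \<and> (\<forall>x\<le>0. s x = 0) \<and> (\<forall>x\<ge>1. s x = 1)"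

lemma step_like_tendsto:
  assumes "step_like s"
  shows "(\<lambda>n. s (real (Suc n) * t)) \<longlonglongrightarrow> (if t > 0 then 1 else 0)"
proof (cases "t > 0")
  case True
  obtain N where N: "1 / t < real N" using reals_Archimedean2 by blast
  have "s (real (Suc n) * t) = 1" if "n \<ge> N" for n
  proof -
    have "1 / t \<le> real (Suc n)" using N that by simp
    then show ?thesis using assms True by (simp add: step_like_def field_simps)
  qed
  then have "\<forall>\<^sub>F n in sequentially. s (real (Suc n) * t) = 1" by (auto simp: eventually_sequentially)
  then show ?thesis using True by (simp add: tendsto_eventually)
next
  case False
  then have "s (real (Suc n) * t) = 0" for n
    using assms by (simp add: step_like_def mult_nonneg_nonpos)
  then show ?thesis using False by simp
qed

text \<open>Half-open intervals arise because the step vanishes at \<open>0\<close>; it matters when \<open>M\<close> has atoms.\<close>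

lemma step_like_interval:
  assumes s: "step_like s" and M: "sets M = sets borel" and f: "\<And>a b. set_integrable M {a..b} f"
    and ab: "a < b"
  shows "(\<lambda>n. LINT x|M. (s (real (Suc n) * (x - a)) - s (real (Suc n) * (x - b))) * f x)
           \<longlonglongrightarrow> (LINT x:{a<..b}|M. f x)" (is "(\<lambda>n. LINT x|M. ?p n x * f x) \<longlonglongrightarrow> _")
    and "integrable M (\<lambda>x. (s (real (Suc n) * (x - a)) - s (real (Suc n) * (x - b))) * f x)"
proof -
  have cs: "continuous_on UNIV s" and s0: "\<And>x. x \<le> 0 \<Longrightarrow> s x = 0" and s1: "\<And>x. x \<ge> 1 \<Longrightarrow> s x = 1"
    using s by (auto simp: step_like_def)
  obtain B where B: "\<And>x. x \<in> {0..1} \<Longrightarrow> \<bar>s x\<bar> \<le> B"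
    using continuous_bounded_on_interval[OF cs] by blast
  have B: "\<bar>s x\<bar> \<le> B + 1" for x
    using B[of x] B[of 0] s0[of x] s1[of x] by (cases "x \<le> 0"; cases "x \<ge> 1") auto
  have cp: "continuous_on UNIV (?p n)" for n
    by (intro continuous_intros continuous_on_compose2[OF cs]) auto
  have z: "?p n x = 0" if "x \<notin> {a..b+1}" for x n
  proof (cases "x < a")
    case True
    then show ?thesis using ab s0 by (simp add: mult_nonneg_nonpos)
  next
    case False
    then have x: "x > b + 1" using that by auto
    have "real (Suc n) * (x - b) \<ge> 1 * 1" "real (Suc n) * (x - a) \<ge> 1 * 1"
      by (rule mult_mono; use x ab in simp)+
    then show ?thesis using s1 by simp
  qed
  show int: "integrable M (\<lambda>x. ?p n x * f x)" for n
    by (rule integrable_times_continuous_supported[OF M f cp z])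
  define w where "w = (\<lambda>x. (2 * B + 2) * norm (indicat_real {a..b+1} x *\<^sub>R f x))"
  show "(\<lambda>n. LINT x|M. ?p n x * f x) \<longlonglongrightarrow> (LINT x:{a<..b}|M. f x)"
    unfolding set_lebesgue_integral_def
  proof (rule integral_dominated_convergence)
    have "{a<..b} \<in> sets M" using M by simp
    then have "set_integrable M {a<..b} f" by (rule set_integrable_subset[OF f[of a b]]) auto
    then show "(\<lambda>x. indicat_real {a<..b} x *\<^sub>R f x) \<in> borel_measurable M" by (simp add: set_integrable_def)
    show "(\<lambda>x. ?p n x * f x) \<in> borel_measurable M" for n using int by auto
    show "integrable M w" using f[of a "b+1"] unfolding w_def set_integrable_def
      by (intro integrable_mult_right integrable_norm)
    show "AE x in M. norm (?p n x * f x) \<le> w x" for n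
    proof (rule AE_I2)
      fix x
      have "\<bar>?p n x\<bar> \<le> 2 * B + 2"
        using B[of "real (Suc n) * (x - a)"] B[of "real (Suc n) * (x - b)"] by linarith
      then show "norm (?p n x * f x) \<le> w x"
        using z[of x n] by (cases "x \<in> {a..b+1}") (auto simp: w_def abs_mult intro: mult_right_mono)
    qed
    show "AE x in M. (\<lambda>n. ?p n x * f x) \<longlonglongrightarrow> indicat_real {a<..b} x *\<^sub>R f x"
    proof (rule AE_I2)
      fix x
      have "(\<lambda>n. ?p n x * f x) \<longlonglongrightarrow> ((if x - a > 0 then 1 else 0) - (if x - b > 0 then 1 else 0)) * f x"
        by (intro tendsto_intros step_like_tendsto s)
      moreover have "(if x - a > 0 then 1 else 0) - (if x - b > 0 then 1 else 0) = indicat_real {a<..b} x"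
        using ab by (auto simp: indicator_def)
      ultimately show "(\<lambda>n. ?p n x * f x) \<longlonglongrightarrow> indicat_real {a<..b} x *\<^sub>R f x" by simp
    qed
  qed
qed

lemma step_like_smooth_step: "step_like smooth_step"
  using Ck_continuous[OF Ck_smooth_step] smooth_step_0 smooth_step_1 by (auto simp: step_like_def)

lemma integral_deriv_smooth_step:
  "integrable lborel (deriv smooth_step)" "(LINT y|lborel. deriv smooth_step y) = 1"
proof -
  have si: "set_integrable lborel {0..1} (deriv smooth_step)"
    by (intro borel_integrable_atLeastAtMost' continuous_deriv_smooth_step)
  note * = integrable_locally_supported[OF si deriv_smooth_step_outside]
  show "integrable lborel (deriv smooth_step)" by (rule *) auto
  have "(LINT y|lborel. deriv smooth_step y) = (LINT y:{0..1}|lborel. deriv smooth_step y)"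
    by (rule *(2)[symmetric]) auto
  also have "\<dots> = smooth_step 1 - smooth_step 0"
    by (rule set_integral_deriv[OF smooth_step_deriv continuous_deriv_smooth_step]) simp
  finally show "(LINT y|lborel. deriv smooth_step y) = 1" by (simp add: smooth_step_0 smooth_step_1)
qed

text \<open>The mass of the kernel sits to the right of \<open>a\<close>, within distance \<open>1/(n+1)\<close>.\<close>

lemma approximate_identity:
  fixes f :: "real \<Rightarrow> real"
  assumes c: "continuous_on UNIV f"
  shows "(\<lambda>n. LINT x|lborel. f x * (real (Suc n) * deriv smooth_step (real (Suc n) * (x - a)))) \<longlonglongrightarrow> f a"
    and "integrable lborel (\<lambda>x. f x * (real (Suc n) * deriv smooth_step (real (Suc n) * (x - a))))"
proof -
  let ?S = "deriv smooth_step"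
  define K where "K n y = f (a + y / real (Suc n)) * ?S y" for n y
  obtain B where B: "\<And>x. x \<in> {a..a+1} \<Longrightarrow> \<bar>f x\<bar> \<le> B"
    using continuous_bounded_on_interval[OF c] by blast
  have cont: "continuous_on UNIV (\<lambda>x. f x * (real (Suc n) * ?S (real (Suc n) * (x - a))))" for n
    by (intro continuous_intros c continuous_on_compose2[OF continuous_deriv_smooth_step[of UNIV]]) auto
  show "integrable lborel (\<lambda>x. f x * (real (Suc n) * ?S (real (Suc n) * (x - a))))" for n
  proof (rule integrable_locally_supported(1)[where a=a and b="a + 1"])
    show "set_integrable lborel {a..a+1} (\<lambda>x. f x * (real (Suc n) * ?S (real (Suc n) * (x - a))))"
      by (intro borel_integrable_atLeastAtMost' continuous_on_subset[OF cont]) auto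
    fix x assume x: "x \<notin> {a..a+1}"
    have "real (Suc n) * (x - a) \<notin> {0<..<1}"
    proof (cases "x < a")
      case False
      then have "real (Suc n) * (x - a) \<ge> 1 * 1" using x by (intro mult_mono) auto
      then show ?thesis by simp
    qed (simp add: mult_le_0_iff zero_less_mult_iff)
    then show "f x * (real (Suc n) * ?S (real (Suc n) * (x - a))) = 0"
      using deriv_smooth_step_outside by simp
  qed
  have eq: "(LINT x|lborel. f x * (real (Suc n) * ?S (real (Suc n) * (x - a)))) = (LINT y|lborel. K n y)" for n
  proof -
    define c where "c = 1 / real (Suc n)"
    define G where "G x = f x * (real (Suc n) * ?S (real (Suc n) * (x - a)))" for x
    have c0: "c > 0" "c * real (Suc n) = 1" by (auto simp: c_def)
    have K: "K n y = c * G (a + c * y)" for y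
    proof -
      have "real (Suc n) * (a + c * y - a) = y" using c0(2) by (simp add: mult.commute[of c] mult.assoc[symmetric] del: of_nat_Suc)
      then have "c * G (a + c * y) = (c * real (Suc n)) * (f (a + c * y) * ?S y)" unfolding G_def by (simp only: ac_simps)
      then show ?thesis unfolding c0(2) by (simp add: K_def c_def)
    qed
    have "(LINT x|lborel. G x) = \<bar>c\<bar> *\<^sub>R (LINT y|lborel. G (a + c * y))"
      by (rule lborel_integral_real_affine) (use c0 in simp)
    also have "\<dots> = (LINT y|lborel. K n y)" unfolding K using c0 by simp
    finally show ?thesis unfolding G_def .
  qed
  have "(\<lambda>n. LINT y|lborel. K n y) \<longlonglongrightarrow> (LINT y|lborel. f a * ?S y)"
  proof (rule integral_dominated_convergence)
    show "(\<lambda>y. f a * ?S y) \<in> borel_measurable lborel"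
      using borel_measurable_continuous_onI[OF continuous_deriv_smooth_step] by simp
    have "continuous_on UNIV (K n)" for n unfolding K_def
      by (intro continuous_intros continuous_deriv_smooth_step continuous_on_compose2[OF c]) auto
    then show "K n \<in> borel_measurable lborel" for n using borel_measurable_continuous_onI[of "K n"] by simp
    show "integrable lborel (\<lambda>y. B * \<bar>?S y\<bar>)"
      using integral_deriv_smooth_step(1) by (intro integrable_mult_right integrable_abs)
    show "AE y in lborel. norm (K n y) \<le> B * \<bar>?S y\<bar>" for n
    proof (rule AE_I2)
      fix y show "norm (K n y) \<le> B * \<bar>?S y\<bar>"
      proof (cases "y \<in> {0<..<1}")
        case True
        then have "a + y / real (Suc n) \<in> {a..a+1}" by (auto simp: field_simps)
        then show ?thesis using B by (auto simp: K_def abs_mult intro!: mult_right_mono)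
      qed (simp add: K_def deriv_smooth_step_outside)
    qed
    show "AE y in lborel. (\<lambda>n. K n y) \<longlonglongrightarrow> f a * ?S y"
    proof (rule AE_I2)
      fix y
      have "(\<lambda>n. a + y * (1 / real (Suc n))) \<longlonglongrightarrow> a + y * 0"
        by (intro tendsto_intros LIMSEQ_Suc[OF lim_1_over_n])
      then have "(\<lambda>n. a + y / real (Suc n)) \<longlonglongrightarrow> a" by simp
      then have "(\<lambda>n. f (a + y / real (Suc n))) \<longlonglongrightarrow> f a"
        by (rule continuous_on_tendsto_compose[OF c]) auto
      then show "(\<lambda>n. K n y) \<longlonglongrightarrow> f a * ?S y" unfolding K_def by (intro tendsto_intros)
    qed
  qed
  then show "(\<lambda>n. LINT x|lborel. f x * (real (Suc n) * ?S (real (Suc n) * (x - a)))) \<longlonglongrightarrow> f a"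
    unfolding eq by (simp add: integral_deriv_smooth_step)
qed

text \<open>The fundamental theorem of calculus for weak derivatives: test with smoothed indicators of
\<open>(a,b]\<close>, whose derivatives concentrate at \<open>a\<close> and at \<open>b\<close>.\<close>

lemma weak_deriv_imp_increment:
  assumes W: "has_weak_deriv f g" and c: "continuous_on UNIV f" and ab: "a < b"
  shows "f b - f a = (LINT x:{a<..b}|lborel. g x)"
proof -
  let ?S = "deriv smooth_step"
  define \<phi> where "\<phi> n x = smooth_step (real (Suc n) * (x - a)) - smooth_step (real (Suc n) * (x - b))" for n x
  have g: "\<And>a b. set_integrable lborel {a..b} g" using W by (auto simp: has_weak_deriv_def locally_integrable_def)
  have C: "Ck k (\<lambda>x. smooth_step (real (Suc n) * (x - a)))" for k n a
    using Ck_affine[OF Ck_smooth_step, of k "real (Suc n)" "- real (Suc n) * a"] by (simp add: algebra_simps)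
  have T: "test_function UNIV (\<phi> n)" for n
  proof (rule test_function_UNIV_I)
    show "Ck k (\<phi> n)" for k unfolding \<phi>_def by (intro Ck_diff C)
    fix x assume x: "x \<notin> {a..b+1}"
    show "\<phi> n x = 0"
    proof (cases "x < a")
      case True
      then show ?thesis using ab by (simp add: \<phi>_def smooth_step_0 mult_nonneg_nonpos)
    next
      case False
      then have x: "x > b + 1" using x by auto
      have "real (Suc n) * (x - b) \<ge> 1 * 1" "real (Suc n) * (x - a) \<ge> 1 * 1"
        by (rule mult_mono; use x ab in simp)+
      then show ?thesis by (simp add: \<phi>_def smooth_step_1)
    qed
  qed
  have D: "deriv (\<phi> n) x = real (Suc n) * ?S (real (Suc n) * (x - a)) - real (Suc n) * ?S (real (Suc n) * (x - b))" for n x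
  proof (rule DERIV_imp_deriv)
    have "((\<lambda>x. smooth_step (real (Suc n) * (x - a))) has_real_derivative ?S (real (Suc n) * (x - a)) * real (Suc n)) (at x)" for a
      by (rule DERIV_chain2[OF smooth_step_deriv]) (auto intro!: derivative_eq_intros)
    from DERIV_diff[OF this[of a] this[of b]]
    show "(\<phi> n has_real_derivative real (Suc n) * ?S (real (Suc n) * (x - a)) - real (Suc n) * ?S (real (Suc n) * (x - b))) (at x)"
      unfolding \<phi>_def by (simp add: mult.commute)
  qed
  have lim: "(\<lambda>n. LINT x|lborel. f x * deriv (\<phi> n) x) \<longlonglongrightarrow> f a - f b"
    unfolding D right_diff_distrib[of "f _"]
    by (subst Bochner_Integration.integral_diff) (intro tendsto_diff approximate_identity c)+
  have eq: "(LINT x|lborel. f x * deriv (\<phi> n) x) = - (LINT x|lborel. g x * \<phi> n x)" for n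
    using W T[of n] unfolding has_weak_deriv_def by blast
  have "(\<lambda>n. LINT x|lborel. \<phi> n x * g x) \<longlonglongrightarrow> (LINT x:{a<..b}|lborel. g x)"
    unfolding \<phi>_def by (rule step_like_interval(1)[OF step_like_smooth_step _ g ab]) simp
  then have "(\<lambda>n. - (LINT x|lborel. g x * \<phi> n x)) \<longlonglongrightarrow> - (LINT x:{a<..b}|lborel. g x)"
    unfolding mult.commute[of "g _"] by (rule tendsto_minus)
  from LIMSEQ_unique[OF lim[unfolded eq] this] show ?thesis by simp
qed

section \<open>Measures and distributions determined by intervals\<close>

text \<open>Uniqueness of a signed measure from its values on intervals, for a signed measure that is given as
the sum of two densities with respect to different reference measures.\<close>

lemma set_integral_borel_vanishing:
  fixes f g :: "real \<Rightarrow> real"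
  assumes M: "sets M = sets borel" and N: "sets N = sets borel"
    and f: "integrable M f" and g: "integrable N g"
    and tot: "(LINT x|M. f x) + (LINT x|N. g x) = 0"
    and ivl: "\<And>a b. a < b \<Longrightarrow> (LINT x:{a<..b}|M. f x) + (LINT x:{a<..b}|N. g x) = 0"
    and A: "A \<in> sets borel"
  shows "(LINT x:A|M. f x) + (LINT x:A|N. g x) = 0"
proof -
  let ?G = "range (\<lambda>(a, b). {a<..b}) :: real set set"
  have spM: "space M = UNIV" "space N = UNIV" using sets_eq_imp_space_eq[OF M] sets_eq_imp_space_eq[OF N] by auto
  have si: "set_integrable M A f" "set_integrable N A g" if "A \<in> sets borel" for A
    using integrable_mult_indicator[OF _ f, of A] integrable_mult_indicator[OF _ g, of A] that M N
    by (auto simp: set_integrable_def)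
  have tot: "(LINT x:UNIV|M. f x) + (LINT x:UNIV|N. g x) = 0" using tot by (simp add: set_lebesgue_integral_def)
  have G: "sigma_sets UNIV ?G = sets borel" unfolding borel_sigma_sets_Ioc by simp
  have "Int_stable ?G"
  proof (rule Int_stableI)
    fix A B assume "A \<in> ?G" "B \<in> ?G"
    then obtain a b c d where "A = {a<..b}" "B = {c<..d}" by auto
    then have "A \<inter> B = (\<lambda>(a, b). {a<..b}) (max a c, min b d)" by auto
    then show "A \<inter> B \<in> ?G" by blast
  qed
  moreover have "?G \<subseteq> Pow UNIV" by auto
  moreover have "A \<in> sigma_sets UNIV ?G" using A G by simp
  ultimately show ?thesis
  proof (induction rule: sigma_sets_induct_disjoint)
    case (basic A)
    then obtain a b where A: "A = {a<..b}" by auto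
    show ?case
    proof (cases "a < b")
      case False
      then have "A = {}" unfolding A by simp
      then show ?thesis by (simp add: set_lebesgue_integral_def)
    qed (use ivl A in simp)
  next
    case empty
    then show ?case by (simp add: set_lebesgue_integral_def)
  next
    case (compl A)
    then have A: "A \<in> sets borel" using G by simp
    have "UNIV - A \<in> sets borel" using A by auto
    then have "(LINT x:A \<union> (UNIV - A)|M. f x) = (LINT x:A|M. f x) + (LINT x:UNIV - A|M. f x)"
      "(LINT x:A \<union> (UNIV - A)|N. g x) = (LINT x:A|N. g x) + (LINT x:UNIV - A|N. g x)"
      using si A by (intro set_integral_Un; blast)+
    moreover have "A \<union> (UNIV - A) = UNIV" by auto
    ultimately show ?case using compl tot by simp
  next
    case (union A)
    have A: "A i \<in> sets borel" for i using union(2) G by auto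
    define B where "B n = (\<Union>i<n. A i)" for n
    have B: "B n \<in> sets borel" for n unfolding B_def using A by auto
    have Bz: "(LINT x:B n|M. f x) + (LINT x:B n|N. g x) = 0" for n
    proof (induction n)
      case 0
      then show ?case by (simp add: B_def set_lebesgue_integral_def)
    next
      case (Suc n)
      have "A n \<inter> A i = {}" if "i < n" for i using union(1) that by (auto simp: disjoint_family_on_def)
      then have d: "A n \<inter> B n = {}" by (auto simp: B_def)
      have e: "B (Suc n) = A n \<union> B n" by (simp add: B_def lessThan_Suc)
      have "(LINT x:A n \<union> B n|M. f x) = (LINT x:A n|M. f x) + (LINT x:B n|M. f x)"
        "(LINT x:A n \<union> B n|N. g x) = (LINT x:A n|N. g x) + (LINT x:B n|N. g x)"
        by (intro set_integral_Un d si A B)+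
      then show ?case using Suc union(3)[rule_format, of n] unfolding e by linarith
    qed
    have U: "(\<Union>i. A i) = (\<Union>n. B n)" by (auto simp: B_def)
    have UB: "(\<Union>n. B n) \<in> sets borel" using B by auto
    have inc: "incseq B" by (auto simp: B_def incseq_def) (meson less_le_trans lessThan_iff)
    have "(\<lambda>n. (LINT x:B n|M. f x) + (LINT x:B n|N. g x)) \<longlonglongrightarrow> (LINT x:(\<Union>i. A i)|M. f x) + (LINT x:(\<Union>i. A i)|N. g x)"
      unfolding U by (intro tendsto_add set_integral_cont_up inc si UB) (use B M N in auto)
    then show ?case using LIMSEQ_unique[OF tendsto_const] unfolding Bz by metis
  qed
qed

text \<open>If \<open>k \<sigma> + h dx\<close> vanishes on intervals, it vanishes on all bounded Borel sets. Sets that avoid the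
null set carrying \<open>\<sigma>\<close> then give \<open>h = 0\<close>, and what remains gives \<open>k = 0\<close>.\<close>

lemma singular_pair_vanishing:
  fixes k h :: "real \<Rightarrow> real"
  assumes \<sigma>: "sets \<sigma> = sets borel" and k: "\<And>a b. set_integrable \<sigma> {a..b} k" and h: "locally_integrable h"
    and N: "N \<in> null_sets lborel" "emeasure \<sigma> (- N) = 0"
    and ivl: "\<And>a b. a < b \<Longrightarrow> (LINT x:{a<..b}|\<sigma>. k x) + (LINT x:{a<..b}|lborel. h x) = 0"
  shows "AE x in \<sigma>. k x = 0" "AE x in lborel. h x = 0"
proof -
  have hi: "set_integrable lborel {a..b} h" for a b using h by (simp add: locally_integrable_def)
  \<comment> \<open>localization: \<open>k\<close> and \<open>h\<close> are only locally integrable\<close>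
  define J where "J j = {- real (Suc j)<..real (Suc j)}" for j
  define kJ where "kJ j x = indicator (J j) x * k x" for j x
  define hJ where "hJ j x = indicator (J j) x * h x" for j x
  have kJi: "integrable \<sigma> (kJ j)" for j
  proof -
    have "set_integrable \<sigma> (J j) k" unfolding J_def
      by (rule set_integrable_subset[OF k[of "- real (Suc j)" "real (Suc j)"]]) (use \<sigma> in auto)
    then show ?thesis by (simp add: set_integrable_def kJ_def[abs_def])
  qed
  have hJi: "integrable lborel (hJ j)" for j
  proof -
    have "set_integrable lborel (J j) h" unfolding J_def
      by (rule set_integrable_subset[OF hi[of "- real (Suc j)" "real (Suc j)"]]) auto
    then show ?thesis by (simp add: set_integrable_def hJ_def[abs_def])
  qed
  have tr: "(LINT x:{a<..b}|\<sigma>. kJ j x) = (LINT x:{a<..b} \<inter> J j|\<sigma>. k x)"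
    "(LINT x:{a<..b}|lborel. hJ j x) = (LINT x:{a<..b} \<inter> J j|lborel. h x)" for a b j
    by (simp_all add: set_lebesgue_integral_def kJ_def hJ_def indicator_inter_arith ac_simps)
  have tr': "(LINT x|\<sigma>. kJ j x) = (LINT x:J j|\<sigma>. k x)" "(LINT x|lborel. hJ j x) = (LINT x:J j|lborel. h x)" for j
    by (simp_all add: set_lebesgue_integral_def kJ_def hJ_def)
  have P: "(LINT x:A|\<sigma>. kJ j x) + (LINT x:A|lborel. hJ j x) = 0" if "A \<in> sets borel" for A j
  proof (rule set_integral_borel_vanishing[OF \<sigma> _ kJi hJi _ _ that])
    show "(LINT x|\<sigma>. kJ j x) + (LINT x|lborel. hJ j x) = 0"
      unfolding tr' J_def by (rule ivl) simp
    fix a b :: real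
    have "{a<..b} \<inter> J j = {max a (- real (Suc j))<..min b (real (Suc j))}" by (auto simp: J_def)
    moreover have "(LINT x:{p<..q}|\<sigma>. k x) + (LINT x:{p<..q}|lborel. h x) = 0" for p q
      using ivl[of p q] by (cases "p < q") (auto simp: set_lebesgue_integral_def)
    ultimately show "(LINT x:{a<..b}|\<sigma>. kJ j x) + (LINT x:{a<..b}|lborel. hJ j x) = 0"
      unfolding tr by simp
  qed simp
  have spS: "space \<sigma> = UNIV" using sets_eq_imp_space_eq[OF \<sigma>] by simp
  have AEN: "AE x in \<sigma>. x \<in> N"
    by (rule AE_I[of _ _ "- N"]) (use N \<sigma> spS in auto)
  have AEN': "AE x in lborel. x \<notin> N" using N(1) AE_not_in by blast
  have hz: "(LINT x:A|lborel. hJ j x) = 0" if A: "A \<in> sets borel" for A j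
  proof -
    \<comment> \<open>off \<open>N\<close> only the Lebesgue part contributes\<close>
    have AN: "A - N \<in> sets borel" using A N by auto
    have meas: "(\<lambda>x. indicat_real B x *\<^sub>R f x) \<in> borel_measurable L"
      if "B \<in> sets borel" "sets L = sets borel" "integrable L f" for B L and f :: "real \<Rightarrow> real"
      using that by (intro borel_measurable_scaleR borel_measurable_indicator borel_measurable_integrable) auto
    have "(LINT x:A - N|lborel. hJ j x) = (LINT x:A|lborel. hJ j x)"
      unfolding set_lebesgue_integral_def
    proof (rule integral_cong_AE)
      show "AE x in lborel. indicat_real (A - N) x *\<^sub>R hJ j x = indicat_real A x *\<^sub>R hJ j x"
        using AEN' by eventually_elim (auto simp: indicator_def)
    qed (rule meas; use A AN hJi in auto)+
    moreover have "(LINT x:A - N|\<sigma>. kJ j x) = (LINT x:{}|\<sigma>. kJ j x)"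
      unfolding set_lebesgue_integral_def
    proof (rule integral_cong_AE)
      show "AE x in \<sigma>. indicat_real (A - N) x *\<^sub>R kJ j x = indicat_real {} x *\<^sub>R kJ j x"
        using AEN by eventually_elim (auto simp: indicator_def)
    qed (rule meas; use \<sigma> AN kJi in auto)+
    moreover note AN
    ultimately show ?thesis using P[of "A - N" j] by (simp add: set_lebesgue_integral_def)
  qed
  have kz: "(LINT x:A|\<sigma>. kJ j x) = 0" if A: "A \<in> sets borel" for A j using P[OF A] hz[OF A] by simp
  have "AE x in \<sigma>. kJ j x = 0" for j
    using density_unique_real[OF kJi[of j], of "\<lambda>x. 0"] kz \<sigma> by (simp add: set_lebesgue_integral_def)
  then have 1: "AE x in \<sigma>. \<forall>j. kJ j x = 0" by (simp add: AE_all_countable)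
  have "AE x in lborel. hJ j x = 0" for j
    using density_unique_real[OF hJi[of j], of "\<lambda>x. 0"] hz by (simp add: set_lebesgue_integral_def)
  then have 2: "AE x in lborel. \<forall>j. hJ j x = 0" by (simp add: AE_all_countable)
  have ex: "\<exists>j. x \<in> J j" for x
  proof -
    obtain j where "\<bar>x\<bar> < real j" using reals_Archimedean2 by blast
    then show ?thesis by (intro exI[of _ j]) (auto simp: J_def)
  qed
  show "AE x in \<sigma>. k x = 0" using 1
  proof (rule eventually_mono)
    fix x assume z: "\<forall>j. kJ j x = 0"
    obtain j where "x \<in> J j" using ex by blast
    then show "k x = 0" using z[rule_format, of j] by (simp add: kJ_def)
  qed
  show "AE x in lborel. h x = 0" using 2
  proof (rule eventually_mono)
    fix x assume z: "\<forall>j. hJ j x = 0"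
    obtain j where "x \<in> J j" using ex by blast
    then show "h x = 0" using z[rule_format, of j] by (simp add: hJ_def)
  qed
qed

lemma locally_integrable_diff:
  "locally_integrable f \<Longrightarrow> locally_integrable g \<Longrightarrow> locally_integrable (\<lambda>x. f x - g x)"
  by (simp add: locally_integrable_def set_integral_diff)

lemma interval_integral_Ioc_diff:
  assumes "locally_integrable f" "locally_integrable g"
  shows "(LINT x:{a<..b}|lborel. f x - g x) = (LINT x:{a<..b}|lborel. f x) - (LINT x:{a<..b}|lborel. g x)"
proof -
  have "set_integrable lborel {a<..b} f" "set_integrable lborel {a<..b} g"
    by (rule set_integrable_subset[of _ "{a..b}"]; use assms in \<open>auto simp: locally_integrable_def\<close>)+
  then show ?thesis by (rule set_integral_diff)
qed

lemma interval_integrals_eq_imp_AE_eq: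
  assumes f: "locally_integrable f" and g: "locally_integrable g"
    and eq: "\<And>a b. a < b \<Longrightarrow> (LINT x:{a<..b}|lborel. f x) = (LINT x:{a<..b}|lborel. g x)"
  shows "AE x in lborel. f x = g x"
proof -
  have "AE x in lborel. f x - g x = 0"
  proof (rule singular_pair_vanishing(2)[where \<sigma>="null_measure lborel" and k="\<lambda>x. 0" and N="{}"])
    show "locally_integrable (\<lambda>x. f x - g x)" using f g by (rule locally_integrable_diff)
    show "(LINT x:{a<..b}|null_measure lborel. 0) + (LINT x:{a<..b}|lborel. f x - g x) = 0" if "a < b" for a b :: real
      using eq[OF that] interval_integral_Ioc_diff[OF f g] by (simp add: set_lebesgue_integral_def)
  qed (auto simp: set_integrable_def)
  then show ?thesis by simp
qed

lemma weak_deriv_AE_unique: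
  assumes "continuous_on UNIV f" "has_weak_deriv f g" "has_weak_deriv f g'"
  shows "AE x in lborel. g x = g' x"
proof (rule interval_integrals_eq_imp_AE_eq)
  show "locally_integrable g" "locally_integrable g'" using assms by (auto simp: has_weak_deriv_def)
  show "(LINT x:{a<..b}|lborel. g x) = (LINT x:{a<..b}|lborel. g' x)" if "a < b" for a b
    using weak_deriv_imp_increment[OF assms(2,1) that] weak_deriv_imp_increment[OF assms(3,1) that] by simp
qed

text \<open>A distribution \<open>k \<sigma> + h dx\<close> with vanishing derivative is a constant multiple of Lebesgue measure.
The test functions are smoothed trapezoids: \<open>1/(b - a)\<close> times the indicator of \<open>(a,b]\<close>, minus the
indicator of \<open>(0,1]\<close>, has integral zero and hence a compactly supported primitive. Writing this
primitive with the ramps \<open>x * smooth_step (n * x)\<close> avoids taking antiderivatives.\<close>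

lemma distribution_deriv_zero_imp_constant:
  fixes k h :: "real \<Rightarrow> real"
  assumes \<sigma>: "sets \<sigma> = sets borel" and k: "\<And>a b. set_integrable \<sigma> {a..b} k" and h: "locally_integrable h"
    and T: "\<And>\<psi>. test_function UNIV \<psi> \<Longrightarrow>
       (LINT x|\<sigma>. deriv \<psi> x * k x) + (LINT x|lborel. deriv \<psi> x * h x) = 0"
  obtains c where "\<And>a b. a < b \<Longrightarrow> (LINT x:{a<..b}|\<sigma>. k x) + (LINT x:{a<..b}|lborel. h x) = c * (b - a)"
proof -
  let ?S = smooth_step
  have hi: "set_integrable lborel {a..b} h" for a b using h by (simp add: locally_integrable_def)
  \<comment> \<open>the derivative of the ramp \<open>R n t\<close> is \<open>r ((n + 1) t)\<close>\<close>
  define r where "r s = ?S s + s * deriv ?S s" for s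
  have rc: "continuous_on UNIV r" unfolding r_def
    by (intro continuous_intros continuous_deriv_smooth_step Ck_continuous[OF Ck_smooth_step])
  have r: "step_like r"
    unfolding step_like_def by (auto simp: rc) (auto simp: r_def smooth_step_0 smooth_step_1 deriv_smooth_step_outside)
  define R where "R n t = t * ?S (real (Suc n) * t)" for n t
  have R: "(R n has_real_derivative r (real (Suc n) * t)) (at t)" for n t
    unfolding R_def r_def
    by (rule DERIV_cong[OF DERIV_mult[OF DERIV_ident DERIV_chain2[OF smooth_step_deriv DERIV_cmult_Id]]])
       (simp add: algebra_simps)
  have RC: "Ck j (\<lambda>x. R n (x - a))" for j n a
    using Ck_mult[OF Ck_affine[OF Ck_id, of _ 1 "-a"] Ck_affine[OF Ck_smooth_step, of _ "real (Suc n)" "- real (Suc n) * a"]]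
    by (simp add: R_def algebra_simps)
  have R0: "R n t = 0" if "t \<le> 0" for n t using that by (simp add: R_def smooth_step_0 mult_nonneg_nonpos)
  have R1: "R n t = t" if "t \<ge> 1" for n t
  proof -
    have "real (Suc n) * t \<ge> 1 * 1" using that by (intro mult_mono) auto
    then show ?thesis by (simp add: R_def smooth_step_1)
  qed
  define m where "m a b = (LINT x:{a<..b}|\<sigma>. k x) + (LINT x:{a<..b}|lborel. h x)" for a b
  define D where "D n a b x = r (real (Suc n) * (x - a)) - r (real (Suc n) * (x - b))" for n a b x
  have lim: "(\<lambda>n. (LINT x|\<sigma>. D n a b x * k x) + (LINT x|lborel. D n a b x * h x)) \<longlonglongrightarrow> m a b" if "a < b" for a b
    unfolding m_def D_def by (intro tendsto_add step_like_interval(1) r \<sigma> k hi that) simp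
  have Di: "integrable \<sigma> (\<lambda>x. D n a b x * k x)" "integrable lborel (\<lambda>x. D n a b x * h x)" if "a < b" for n a b
    unfolding D_def by (intro step_like_interval(2) r \<sigma> k hi that; simp)+
  have "m a b / (b - a) = m 0 1" if ab: "a < b" for a b
  proof -
    define \<psi> where "\<psi> n x = (1 / (b - a)) * (R n (x - a) - R n (x - b)) - (R n (x - 0) - R n (x - 1))" for n x
    have T': "test_function UNIV (\<psi> n)" for n
    proof (rule test_function_UNIV_I)
      show "Ck j (\<psi> n)" for j unfolding \<psi>_def by (intro Ck_diff Ck_mult Ck_const RC)
      show "\<psi> n x = 0" if x: "x \<notin> {min a 0..max (b + 1) 2}" for x
      proof (cases "x < min a 0")
        case True
        then show ?thesis using ab by (simp add: \<psi>_def R0)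
      next
        case False
        then have "x > max (b + 1) 2" using x by auto
        then show ?thesis using ab by (simp add: \<psi>_def R1)
      qed
    qed
    have d: "deriv (\<psi> n) x = (1 / (b - a)) * D n a b x - D n 0 1 x" for n x
    proof (rule DERIV_imp_deriv)
      have R': "((\<lambda>x. R n (x - a)) has_real_derivative r (real (Suc n) * (x - a))) (at x)" for a
        by (rule DERIV_cong[OF DERIV_chain2[OF R DERIV_diff[OF DERIV_ident DERIV_const]]]) simp
      show "(\<psi> n has_real_derivative (1 / (b - a)) * D n a b x - D n 0 1 x) (at x)"
        unfolding \<psi>_def D_def by (intro DERIV_diff DERIV_cmult R')
    qed
    have z: "(1 / (b - a)) * ((LINT x|\<sigma>. D n a b x * k x) + (LINT x|lborel. D n a b x * h x))
       - ((LINT x|\<sigma>. D n 0 1 x * k x) + (LINT x|lborel. D n 0 1 x * h x)) = 0" for n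
    proof -
      have s: "(LINT x|L. deriv (\<psi> n) x * f x) = (1 / (b - a)) * (LINT x|L. D n a b x * f x) - (LINT x|L. D n 0 1 x * f x)"
        if "\<And>a b. a < b \<Longrightarrow> integrable L (\<lambda>x. D n a b x * f x)" for L and f :: "real \<Rightarrow> real"
      proof -
        have "deriv (\<psi> n) x * f x = (1 / (b - a)) * (D n a b x * f x) - D n 0 1 x * f x" for x
          by (simp add: d algebra_simps)
        then show ?thesis using that[OF ab] that[of 0 1] by simp
      qed
      show ?thesis
        using T[OF T'[of n]] s[of \<sigma> k, OF Di(1)] s[of lborel h, OF Di(2)] unfolding distrib_left by linarith
    qed
    have "(\<lambda>n. (1 / (b - a)) * ((LINT x|\<sigma>. D n a b x * k x) + (LINT x|lborel. D n a b x * h x))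
       - ((LINT x|\<sigma>. D n 0 1 x * k x) + (LINT x|lborel. D n 0 1 x * h x))) \<longlonglongrightarrow> (1 / (b - a)) * m a b - m 0 1"
      by (intro tendsto_intros lim ab) simp
    from LIMSEQ_unique[OF this[unfolded z] tendsto_const] show ?thesis by simp
  qed
  then have "(LINT x:{a<..b}|\<sigma>. k x) + (LINT x:{a<..b}|lborel. h x) = m 0 1 * (b - a)" if "a < b" for a b
    using that unfolding m_def by (simp add: field_simps)
  then show thesis by (rule that)
qed

lemma has_weak_deriv_weak_deriv: "f \<in> W11_loc \<Longrightarrow> has_weak_deriv f (weak_deriv f)"
  using someI_ex[of "has_weak_deriv f"] by (simp add: W11_loc_def weak_deriv_def)

lemma locally_integrable_measurable:
  assumes "locally_integrable g" shows "g \<in> borel_measurable borel"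
proof (rule borel_measurable_LIMSEQ_real)
  show "(\<lambda>x. indicat_real {- real n..real n} x *\<^sub>R g x) \<in> borel_measurable borel" for n
  proof -
    have "integrable lborel (\<lambda>x. indicat_real {- real n..real n} x *\<^sub>R g x)"
      using assms unfolding locally_integrable_def set_integrable_def by blast
    from borel_measurable_integrable[OF this] show ?thesis by simp
  qed
  fix x
  obtain N where N: "\<bar>x\<bar> < real N" using reals_Archimedean2 by blast
  then have "\<forall>\<^sub>F n in sequentially. indicat_real {- real n..real n} x *\<^sub>R g x = g x"
    unfolding eventually_sequentially by (intro exI[of _ N]) (auto simp: indicator_def)
  then show "(\<lambda>n. indicat_real {- real n..real n} x *\<^sub>R g x) \<longlonglongrightarrow> g x" by (rule tendsto_eventually)
qed

lemma locally_integrable_integrable: "integrable lborel f \<Longrightarrow> locally_integrable f"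
  unfolding locally_integrable_def set_integrable_def by (intro allI integrable_mult_indicator) auto

lemma locally_integrable_times_continuous:
  assumes "locally_integrable f" "continuous_on UNIV \<phi>"
  shows "locally_integrable (\<lambda>x. \<phi> x * f x)"
  using assms set_integrable_times_continuous[of lborel] unfolding locally_integrable_def by auto

lemma set_integral_Ioc_eq_Icc:
  fixes h :: "real \<Rightarrow> real"
  assumes "h \<in> borel_measurable borel"
  shows "(LINT x:{a<..b}|lborel. h x) = (LINT x:{a..b}|lborel. h x)"
  unfolding set_lebesgue_integral_def
proof (rule integral_cong_AE)
  show "AE x in lborel. indicat_real {a<..b} x *\<^sub>R h x = indicat_real {a..b} x *\<^sub>R h x"
    using AE_lborel_singleton[of a] by eventually_elim (auto simp: indicator_def)
qed (use assms in measurable)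

text \<open>Where the weak derivative agrees almost everywhere with a continuous function, it is a classical
one.\<close>

lemma increment_integral_imp_DERIV:
  fixes f g h :: "real \<Rightarrow> real"
  assumes g: "g \<in> borel_measurable borel"
    and inc: "\<And>x y. x < y \<Longrightarrow> f y - f x = (LINT t:{x<..y}|lborel. g t)"
    and S: "open S" "x0 \<in> S" and h: "continuous_on S h" and ae: "AE x in lborel. x \<in> S \<longrightarrow> g x = h x"
  shows "(f has_real_derivative h x0) (at x0)"
proof -
  obtain e where e: "e > 0" "cball x0 e \<subseteq> S" using S open_contains_cball by blast
  define a where "a = x0 - e"
  define b where "b = x0 + e"
  have ab: "{a..b} \<subseteq> S" "a < x0" "x0 < b" using e by (auto simp: a_def b_def cball_eq_atLeastAtMost)
  have ch: "continuous_on {a..b} h" using h ab(1) continuous_on_subset by blast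
  define F where "F x = integral {a..x} h" for x
  have F: "(F has_real_derivative h t) (at t within {a..b})" if "t \<in> {a..b}" for t
    unfolding F_def using integral_has_real_derivative[OF ch that] .
  have eq: "f y - F y = f a - F a" if y: "y \<in> {a..b}" for y
  proof (cases "y = a")
    case False
    then have ay: "a < y" "y \<le> b" using y by auto
    have mh: "(\<lambda>x. indicat_real {a..y} x *\<^sub>R h x) \<in> borel_measurable borel"
    proof -
      have "set_integrable lborel {a..y} h"
        using ay by (intro borel_integrable_atLeastAtMost' continuous_on_subset[OF ch]) auto
      then show ?thesis by (auto simp: set_integrable_def dest: borel_measurable_integrable)
    qed
    have "f y - f a = (LINT t:{a..y}|lborel. g t)" using inc[OF ay(1)] set_integral_Ioc_eq_Icc[OF g] by simp
    also have "\<dots> = (LINT t:{a..y}|lborel. h t)" unfolding set_lebesgue_integral_def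
    proof (rule integral_cong_AE)
      show "AE x in lborel. indicat_real {a..y} x *\<^sub>R g x = indicat_real {a..y} x *\<^sub>R h x"
        using ae
      proof eventually_elim
        case (elim x)
        then show ?case using subsetD[OF ab(1), of x] ay by (cases "x \<in> {a..y}") auto
      qed
    qed (use g mh in auto)
    also have "\<dots> = F y - F a" unfolding set_lebesgue_integral_def
    proof (rule integral_FTC_atLeastAtMost)
      show "(F has_vector_derivative h x) (at x within {a..y})" if "a \<le> x" "x \<le> y" for x
        using F[of x] that ay DERIV_subset[of F "h x" x "{a..b}" "{a..y}"]
        by (simp add: has_real_derivative_iff_has_vector_derivative)
    qed (use ay in \<open>auto intro: continuous_on_subset[OF ch]\<close>)
    finally show ?thesis by simp
  qed simp
  have "at x0 within {a..b} = at x0" using ab by (intro at_within_interior) simp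
  then have "(F has_real_derivative h x0) (at x0)" using F[of x0] ab by simp
  then have "((\<lambda>x. F x + (f a - F a)) has_real_derivative h x0) (at x0)"
    by (auto intro!: derivative_eq_intros)
  then show ?thesis
  proof (rule has_field_derivative_transform_within_open[where S="{a<..<b}"])
    show "F y + (f a - F a) = f y" if "y \<in> {a<..<b}" for y using eq[of y] that by simp
  qed (use ab in auto)
qed

lemma integral_by_parts_test_function:
  fixes w w' \<phi> :: "real \<Rightarrow> real"
  assumes w: "\<And>x. (w has_real_derivative w' x) (at x)" and c: "continuous_on UNIV w'"
    and T: "test_function UNIV \<phi>"
  shows "(LINT x|lborel. w x * deriv \<phi> x) = - (LINT x|lborel. w' x * \<phi> x)"
proof -
  obtain a b where ab: "a < b" and z: "\<And>x. x \<notin> {a..b} \<Longrightarrow> \<phi> x = 0" "\<And>x. x \<notin> {a..b} \<Longrightarrow> deriv \<phi> x = 0"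
    and d: "\<And>x. (\<phi> has_real_derivative deriv \<phi> x) (at x)"
    and c\<phi>: "continuous_on UNIV \<phi>" "continuous_on UNIV (deriv \<phi>)"
    using test_functionD[OF T] by blast
  have cw: "continuous_on UNIV w" using w DERIV_isCont continuous_at_imp_continuous_on by blast
  have si: "set_integrable lborel {p..q} w'" "set_integrable lborel {p..q} w" for p q
    using locally_integrable_continuous[OF c] locally_integrable_continuous[OF cw] by (auto simp: locally_integrable_def)
  have i: "integrable lborel (\<lambda>x. \<phi> x * w' x)" "integrable lborel (\<lambda>x. deriv \<phi> x * w x)"
    by (rule integrable_times_continuous_supported[OF _ si(1)[of a b] c\<phi>(1)], auto simp: z)
       (rule integrable_times_continuous_supported[OF _ si(2)[of a b] c\<phi>(2)], auto simp: z)
  let ?f = "\<lambda>x. w' x * \<phi> x + w x * deriv \<phi> x"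
  have cf: "continuous_on UNIV ?f" by (intro continuous_intros c c\<phi> cw)
  have "(LINT x:{a-1..b+1}|lborel. ?f x) = w (b + 1) * \<phi> (b + 1) - w (a - 1) * \<phi> (a - 1)"
  proof (rule set_integral_deriv[OF _ cf])
    show "((\<lambda>x. w x * \<phi> x) has_real_derivative ?f x) (at x)" for x
      using DERIV_mult[OF w d] by (simp add: algebra_simps)
  qed (use ab in simp)
  also have "\<dots> = 0" using z(1)[of "b + 1"] z(1)[of "a - 1"] by simp
  finally have "(LINT x:{a-1..b+1}|lborel. ?f x) = 0" .
  moreover have "(LINT x:{a-1..b+1}|lborel. ?f x) = (LINT x|lborel. ?f x)"
    using locally_integrable_continuous[OF cf]
    by (intro integrable_locally_supported(2)) (auto simp: locally_integrable_def z)
  ultimately have "(LINT x|lborel. ?f x) = 0" by simp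
  moreover have "(LINT x|lborel. ?f x) = (LINT x|lborel. w' x * \<phi> x) + (LINT x|lborel. w x * deriv \<phi> x)"
    using i by (intro Bochner_Integration.integral_add) (simp_all add: mult.commute)
  ultimately show ?thesis by simp
qed

section \<open>The pressure law and its entropy\<close>

text \<open>Profiles are functions on \<open>(0,\<infinity>)\<close> that are extended to the left by their limit at \<open>0\<close>.\<close>

lemma continuous_on_extend_by_limit:
  fixes g :: "real \<Rightarrow> 'b::topological_space"
  assumes pos: "\<And>v. v > 0 \<Longrightarrow> isCont f v" and lim: "(f \<longlongrightarrow> c) (at_right 0)"
    and g: "\<And>v. v > 0 \<Longrightarrow> g v = f v" "\<And>v. v \<le> 0 \<Longrightarrow> g v = c"
  shows "continuous_on UNIV g"
proof (rule continuous_at_imp_continuous_on, rule ballI)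
  fix v :: real
  consider "v > 0" | "v < 0" | "v = 0" by linarith
  then show "isCont g v"
  proof cases
    case 1
    have "\<forall>\<^sub>F w in nhds v. f w = g w"
      using eventually_nhds_in_open[of "{0<..}" v] 1 by (auto elim!: eventually_mono simp: g)
    then show ?thesis using pos[OF 1] by (subst isCont_cong[of g f]) (auto elim: eventually_mono)
  next
    case 2
    have "\<forall>\<^sub>F w in nhds v. g w = c"
      using eventually_nhds_in_open[of "{..<0}" v] 2 by (auto elim!: eventually_mono simp: g)
    then show ?thesis by (subst isCont_cong[of g "\<lambda>_. c"]) auto
  next
    case 3
    have "(g \<longlongrightarrow> c) (at_right 0)"
      by (rule Lim_transform_eventually[OF lim]) (auto simp: eventually_at_filter g)
    moreover have "(g \<longlongrightarrow> c) (at_left 0)"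
      by (rule tendsto_eventually) (auto simp: eventually_at_filter g)
    ultimately show ?thesis using 3 g(2)[of 0] by (simp add: isCont_def filterlim_split_at)
  qed
qed

text \<open>The last assumption makes \<open>P\<close> a map onto \<open>(0,\<infinity>)\<close>, so that \<open>H_fun \<beta>\<close> is its inverse on the whole
half line.\<close>

locale saturating_pressure =
  fixes \<beta> :: "real \<Rightarrow> real"
  assumes C1: "\<exists>\<beta>'. continuous_on {0..} \<beta>' \<and>
             (\<forall>r\<ge>0. (\<beta> has_real_derivative \<beta>' r) (at r within {0..}))"
    and strict: "strict_mono_on {0..} \<beta>"
    and zero: "\<beta> 0 = 0"
    and limit: "\<exists>L. (\<beta> \<longlongrightarrow> L) at_top"
    and threshold: "d_threshold \<beta> = \<infinity>"
begin

definition sup_\<beta> :: real where "sup_\<beta> = Lim at_top \<beta>"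

definition P :: "real \<Rightarrow> real" where "P r = - E_prime \<beta> r"

abbreviation H :: "real \<Rightarrow> real" where "H \<equiv> H_fun \<beta>"

lemma beta_tendsto: "(\<beta> \<longlongrightarrow> sup_\<beta>) at_top"
  using limit tendsto_Lim[of at_top \<beta>] unfolding sup_\<beta>_def by auto

lemma beta_less: "0 \<le> a \<Longrightarrow> a < b \<Longrightarrow> \<beta> a < \<beta> b"
  using strict by (auto simp: strict_mono_on_def)

lemma beta_less_sup: assumes "0 \<le> a" shows "\<beta> a < sup_\<beta>"
proof -
  have "\<beta> (a + 1) \<le> sup_\<beta>"
  proof (rule tendsto_lowerbound[OF beta_tendsto])
    show "\<forall>\<^sub>F x in at_top. \<beta> (a + 1) \<le> \<beta> x"
      using eventually_gt_at_top[of "a + 1"] by eventually_elim (use beta_less[of "a + 1"] assms in fastforce)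
  qed simp
  then show ?thesis using beta_less[of a "a + 1"] assms by simp
qed

lemma beta_pos: "0 < a \<Longrightarrow> 0 < \<beta> a" using beta_less[of 0 a] zero by simp

lemma sup_pos: "0 < sup_\<beta>" using beta_less_sup[of 0] zero by simp

lemma DERIV_beta: assumes "r > 0" shows "(\<beta> has_real_derivative deriv \<beta> r) (at r)"
proof -
  obtain b where "\<forall>r\<ge>0. (\<beta> has_real_derivative b r) (at r within {0..})" using C1 by blast
  then have "(\<beta> has_real_derivative b r) (at r within {0..})" using assms by simp
  moreover have "at r within {0..} = at r" using assms by (intro at_within_interior) simp
  ultimately have "(\<beta> has_real_derivative b r) (at r)" by simp
  then show ?thesis using DERIV_imp_deriv by metis
qed

lemma continuous_deriv_beta: "continuous_on {0<..} (deriv \<beta>)"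
proof -
  obtain b where c: "continuous_on {0..} b" and d: "\<forall>r\<ge>0. (\<beta> has_real_derivative b r) (at r within {0..})"
    using C1 by blast
  have "deriv \<beta> r = b r" if "r > 0" for r
  proof -
    have "at r within {0..} = at r" using that by (intro at_within_interior) simp
    then show ?thesis using d[rule_format, of r] that by (intro DERIV_imp_deriv) simp
  qed
  moreover have "continuous_on {0<..} b" using c by (rule continuous_on_subset) auto
  ultimately show ?thesis using continuous_on_cong[of "{0<..}" "{0<..}" "deriv \<beta>" b] by simp
qed

lemma deriv_beta_nonneg: assumes "r > 0" shows "deriv \<beta> r \<ge> 0"
proof (rule ccontr)
  assume "\<not> deriv \<beta> r \<ge> 0"
  then obtain d where "d > 0" and d: "\<And>h. 0 < h \<Longrightarrow> h < d \<Longrightarrow> \<beta> (r + h) < \<beta> r"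
    using DERIV_neg_dec_right[OF DERIV_beta[OF assms]] by (metis not_le)
  have "\<beta> (r + d / 2) < \<beta> r" using d[of "d / 2"] \<open>d > 0\<close> by simp
  moreover have "\<beta> r < \<beta> (r + d / 2)" using beta_less[of r "r + d / 2"] assms \<open>d > 0\<close> by simp
  ultimately show False by simp
qed

lemma continuous_beta: "continuous_on {0..} \<beta>"
  using C1 DERIV_continuous_on[of "{0..}" \<beta>] by fastforce

lemma isCont_beta: "r > 0 \<Longrightarrow> isCont \<beta> r"
  using DERIV_beta DERIV_isCont by blast

text \<open>The integrand of \<open>P\<close>, set to zero on the negative half line so that it is measurable.\<close>

definition q :: "real \<Rightarrow> real" where "q s = (if s > 0 then deriv \<beta> s / s else 0)"

definition d\<beta> :: "real \<Rightarrow> real" where "d\<beta> s = (if s > 0 then deriv \<beta> s else 0)"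

lemma q_measurable [measurable]: "q \<in> borel_measurable borel"
proof -
  have "(\<lambda>s. if s \<in> {0<..} then deriv \<beta> s / s else 0) \<in> borel_measurable borel"
    by (intro borel_measurable_continuous_on_if continuous_intros continuous_deriv_beta) auto
  then show ?thesis by (simp add: q_def[abs_def])
qed

lemma d\<beta>_measurable [measurable]: "d\<beta> \<in> borel_measurable borel"
proof -
  have "(\<lambda>s. if s \<in> {0<..} then deriv \<beta> s else 0) \<in> borel_measurable borel"
    by (intro borel_measurable_continuous_on_if continuous_intros continuous_deriv_beta) auto
  then show ?thesis by (simp add: d\<beta>_def[abs_def])
qed

lemma q_nonneg: "q s \<ge> 0" and d\<beta>_nonneg: "d\<beta> s \<ge> 0"
  using deriv_beta_nonneg by (auto simp: q_def d\<beta>_def)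

text \<open>Boundedness of \<open>\<beta>\<close> makes \<open>\<beta>'\<close> integrable at infinity, and \<open>\<beta>'(s)/s \<le> \<beta>'(s)/r\<close> for \<open>s > r\<close>
transfers this to the integral defining \<open>P\<close>.\<close>

lemma nn_integral_d\<beta>: assumes "r > 0"
  shows "(\<integral>\<^sup>+s. ennreal (indicator {r<..} s * d\<beta> s) \<partial>lborel) = ennreal (sup_\<beta> - \<beta> r)"
proof -
  have "(\<integral>\<^sup>+s. ennreal (indicator {r<..} s * d\<beta> s) \<partial>lborel) = (\<integral>\<^sup>+s. ennreal (d\<beta> s) * indicator {r..} s \<partial>lborel)"
    by (rule nn_integral_cong_AE)
       (use AE_lborel_singleton[of r] in eventually_elim, auto simp: indicator_def)
  also have "\<dots> = ennreal (sup_\<beta> - \<beta> r)"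
    by (rule nn_integral_FTC_atLeast[OF d\<beta>_measurable _ d\<beta>_nonneg beta_tendsto])
       (use assms DERIV_beta in \<open>auto simp: d\<beta>_def\<close>)
  finally show ?thesis .
qed

lemma d\<beta>_tail:
  assumes "r > 0"
  shows "set_integrable lborel {r<..} d\<beta>" "(LINT s:{r<..}|lborel. d\<beta> s) = sup_\<beta> - \<beta> r"
proof -
  have *: "sup_\<beta> - \<beta> r \<ge> 0" using beta_less_sup[of r] assms by simp
  show i: "set_integrable lborel {r<..} d\<beta>" unfolding set_integrable_def
    by (rule integrableI_nonneg) (use nn_integral_d\<beta>[OF assms] d\<beta>_nonneg in auto)
  have "ennreal (LINT s|lborel. indicator {r<..} s * d\<beta> s) = ennreal (sup_\<beta> - \<beta> r)"
    using i nn_integral_eq_integral[of lborel "\<lambda>s. indicator {r<..} s * d\<beta> s"] nn_integral_d\<beta>[OF assms] d\<beta>_nonneg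
    by (simp add: set_integrable_def)
  moreover have "(LINT s|lborel. indicator {r<..} s * d\<beta> s) \<ge> 0"
    by (intro Bochner_Integration.integral_nonneg) (auto simp: d\<beta>_nonneg)
  ultimately show "(LINT s:{r<..}|lborel. d\<beta> s) = sup_\<beta> - \<beta> r"
    using * by (simp add: set_lebesgue_integral_def)
qed

lemma q_tail:
  assumes "r > 0"
  shows "set_integrable lborel {r<..} q" "P r = (LINT s:{r<..}|lborel. q s)"
proof -
  have "set_integrable lborel {r<..} (\<lambda>s. (1 / r) * d\<beta> s)"
    using d\<beta>_tail(1)[OF assms] by simp
  then show "set_integrable lborel {r<..} q" unfolding set_integrable_def
  proof (rule Bochner_Integration.integrable_bound)
    show "AE s in lborel. norm (indicat_real {r<..} s *\<^sub>R q s) \<le> norm (indicat_real {r<..} s *\<^sub>R (1 / r * d\<beta> s))"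
    proof (rule AE_I2)
      fix s show "norm (indicat_real {r<..} s *\<^sub>R q s) \<le> norm (indicat_real {r<..} s *\<^sub>R (1 / r * d\<beta> s))"
        using assms deriv_beta_nonneg[of s]
        by (auto simp: indicator_def q_def d\<beta>_def divide_left_mono)
    qed
  qed measurable
  show "P r = (LINT s:{r<..}|lborel. q s)"
    unfolding P_def E_prime_def set_lebesgue_integral_def using assms
    by (auto simp: q_def indicator_def intro!: Bochner_Integration.integral_cong)
qed

lemma q_le: "0 < r \<Longrightarrow> r < s \<Longrightarrow> q s \<le> (1 / r) * d\<beta> s"
  using deriv_beta_nonneg[of s] by (auto simp: q_def d\<beta>_def intro!: divide_left_mono)

lemma q_ge: "0 < s \<Longrightarrow> s \<le> r \<Longrightarrow> (1 / r) * d\<beta> s \<le> q s"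
  using deriv_beta_nonneg[of s] by (auto simp: q_def d\<beta>_def intro!: divide_left_mono)

lemma P_increment_weak:
  assumes "0 < a" "a < b"
  shows "(\<beta> b - \<beta> a) / b \<le> P a - P b" "P a - P b \<le> (\<beta> b - \<beta> a) / a"
proof -
  have U: "{a<..} = {a<..b} \<union> {b<..}" "{a<..b} \<inter> {b<..} = {}" using assms by auto
  have si: "set_integrable lborel {a<..b} q" "set_integrable lborel {a<..b} d\<beta>"
    by (rule set_integrable_subset[OF q_tail(1)[OF assms(1)]]; auto)
       (rule set_integrable_subset[OF d\<beta>_tail(1)[OF assms(1)]]; auto)
  have q: "P a - P b = (LINT s:{a<..b}|lborel. q s)"
    using q_tail[of a] q_tail[of b] assms set_integral_Un[OF U(2) si(1), of] U(1) by simp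
  have b: "\<beta> b - \<beta> a = (LINT s:{a<..b}|lborel. d\<beta> s)"
    using d\<beta>_tail[of a] d\<beta>_tail[of b] assms set_integral_Un[OF U(2) si(2), of] U(1) by simp
  have "(LINT s:{a<..b}|lborel. (1 / b) * d\<beta> s) \<le> (LINT s:{a<..b}|lborel. q s)"
    by (rule set_integral_mono[OF set_integrable_mult_right si(1)]) (use si(2) assms q_ge in auto)
  then show "(\<beta> b - \<beta> a) / b \<le> P a - P b" unfolding q b by simp
  have "(LINT s:{a<..b}|lborel. q s) \<le> (LINT s:{a<..b}|lborel. (1 / a) * d\<beta> s)"
    by (rule set_integral_mono[OF si(1) set_integrable_mult_right]) (use si(2) assms q_le in auto)
  then show "P a - P b \<le> (\<beta> b - \<beta> a) / a" unfolding q b by simp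
qed

text \<open>Splitting at the midpoint makes the weak estimates strict: on one of the two halves the factor
\<open>1/s\<close> is bounded by its value at the midpoint, and \<open>\<beta>\<close> increases strictly on each half.\<close>

lemma P_increment:
  assumes "0 < a" "a < b"
  shows "(\<beta> b - \<beta> a) / b < P a - P b" "P a - P b < (\<beta> b - \<beta> a) / a"
proof -
  define c where "c = (a + b) / 2"
  have c: "a < c" "c < b" using assms by (auto simp: c_def)
  have m: "\<beta> a < \<beta> c" "\<beta> c < \<beta> b" using beta_less c assms by auto
  have "(\<beta> c - \<beta> a) / b < (\<beta> c - \<beta> a) / c" "(\<beta> b - \<beta> c) / c < (\<beta> b - \<beta> c) / a"
    using c m assms by (auto intro!: divide_strict_left_mono)
  moreover have "(\<beta> b - \<beta> a) / b = (\<beta> c - \<beta> a) / b + (\<beta> b - \<beta> c) / b"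
    "(\<beta> b - \<beta> a) / a = (\<beta> c - \<beta> a) / a + (\<beta> b - \<beta> c) / a"
    by (simp_all add: add_divide_distrib[symmetric])
  ultimately show "(\<beta> b - \<beta> a) / b < P a - P b" "P a - P b < (\<beta> b - \<beta> a) / a"
    using P_increment_weak[of a c] P_increment_weak[of c b] c assms by auto
qed

lemma P_less: "0 < a \<Longrightarrow> a < b \<Longrightarrow> P b < P a"
  using P_increment(1)[of a b] beta_less[of a b] by (smt (verit) divide_pos_pos)

lemma P_less_iff: "0 < a \<Longrightarrow> 0 < b \<Longrightarrow> P b < P a \<longleftrightarrow> a < b"
  using P_less[of a b] P_less[of b a] by (cases a b rule: linorder_cases) auto

text \<open>The secant slope of \<open>P\<close> against \<open>\<beta>\<close>, in the form used to pass to the limit \<open>b \<longrightarrow> a\<close>.\<close>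

lemma P_secant:
  assumes "a > 0" "b > 0"
  shows "\<exists>k. P b - P a = - k * (\<beta> b - \<beta> a) \<and> \<bar>k - 1 / a\<bar> \<le> \<bar>1 / b - 1 / a\<bar>"
proof (cases a b rule: linorder_cases)
  case equal
  then show ?thesis by (intro exI[of _ "1 / a"]) simp
next
  case less
  have m: "\<beta> b - \<beta> a > 0" using beta_less less assms by simp
  define k where "k = (P a - P b) / (\<beta> b - \<beta> a)"
  have "1 / b < k" "k < 1 / a"
    using P_increment[OF assms(1) less] m by (auto simp: k_def field_simps)
  moreover have "P b - P a = - k * (\<beta> b - \<beta> a)" using m by (simp add: k_def)
  ultimately show ?thesis by (intro exI[of _ k]) auto
next
  case greater
  have m: "\<beta> a - \<beta> b > 0" using beta_less greater assms by simp
  define k where "k = (P b - P a) / (\<beta> a - \<beta> b)"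
  have "1 / a < k" "k < 1 / b"
    using P_increment[OF assms(2) greater] m by (auto simp: k_def field_simps)
  moreover have "P b - P a = - k * (\<beta> b - \<beta> a)" using m by (simp add: k_def field_simps)
  ultimately show ?thesis by (intro exI[of _ k]) auto
qed

lemma P_pos: assumes "r > 0" shows "P r > 0"
proof -
  have "P (r + 1) \<ge> 0"
    using q_tail(2)[of "r + 1"] assms q_nonneg
    by (simp add: set_lebesgue_integral_def Bochner_Integration.integral_nonneg)
  then show ?thesis using P_less[of r "r + 1"] assms by simp
qed

lemma P_upper: assumes "r > 0" shows "P r \<le> sup_\<beta> / r"
proof -
  have "(LINT s:{r<..}|lborel. q s) \<le> (LINT s:{r<..}|lborel. (1 / r) * d\<beta> s)"
    by (rule set_integral_mono[OF q_tail(1)[OF assms] set_integrable_mult_right])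
       (use d\<beta>_tail(1)[OF assms] q_le[OF assms] in auto)
  also have "\<dots> = (sup_\<beta> - \<beta> r) / r" using d\<beta>_tail(2)[OF assms] by simp
  also have "\<dots> \<le> sup_\<beta> / r" using assms beta_pos[OF assms] by (intro divide_right_mono) auto
  finally show ?thesis using q_tail(2)[OF assms] by simp
qed

lemma P_unbounded: "\<exists>r>0. P r > M"
proof (rule ccontr)
  assume "\<not> (\<exists>r>0. P r > M)"
  then have M: "P r \<le> M" if "r > 0" for r using that by force
  \<comment> \<open>truncations of the divergent integral at \<open>1/(n+1)\<close>\<close>
  define f where "f n s = ennreal (indicator {1 / real (Suc n)<..} s * q s)" for n s
  have "incseq f"
  proof (intro incseq_SucI le_funI)
    fix n s
    have "1 / real (Suc (Suc n)) \<le> 1 / real (Suc n)" by (intro divide_left_mono) auto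
    then show "f n s \<le> f (Suc n) s" using q_nonneg[of s] by (auto simp: f_def indicator_def)
  qed
  then have mc: "(\<integral>\<^sup>+s. (SUP n. f n s) \<partial>lborel) = (SUP n. \<integral>\<^sup>+s. f n s \<partial>lborel)"
    by (rule nn_integral_monotone_convergence_SUP) (simp add: f_def[abs_def])
  have "(\<integral>\<^sup>+s. f n s \<partial>lborel) = ennreal (P (1 / real (Suc n)))" for n
    using q_tail[of "1 / real (Suc n)"] q_nonneg
    by (simp add: f_def[abs_def] set_integrable_def set_lebesgue_integral_def nn_integral_eq_integral)
  then have "(SUP n. \<integral>\<^sup>+s. f n s \<partial>lborel) \<le> ennreal M"
    using M by (auto intro!: SUP_least ennreal_leI)
  moreover have "(\<integral>\<^sup>+s\<in>{0<..}. ennreal (deriv \<beta> s / s) \<partial>lborel) \<le> (\<integral>\<^sup>+s. (SUP n. f n s) \<partial>lborel)"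
  proof (rule nn_integral_mono)
    fix s :: real
    show "ennreal (deriv \<beta> s / s) * indicator {0<..} s \<le> (SUP n. f n s)"
    proof (cases "s > 0")
      case True
      then obtain n where "1 / real (Suc n) < s" using nat_approx_posE by (metis)
      then have "ennreal (deriv \<beta> s / s) * indicator {0<..} s = f n s" using True by (simp add: f_def q_def)
      then show ?thesis by (metis SUP_upper UNIV_I)
    qed simp
  qed
  ultimately have "d_threshold \<beta> \<le> ennreal M" unfolding d_threshold_def mc by (rule order_trans[rotated])
  moreover have "ennreal M < d_threshold \<beta>" unfolding threshold by simp
  ultimately show False by (simp add: not_less[symmetric])
qed

lemma continuous_P: "continuous_on {0<..} P"
proof (rule continuous_on_eq_continuous_at[THEN iffD2, rule_format])
  fix r :: real assume "r \<in> {0<..}"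
  then have r: "r > 0" by simp
  have "((\<lambda>s. (2 / r) * \<bar>\<beta> s - \<beta> r\<bar>) \<longlongrightarrow> (2 / r) * \<bar>\<beta> r - \<beta> r\<bar>) (at r)"
    using isCont_beta[OF r] by (intro tendsto_intros) (simp add: isCont_def)
  then have lim: "((\<lambda>s. (2 / r) * \<bar>\<beta> s - \<beta> r\<bar>) \<longlongrightarrow> 0) (at r)" by simp
  have ev: "\<forall>\<^sub>F s in at r. s > r / 2"
    by (rule order_tendstoD(1)[OF tendsto_ident_at]) (use r in simp)
  have "((\<lambda>s. P s - P r) \<longlongrightarrow> 0) (at r)"
  proof (rule Lim_null_comparison[OF _ lim])
    show "\<forall>\<^sub>F s in at r. norm (P s - P r) \<le> (2 / r) * \<bar>\<beta> s - \<beta> r\<bar>" using ev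
    proof eventually_elim
      case (elim s)
      have s: "s > 0" using elim r by simp
      obtain k where k: "P s - P r = - k * (\<beta> s - \<beta> r)" "\<bar>k - 1 / r\<bar> \<le> \<bar>1 / s - 1 / r\<bar>"
        using P_secant[OF r s] by blast
      have "1 / s \<le> 2 / r" using elim r s by (simp add: field_simps)
      moreover have "0 < 1 / r" "0 < 1 / s" "1 / r \<le> 2 / r" using r s by (auto simp: divide_right_mono)
      ultimately have "\<bar>k\<bar> \<le> 2 / r" using k(2) by linarith
      then have "\<bar>k\<bar> * \<bar>\<beta> s - \<beta> r\<bar> \<le> (2 / r) * \<bar>\<beta> s - \<beta> r\<bar>" by (intro mult_right_mono) auto
      then show ?case unfolding k(1) by (simp add: abs_mult)
    qed
  qed
  then show "isCont P r" using LIM_zero_cancel unfolding isCont_def by blast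
qed simp

lemma isCont_P: "r > 0 \<Longrightarrow> isCont P r"
  using continuous_P continuous_on_eq_continuous_at[of "{0<..}" P] by simp

lemma ex_P: assumes "v > 0" shows "\<exists>r>0. P r = v"
proof -
  obtain a where a: "a > 0" "P a > v" using P_unbounded by blast
  define b where "b = max (a + 1) (sup_\<beta> / v + 1)"
  have b: "b > a" "b > sup_\<beta> / v" by (auto simp: b_def)
  have "P b \<le> sup_\<beta> / b" using P_upper a b by simp
  also have "\<dots> < v" using b a assms by (simp add: field_simps)
  finally obtain r where "r \<ge> a" "P r = v"
    using a b isCont_P IVT2[of P b v a] by fastforce
  then show ?thesis using a by (intro exI[of _ r]) auto
qed

lemma H_P: assumes "r > 0" shows "H (P r) = r"
proof -
  have "inj_on (E_prime \<beta>) {0<..}"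
  proof (rule inj_onI)
    fix a b assume "a \<in> {0<..}" "b \<in> {0<..}" "E_prime \<beta> a = E_prime \<beta> b"
    then show "a = b" using P_less[of a b] P_less[of b a] by (cases a b rule: linorder_cases) (auto simp: P_def)
  qed
  then show ?thesis using assms the_inv_into_f_f[of "E_prime \<beta>" "{0<..}" r]
    unfolding H_fun_def P_def by (simp add: threshold)
qed

lemma H_pos: "v > 0 \<Longrightarrow> H v > 0" and P_H: "v > 0 \<Longrightarrow> P (H v) = v"
  using ex_P[of v] H_P by auto

lemma less_H_iff: "v > 0 \<Longrightarrow> r > 0 \<Longrightarrow> r < H v \<longleftrightarrow> v < P r"
  using P_less_iff[of r "H v"] H_pos[of v] P_H[of v] by simp

lemma H_less_iff: "v > 0 \<Longrightarrow> r > 0 \<Longrightarrow> H v < r \<longleftrightarrow> P r < v"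
  using P_less_iff[of "H v" r] H_pos[of v] P_H[of v] by simp

lemma H_less: "0 < v \<Longrightarrow> v < w \<Longrightarrow> H w < H v"
  using P_less_iff[of "H w" "H v"] H_pos P_H by auto

lemma isCont_H: assumes "v > 0" shows "isCont H v"
proof -
  have "isCont H (P (H v))"
  proof (rule isCont_inverse_function[where d="H v / 2" and f=P and x="H v"])
    show "0 < H v / 2" using H_pos[OF assms] by simp
    fix z assume "\<bar>z - H v\<bar> \<le> H v / 2"
    then have "z > 0" using H_pos[OF assms] by linarith
    then show "H (P z) = z" "isCont P z" by (rule H_P, rule isCont_P)
  qed
  then show ?thesis using P_H assms by simp
qed

lemma H_tendsto_at_top: "filterlim H at_top (at_right 0)"
proof (subst filterlim_at_top_gt[where c=0], intro allI impI)
  fix r :: real assume r: "0 < r"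
  have "\<forall>\<^sub>F v in at_right 0. v \<in> {0<..<P r}"
    using P_pos[OF r] by (intro eventually_at_right_real)
  then show "\<forall>\<^sub>F v in at_right 0. r \<le> H v"
    by eventually_elim (use less_H_iff r in \<open>auto simp: less_imp_le\<close>)
qed

lemma H_tendsto_0: "(H \<longlongrightarrow> 0) at_top"
proof (rule order_tendstoI)
  fix a :: real assume "a < 0"
  show "\<forall>\<^sub>F v in at_top. a < H v"
    using eventually_gt_at_top[of 0] by eventually_elim (use H_pos \<open>a < 0\<close> in force)
next
  fix a :: real assume a: "0 < a"
  show "\<forall>\<^sub>F v in at_top. H v < a"
    using eventually_gt_at_top[of "max 0 (P a)"] by eventually_elim (use H_less_iff a in auto)
qed

text \<open>The slope \<open>k\<close> of the secants tends to \<open>1/H(v)\<close>, and \<open>-1/k\<close> is the difference quotient.\<close>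

lemma DERIV_beta_H:
  assumes v: "v > 0"
  shows "((\<lambda>v. \<beta> (H v)) has_real_derivative - H v) (at v)"
proof -
  have h: "H v > 0" using H_pos v .
  have "\<exists>k. w - v = - k * (\<beta> (H w) - \<beta> (H v)) \<and> \<bar>k - 1 / H v\<bar> \<le> \<bar>1 / H w - 1 / H v\<bar>" if "w > 0" for w
    using P_secant[OF h H_pos[OF that]] P_H v that by simp
  then obtain k where k: "\<And>w. w > 0 \<Longrightarrow> w - v = - k w * (\<beta> (H w) - \<beta> (H v))"
    "\<And>w. w > 0 \<Longrightarrow> \<bar>k w - 1 / H v\<bar> \<le> \<bar>1 / H w - 1 / H v\<bar>" by metis
  have ev: "\<forall>\<^sub>F w in at v. w > 0" by (rule order_tendstoD(1)[OF tendsto_ident_at v])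
  have "((\<lambda>w. \<bar>1 / H w - 1 / H v\<bar>) \<longlongrightarrow> \<bar>1 / H v - 1 / H v\<bar>) (at v)"
    using isCont_H[OF v] h by (intro tendsto_intros) (auto simp: isCont_def)
  then have lim: "((\<lambda>w. \<bar>1 / H w - 1 / H v\<bar>) \<longlongrightarrow> 0) (at v)" by simp
  have "((\<lambda>w. k w - 1 / H v) \<longlongrightarrow> 0) (at v)"
    by (rule Lim_null_comparison[OF _ lim]) (use ev k(2) in \<open>auto elim!: eventually_mono\<close>)
  then have "(k \<longlongrightarrow> 1 / H v) (at v)" by (rule LIM_zero_cancel)
  then have "((\<lambda>w. - inverse (k w)) \<longlongrightarrow> - inverse (1 / H v)) (at v)"
    using h by (intro tendsto_intros) auto
  then have *: "((\<lambda>w. - inverse (k w)) \<longlongrightarrow> - H v) (at v)" by simp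
  show ?thesis unfolding has_field_derivative_iff
  proof (rule Lim_transform_eventually[OF *])
    show "\<forall>\<^sub>F w in at v. - inverse (k w) = (\<beta> (H w) - \<beta> (H v)) / (w - v)"
      using ev eventually_neq_at_within[of v]
    proof eventually_elim
      case (elim w)
      then have "k w \<noteq> 0" using k(1)[of w] by auto
      then show ?case using elim k(1)[of w] by (simp add: field_simps)
    qed
  qed
qed

text \<open>At zeros of \<open>\<beta>'\<close> the differentiability of \<open>\<beta> \<circ> u\<close> does not pass to \<open>u\<close>; secants replace the chain rule.\<close>

lemma DERIV_P_comp:
  fixes u :: "real \<Rightarrow> real"
  assumes pos: "\<And>x. x \<in> S \<Longrightarrow> u x > 0" and S: "open S" "x0 \<in> S" and c: "isCont u x0"
    and d: "((\<lambda>x. \<beta> (u x)) has_real_derivative - (u x0 * D)) (at x0)"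
  shows "((\<lambda>x. P (u x)) has_real_derivative D) (at x0)"
proof -
  have u0: "u x0 > 0" using pos S by simp
  have "\<exists>k. P (u x) - P (u x0) = - k * (\<beta> (u x) - \<beta> (u x0)) \<and> \<bar>k - 1 / u x0\<bar> \<le> \<bar>1 / u x - 1 / u x0\<bar>" if "x \<in> S" for x
    using P_secant[OF u0 pos[OF that]] .
  then obtain k where k: "\<And>x. x \<in> S \<Longrightarrow> P (u x) - P (u x0) = - k x * (\<beta> (u x) - \<beta> (u x0))"
    "\<And>x. x \<in> S \<Longrightarrow> \<bar>k x - 1 / u x0\<bar> \<le> \<bar>1 / u x - 1 / u x0\<bar>" by metis
  have ev: "\<forall>\<^sub>F x in at x0. x \<in> S" using S by (rule eventually_at_in_open')
  have "((\<lambda>x. \<bar>1 / u x - 1 / u x0\<bar>) \<longlongrightarrow> \<bar>1 / u x0 - 1 / u x0\<bar>) (at x0)"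
    using c u0 by (intro tendsto_intros) (auto simp: isCont_def)
  then have lim: "((\<lambda>x. \<bar>1 / u x - 1 / u x0\<bar>) \<longlongrightarrow> 0) (at x0)" by simp
  have "((\<lambda>x. k x - 1 / u x0) \<longlongrightarrow> 0) (at x0)"
    by (rule Lim_null_comparison[OF _ lim]) (use ev k(2) in \<open>auto elim!: eventually_mono\<close>)
  then have "(k \<longlongrightarrow> 1 / u x0) (at x0)" by (rule LIM_zero_cancel)
  moreover have "((\<lambda>x. (\<beta> (u x) - \<beta> (u x0)) / (x - x0)) \<longlongrightarrow> - (u x0 * D)) (at x0)"
    using d by (simp add: has_field_derivative_iff)
  ultimately have "((\<lambda>x. - k x * ((\<beta> (u x) - \<beta> (u x0)) / (x - x0))) \<longlongrightarrow> - (1 / u x0) * - (u x0 * D)) (at x0)"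
    by (intro tendsto_intros)
  then have *: "((\<lambda>x. - k x * ((\<beta> (u x) - \<beta> (u x0)) / (x - x0))) \<longlongrightarrow> D) (at x0)" using u0 by simp
  show ?thesis unfolding has_field_derivative_iff
    by (rule Lim_transform_eventually[OF *]) (use ev k(1) in \<open>auto elim!: eventually_mono\<close>)
qed

text \<open>The density of an equilibrium as a function of \<open>V - C\<close>: the function \<open>H\<close>, continuously extended by
the value \<open>+\<infinity>\<close>.\<close>

definition K :: "real \<Rightarrow> ennreal" where
  "K v = (if v > 0 then ennreal (H v) else \<infinity>)"

lemma continuous_K: "continuous_on UNIV K"
proof (rule continuous_on_extend_by_limit[where f="\<lambda>v. ennreal (H v)" and c=\<infinity>])
  show "isCont (\<lambda>v. ennreal (H v)) v" if "v > 0" for v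
    using isCont_H[OF that] by (simp add: isCont_def tendsto_ennrealI)
  show "((\<lambda>v. ennreal (H v)) \<longlongrightarrow> \<infinity>) (at_right 0)"
    unfolding infinity_ennreal_def by (intro ennreal_tendsto_top_eq_at_top[THEN iffD2] H_tendsto_at_top)
qed (auto simp: K_def)

lemma beta_ext_le: "beta_ext \<beta> r \<le> sup_\<beta>" and beta_ext_nonneg: "0 \<le> beta_ext \<beta> r"
proof -
  have "0 \<le> \<beta> a" if "a \<ge> 0" for a using beta_pos[of a] that zero by (cases "a = 0") auto
  then show "beta_ext \<beta> r \<le> sup_\<beta>" "0 \<le> beta_ext \<beta> r"
    using beta_less_sup[of "enn2real r"] sup_pos
    by (auto simp: beta_ext_def sup_\<beta>_def[symmetric] less_imp_le)
qed

text \<open>Continuity of the extension at \<open>+\<infinity>\<close> is the monotone convergence \<open>\<beta>(r) \<longrightarrow> sup_\<beta>\<close>.\<close>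

lemma continuous_beta_ext:
  fixes u :: "real \<Rightarrow> ennreal"
  assumes c: "continuous_on UNIV u"
  shows "continuous_on UNIV (\<lambda>x. beta_ext \<beta> (u x))"
proof (rule continuous_at_imp_continuous_on, rule ballI)
  fix x :: real
  have ux: "(u \<longlongrightarrow> u x) (at x)" using c by (auto simp: continuous_on_def)
  have "((\<lambda>y. beta_ext \<beta> (u y)) \<longlongrightarrow> beta_ext \<beta> (u x)) (at x)"
  proof (cases "u x = \<infinity>")
    case False
    then have ev: "\<forall>\<^sub>F y in at x. u y < \<infinity>"
      using order_tendstoD(2)[OF ux, of \<infinity>] by (simp add: less_top)
    have "((\<lambda>y. enn2real (u y)) \<longlongrightarrow> enn2real (u x)) (at x)"
      using ux False by (intro tendsto_enn2real) (auto simp: less_top)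
    then have "((\<lambda>y. \<beta> (enn2real (u y))) \<longlongrightarrow> \<beta> (enn2real (u x))) (at x)"
      by (rule continuous_on_tendsto_compose[OF continuous_beta]) auto
    then have "((\<lambda>y. \<beta> (enn2real (u y))) \<longlongrightarrow> beta_ext \<beta> (u x)) (at x)"
      using False by (simp add: beta_ext_def)
    then show ?thesis
    proof (rule Lim_transform_eventually)
      show "\<forall>\<^sub>F y in at x. \<beta> (enn2real (u y)) = beta_ext \<beta> (u y)"
        using ev by eventually_elim (auto simp: beta_ext_def)
    qed
  next
    case True
    have B: "beta_ext \<beta> (u x) = sup_\<beta>" using True by (simp add: beta_ext_def sup_\<beta>_def)
    show ?thesis unfolding B
    proof (rule order_tendstoI)
      fix a assume "a < sup_\<beta>"
      then have "\<forall>\<^sub>F r in at_top. a < \<beta> r" by (rule order_tendstoD(1)[OF beta_tendsto])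
      then have "\<forall>\<^sub>F r in at_top. a < \<beta> r \<and> r > 0" using eventually_gt_at_top[of 0] by eventually_elim simp
      then obtain r where r: "a < \<beta> r" "r > 0" using eventually_happens[of _ "at_top :: real filter"] by auto
      have "\<forall>\<^sub>F y in at x. ennreal r < u y" by (rule order_tendstoD(1)[OF ux]) (simp add: True)
      then show "\<forall>\<^sub>F y in at x. a < beta_ext \<beta> (u y)"
      proof eventually_elim
        case (elim y)
        show ?case
        proof (cases "u y = \<infinity>")
          case True
          then show ?thesis using r beta_less_sup[of r] by (simp add: beta_ext_def sup_\<beta>_def[symmetric])
        next
          case False
          then have "u y = ennreal (enn2real (u y))" by (simp add: less_top)
          then have "r < enn2real (u y)" using elim r by (metis ennreal_less_iff less_imp_le)
          then show ?thesis using r beta_less[of r "enn2real (u y)"] False by (simp add: beta_ext_def)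
        qed
      qed
    next
      fix a assume "sup_\<beta> < a"
      then show "\<forall>\<^sub>F y in at x. beta_ext \<beta> (u y) < a" using beta_ext_le by (intro always_eventually) (auto intro: le_less_trans)
    qed
  qed
  then show "isCont (\<lambda>y. beta_ext \<beta> (u y)) x" by (simp add: isCont_def)
qed

lemma continuous_beta_K: "continuous_on UNIV (\<lambda>v. beta_ext \<beta> (K v))"
  by (rule continuous_beta_ext[OF continuous_K])

text \<open>Near \<open>0\<close> the bound comes from the derivative of \<open>\<beta>\<close> at \<open>0\<close>, away from \<open>0\<close> from the boundedness of
\<open>\<beta>\<close>. It makes \<open>\<beta>(H(V - C))\<close> integrable as soon as the profile \<open>H(V - C)\<close> is.\<close>

lemma beta_linear_bound: "\<exists>\<kappa>. \<forall>r\<ge>0. \<beta> r \<le> \<kappa> * r"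
proof -
  obtain b where "\<forall>r\<ge>0. (\<beta> has_real_derivative b r) (at r within {0..})" using C1 by blast
  then have "((\<lambda>r. (\<beta> r - \<beta> 0) / (r - 0)) \<longlongrightarrow> b 0) (at 0 within {0..})"
    unfolding has_field_derivative_iff by blast
  then have "\<forall>\<^sub>F r in at 0 within {0..}. \<beta> r / r < b 0 + 1"
    using order_tendstoD(2)[of _ "b 0" _ "b 0 + 1"] zero by simp
  then obtain d where d: "d > 0" "\<And>r. 0 < r \<Longrightarrow> r < d \<Longrightarrow> \<beta> r / r < b 0 + 1"
    unfolding eventually_at by (auto simp: dist_real_def)
  define \<kappa> where "\<kappa> = max (b 0 + 1) (sup_\<beta> / d)"
  have "\<beta> r \<le> \<kappa> * r" if "r \<ge> 0" for r
  proof -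
    consider "r = 0" | "0 < r" "r < d" | "r \<ge> d" using \<open>r \<ge> 0\<close> by linarith
    then show ?thesis
    proof cases
      case 2
      have "\<beta> r \<le> (b 0 + 1) * r" using d(2)[OF 2] 2 by (simp add: field_simps)
      also have "\<dots> \<le> \<kappa> * r" using 2 by (intro mult_right_mono) (auto simp: \<kappa>_def)
      finally show ?thesis .
    next
      case 3
      have "\<beta> r \<le> (sup_\<beta> / d) * d" using beta_less_sup[OF that] d(1) by simp
      also have "\<dots> \<le> (sup_\<beta> / d) * r" using 3 d(1) sup_pos by (intro mult_left_mono) auto
      also have "\<dots> \<le> \<kappa> * r" using that by (intro mult_right_mono) (auto simp: \<kappa>_def)
      finally show ?thesis .
    qed (simp add: zero)
  qed
  then show ?thesis by blast
qed

lemma E_fun_eq: "E_fun \<beta> r = - \<beta> r - r * P r"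
  by (simp add: E_fun_def P_def E_prime_def zero)

text \<open>Since \<open>E(r) = - \<beta>(r) - r P(r)\<close>, the difference of both sides is \<open>\<beta>(H v) - \<beta>(r) + r (v - P(r))\<close>, and
\<open>v = P(H v)\<close> reduces its sign to \<open>P_increment\<close>.\<close>

lemma legendre:
  assumes v: "v > 0" and r: "r \<ge> 0"
  shows "- \<beta> (H v) \<le> E_fun \<beta> r + v * r" and "E_fun \<beta> r + v * r = - \<beta> (H v) \<longleftrightarrow> r = H v"
proof -
  have h: "H v > 0" using H_pos v .
  consider "r = H v" | "r = 0" | "0 < r" "r < H v" | "H v < r" using r by linarith
  then have "- \<beta> (H v) \<le> E_fun \<beta> r + v * r \<and> (E_fun \<beta> r + v * r = - \<beta> (H v) \<longleftrightarrow> r = H v)"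
  proof cases
    case 1
    then show ?thesis using P_H[OF v] by (simp add: E_fun_eq)
  next
    case 2
    then show ?thesis using beta_pos[OF h] h by (simp add: E_fun_eq zero)
  next
    case 3
    have "r * (P r - P (H v)) < \<beta> (H v) - \<beta> r" using P_increment(2)[OF 3] 3 by (simp add: field_simps)
    then show ?thesis using 3 P_H[OF v] by (simp add: E_fun_eq algebra_simps)
  next
    case 4
    have "\<beta> r - \<beta> (H v) < r * (P (H v) - P r)" using P_increment(1)[OF h 4] 4 h by (simp add: field_simps)
    then show ?thesis using 4 P_H[OF v] by (simp add: E_fun_eq algebra_simps)
  qed
  then show "- \<beta> (H v) \<le> E_fun \<beta> r + v * r" "E_fun \<beta> r + v * r = - \<beta> (H v) \<longleftrightarrow> r = H v" by auto
qed

lemma E_fun_measurable: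
  assumes "u \<in> borel_measurable M" "\<And>x. u x \<ge> 0"
  shows "(\<lambda>x. E_fun \<beta> (u x)) \<in> borel_measurable M"
proof -
  have "(\<lambda>r. if r \<in> {0<..} then - \<beta> r - r * P r else 0) \<in> borel_measurable borel"
    by (intro borel_measurable_continuous_on_if continuous_intros continuous_P continuous_on_subset[OF continuous_beta]) auto
  from measurable_compose[OF assms(1) this]
  have "(\<lambda>x. if u x \<in> {0<..} then - \<beta> (u x) - u x * P (u x) else 0) \<in> borel_measurable M" .
  moreover have "(if u x \<in> {0<..} then - \<beta> (u x) - u x * P (u x) else 0) = E_fun \<beta> (u x)" for x
    using assms(2)[of x] by (auto simp: E_fun_eq zero less_le)
  ultimately show ?thesis by simp
qed

end

section \<open>Lebesgue decomposition with respect to Lebesgue measure\<close>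

text \<open>Among all Lebesgue null sets one of maximal \<open>\<rho>\<close>-measure carries the singular part; by maximality
the rest of \<open>\<rho>\<close> is absolutely continuous.\<close>

lemma lebesgue_decomposition_exists:
  assumes "\<rho> \<in> Mplus"
  shows "\<exists>u \<sigma>. lebesgue_decomposition \<rho> u \<sigma>"
proof -
  have sets: "sets \<rho> = sets borel" and "finite_measure \<rho>" using assms by (auto simp: Mplus_def)
  interpret finite_measure \<rho> by fact
  let ?A = "emeasure \<rho> ` null_sets lborel"
  have ne: "?A \<noteq> {}" by blast
  obtain f :: "nat \<Rightarrow> ennreal" where f: "incseq f" "range f \<subseteq> ?A" "Sup ?A = (SUP i. f i)"
    using ennreal_Sup_countable_SUP[OF ne] by auto
  have "\<exists>B. B \<in> null_sets lborel \<and> f i = emeasure \<rho> B" for i using f(2) by blast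
  then obtain B where B: "\<And>i. B i \<in> null_sets lborel" "\<And>i. f i = emeasure \<rho> (B i)" by metis
  define N where "N = (\<Union>i::nat. B i)"
  have N: "N \<in> null_sets lborel" unfolding N_def by (rule null_sets_UN) (rule B)
  have bN: "N \<in> sets borel" using N by auto
  have max: "emeasure \<rho> A \<le> emeasure \<rho> N" if "A \<in> null_sets lborel" for A
  proof -
    have "emeasure \<rho> A \<le> (SUP i. f i)" unfolding f(3)[symmetric] using that by (intro Sup_upper) auto
    also have "\<dots> \<le> emeasure \<rho> N"
      using bN sets by (intro SUP_least) (auto simp: B(2) N_def intro!: emeasure_mono)
    finally show ?thesis .
  qed
  define \<sigma> where "\<sigma> = density \<rho> (indicator N)"
  define \<tau> where "\<tau> = density \<rho> (indicator (- N))"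
  have s: "emeasure \<sigma> A = emeasure \<rho> (N \<inter> A)" "emeasure \<tau> A = emeasure \<rho> (- N \<inter> A)" if "A \<in> sets borel" for A
    unfolding \<sigma>_def \<tau>_def using that bN sets by (simp_all add: emeasure_restricted)
  have "absolutely_continuous lborel \<tau>"
    unfolding absolutely_continuous_def
  proof
    fix A :: "real set" assume A: "A \<in> null_sets lborel"
    then have bA: "A \<in> sets borel" by auto
    have d: "emeasure \<rho> (N \<union> A) = emeasure \<rho> N + emeasure \<rho> (A - N)"
      using plus_emeasure[of N \<rho> "A - N"] bN bA sets by (auto simp: Un_Diff_cancel)
    have "emeasure \<rho> (N \<union> A) \<le> emeasure \<rho> N + 0" using max[of "N \<union> A"] N A by auto
    then have "emeasure \<rho> (A - N) = 0" unfolding d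
      using emeasure_finite[of N] by (simp add: ennreal_add_left_cancel_le)
    moreover have "- N \<inter> A = A - N" by auto
    ultimately show "A \<in> null_sets \<tau>" using s(2)[OF bA] bA sets by (auto simp: null_sets_def \<tau>_def)
  qed
  then obtain u where u: "u \<in> borel_measurable lborel" "density lborel u = \<tau>"
    using sigma_finite_measure.Radon_Nikodym[OF sigma_finite_lborel, of \<tau>] sets by (auto simp: \<tau>_def)
  have "lebesgue_decomposition \<rho> u \<sigma>"
    unfolding lebesgue_decomposition_def
  proof (intro conjI bexI[OF _ N] ballI)
    show "u \<in> borel_measurable borel" using u by simp
    show "sets \<sigma> = sets borel" using sets by (simp add: \<sigma>_def)
    show "emeasure \<sigma> (- N) = 0" using s(1)[of "- N"] bN by simp
    fix A :: "real set" assume A: "A \<in> sets borel"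
    have "(\<integral>\<^sup>+x\<in>A. u x \<partial>lborel) = emeasure \<tau> A" unfolding u(2)[symmetric] using A u(1) by (simp add: emeasure_density)
    then show "emeasure \<rho> A = (\<integral>\<^sup>+x\<in>A. u x \<partial>lborel) + emeasure \<sigma> A"
      using s[OF A] A bN sets plus_emeasure[of "- N \<inter> A" \<rho> "N \<inter> A"]
      by (simp add: Int_Un_distrib2[symmetric] Int_assoc Int_left_commute)
  qed
  then show ?thesis by blast
qed

text \<open>The union \<open>M\<close> of the two exceptional null sets separates both decompositions simultaneously.\<close>

lemma lebesgue_decomposition_unique:
  assumes "lebesgue_decomposition \<rho> u \<sigma>" "lebesgue_decomposition \<rho> u' \<sigma>'"
  shows "\<sigma> = \<sigma>'" "AE x in lborel. u x = u' x"
proof -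
  obtain N N' where N: "N \<in> null_sets lborel" "emeasure \<sigma> (- N) = 0" "N' \<in> null_sets lborel" "emeasure \<sigma>' (- N') = 0"
    using assms by (auto simp: lebesgue_decomposition_def)
  have m [measurable]: "u \<in> borel_measurable borel" "u' \<in> borel_measurable borel"
    and s: "sets \<sigma> = sets borel" "sets \<sigma>' = sets borel"
    and e: "\<And>A. A \<in> sets borel \<Longrightarrow> emeasure \<rho> A = (\<integral>\<^sup>+x\<in>A. u x \<partial>lborel) + emeasure \<sigma> A"
           "\<And>A. A \<in> sets borel \<Longrightarrow> emeasure \<rho> A = (\<integral>\<^sup>+x\<in>A. u' x \<partial>lborel) + emeasure \<sigma>' A"
    using assms by (auto simp: lebesgue_decomposition_def)
  define M where "M = N \<union> N'"
  have M: "M \<in> null_sets lborel" using N unfolding M_def by blast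
  have bN: "N \<in> sets borel" "N' \<in> sets borel" using null_setsD2[OF N(1)] null_setsD2[OF N(3)] by simp_all
  then have bM: "M \<in> sets borel" unfolding M_def by blast
  note M = M bM
  have AEM: "AE x in lborel. x \<notin> M" using M(1) AE_not_in by blast
  have off: "emeasure \<sigma> (A - M) = 0" "emeasure \<sigma>' (A - M) = 0" for A
  proof -
    have "emeasure \<sigma> (A - M) \<le> emeasure \<sigma> (- N)" "emeasure \<sigma>' (A - M) \<le> emeasure \<sigma>' (- N')"
      by (rule emeasure_mono, force simp: M_def, use bN s in auto)+
    then show "emeasure \<sigma> (A - M) = 0" "emeasure \<sigma>' (A - M) = 0" using N by auto
  qed
  have null: "(\<integral>\<^sup>+x\<in>A \<inter> M. v x \<partial>lborel) = 0" for A and v :: "real \<Rightarrow> ennreal"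
  proof -
    have "(\<integral>\<^sup>+x\<in>A \<inter> M. v x \<partial>lborel) = nn_integral (lborel :: real measure) (\<lambda>x. 0)"
      by (rule nn_integral_cong_AE) (use AEM in eventually_elim, auto)
    then show ?thesis by simp
  qed
  have split: "emeasure L A = emeasure L (A \<inter> M)" if "emeasure L (A - M) = 0" "sets L = sets borel" "A \<in> sets borel" for A and L :: "real measure"
  proof -
    have "emeasure L ((A \<inter> M) \<union> (A - M)) = emeasure L (A \<inter> M) + emeasure L (A - M)"
      using that M by (intro plus_emeasure[symmetric]) auto
    moreover have "(A \<inter> M) \<union> (A - M) = A" by auto
    ultimately show ?thesis using that by simp
  qed
  show "\<sigma> = \<sigma>'"
  proof (rule measure_eqI)
    fix A assume "A \<in> sets \<sigma>"
    then have A: "A \<in> sets borel" using s by simp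
    have "emeasure \<sigma> (A \<inter> M) = emeasure \<sigma>' (A \<inter> M)" using e(1)[of "A \<inter> M"] e(2)[of "A \<inter> M"] A M null by simp
    then show "emeasure \<sigma> A = emeasure \<sigma>' A" using split[OF off(1) s(1) A] split[OF off(2) s(2) A] by simp
  qed (simp add: s)
  show "AE x in lborel. u x = u' x"
  proof (rule sigma_finite_measure.density_unique[OF sigma_finite_lborel])
    show "density lborel u = density lborel u'"
    proof (rule measure_eqI)
      fix A assume "A \<in> sets (density lborel u)"
      then have A: "A \<in> sets borel" by simp
      have v: "(\<integral>\<^sup>+x\<in>A. v x \<partial>lborel) = (\<integral>\<^sup>+x\<in>A - M. v x \<partial>lborel)" for v :: "real \<Rightarrow> ennreal"
        by (rule nn_integral_cong_AE) (use AEM in eventually_elim, auto simp: indicator_def)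
      have "(\<integral>\<^sup>+x\<in>A - M. u x \<partial>lborel) = (\<integral>\<^sup>+x\<in>A - M. u' x \<partial>lborel)"
        using e(1)[of "A - M"] e(2)[of "A - M"] A M off by simp
      then show "emeasure (density lborel u) A = emeasure (density lborel u') A"
        using A v[of u] v[of u'] by (simp add: emeasure_density)
    qed simp
  qed auto
qed

lemma singular_part_eq:
  assumes "lebesgue_decomposition \<rho> u \<sigma>"
  shows "singular_part \<rho> = \<sigma>"
  unfolding singular_part_def
  by (rule the_equality) (use assms lebesgue_decomposition_unique(1) in blast)+

lemma lebesgue_decomposition_ac_density:
  assumes "\<rho> \<in> Mplus"
  shows "lebesgue_decomposition \<rho> (ac_density \<rho>) (singular_part \<rho>)"
proof -
  have "\<exists>\<sigma>. lebesgue_decomposition \<rho> (ac_density \<rho>) \<sigma>"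
    unfolding ac_density_def using someI_ex[OF lebesgue_decomposition_exists[OF assms]] .
  then show ?thesis using singular_part_eq by blast
qed

lemma null_open_imp_empty:
  fixes S :: "real set"
  assumes "open S" "AE x in lborel. x \<notin> S"
  shows "S = {}"
proof -
  have "S \<in> null_sets lborel" using assms by (subst AE_iff_null_sets) auto
  then have "negligible S" by (simp add: negligible_iff_null_sets null_sets_completionI)
  then show ?thesis using open_not_negligible assms(1) by blast
qed

text \<open>The set where two continuous functions differ is open, so it is empty once it is null.\<close>

lemma continuous_AE_eq_imp_eq:
  fixes f g :: "real \<Rightarrow> 'b::t2_space"
  assumes "continuous_on UNIV f" "continuous_on UNIV g" "AE x in lborel. f x = g x"
  shows "f = g"
proof -
  have "{x. f x \<noteq> g x} = {}"
    using assms by (intro null_open_imp_empty open_Collect_neq) auto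
  then show ?thesis by auto
qed

lemma cont_density_eq:
  assumes "continuous_on UNIV u" "lebesgue_decomposition \<rho> u \<sigma>"
  shows "cont_density \<rho> = u"
  unfolding cont_density_def
proof (rule the_equality)
  show "continuous_on UNIV u \<and> lebesgue_decomposition \<rho> u (singular_part \<rho>)"
    using assms singular_part_eq by blast
  fix v assume v: "continuous_on UNIV v \<and> lebesgue_decomposition \<rho> v (singular_part \<rho>)"
  then show "v = u" using continuous_AE_eq_imp_eq lebesgue_decomposition_unique(2) assms by blast
qed

lemma lebesgue_decomposition_nn_integral:
  assumes d: "lebesgue_decomposition \<rho> u \<sigma>" and \<rho>: "\<rho> \<in> Mplus" and f: "f \<in> borel_measurable borel"
  shows "(\<integral>\<^sup>+x. f x \<partial>\<rho>) = (\<integral>\<^sup>+x. f x * u x \<partial>lborel) + (\<integral>\<^sup>+x. f x \<partial>\<sigma>)"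
proof -
  have u [measurable]: "u \<in> borel_measurable borel" and s: "sets \<sigma> = sets borel" "sets \<rho> = sets borel"
    using d \<rho> by (auto simp: lebesgue_decomposition_def Mplus_def)
  note [measurable_cong] = s
  show ?thesis using f
  proof (induction rule: borel_measurable_induct)
    case (cong f g)
    then have "f = g" by (auto simp: fun_eq_iff)
    then show ?case using cong by simp
  next
    case (set A)
    then have "emeasure \<rho> A = (\<integral>\<^sup>+x\<in>A. u x \<partial>lborel) + emeasure \<sigma> A"
      using d by (simp add: lebesgue_decomposition_def)
    then show ?case using set s by (simp add: mult.commute)
  next
    case (mult f c)
    have [measurable]: "f \<in> borel_measurable borel" by fact
    show ?case using mult(4) by (simp add: nn_integral_cmult mult.assoc distrib_left)
  next
    case (add f g)
    have [measurable]: "f \<in> borel_measurable borel" "g \<in> borel_measurable borel" by fact+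
    have "(\<integral>\<^sup>+x. (f x + g x) * u x \<partial>lborel) = (\<integral>\<^sup>+x. f x * u x \<partial>lborel) + (\<integral>\<^sup>+x. g x * u x \<partial>lborel)"
      unfolding distrib_right by (rule nn_integral_add) measurable
    moreover have "(\<integral>\<^sup>+x. f x + g x \<partial>L) = (\<integral>\<^sup>+x. f x \<partial>L) + (\<integral>\<^sup>+x. g x \<partial>L)" if "sets L = sets borel" for L
      using that by (intro nn_integral_add) (auto cong: measurable_cong_sets)
    ultimately show ?case using add.IH s by (simp add: ac_simps)
  next
    case (seq F)
    have [measurable]: "F i \<in> borel_measurable borel" for i using seq by blast
    have S: "(\<lambda>x. Sup (range F) x) = (\<lambda>x. SUP i. F i x)" by (auto simp: image_image)
    have "incseq (\<lambda>i x. F i x * u x)" using \<open>incseq F\<close> by (auto simp: incseq_def le_fun_def intro: mult_right_mono)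
    then have 1: "(\<integral>\<^sup>+x. (SUP i. F i x * u x) \<partial>lborel) = (SUP i. \<integral>\<^sup>+x. F i x * u x \<partial>lborel)"
      by (rule nn_integral_monotone_convergence_SUP) measurable
    have 2: "(\<integral>\<^sup>+x. (SUP i. F i x) \<partial>L) = (SUP i. \<integral>\<^sup>+x. F i x \<partial>L)" if "sets L = sets borel" for L
      using \<open>incseq F\<close> that by (intro nn_integral_monotone_convergence_SUP) (auto cong: measurable_cong_sets)
    have i: "incseq (\<lambda>i. \<integral>\<^sup>+x. F i x * u x \<partial>lborel)" "incseq (\<lambda>i. \<integral>\<^sup>+x. F i x \<partial>\<sigma>)"
      using \<open>incseq F\<close> by (auto simp: incseq_def le_fun_def intro!: nn_integral_mono mult_right_mono)
    have 3: "(SUP i. F i x) * u x = (SUP i. F i x * u x)" for x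
      by (rule SUP_mult_right_ennreal)
    have "(SUP i. \<integral>\<^sup>+x. F i x \<partial>\<rho>) = (SUP i. (\<integral>\<^sup>+x. F i x * u x \<partial>lborel) + (\<integral>\<^sup>+x. F i x \<partial>\<sigma>))"
      using seq.IH by simp
    also have "\<dots> = (SUP i. \<integral>\<^sup>+x. F i x * u x \<partial>lborel) + (SUP i. \<integral>\<^sup>+x. F i x \<partial>\<sigma>)"
      by (rule ennreal_SUP_add[OF i])
    finally show ?case unfolding S 3 1 2[OF s(1)] 2[OF s(2)] .
  qed
qed

lemma lebesgue_decomposition_mass:
  assumes d: "lebesgue_decomposition \<rho> u \<sigma>" and \<rho>: "\<rho> \<in> Mplus"
  shows "(\<integral>\<^sup>+x. u x \<partial>lborel) < \<infinity>" "finite_measure \<sigma>" "AE x in lborel. u x < \<infinity>"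
    "integrable lborel (\<lambda>x. enn2real (u x))"
    "measure \<rho> UNIV = (LINT x|lborel. enn2real (u x)) + measure \<sigma> UNIV"
proof -
  have u [measurable]: "u \<in> borel_measurable borel" and s: "sets \<sigma> = sets borel" "sets \<rho> = sets borel"
    and fin: "finite_measure \<rho>"
    using d \<rho> by (auto simp: lebesgue_decomposition_def Mplus_def)
  have e: "emeasure \<rho> UNIV = (\<integral>\<^sup>+x. u x \<partial>lborel) + emeasure \<sigma> UNIV"
    using d by (simp add: lebesgue_decomposition_def)
  interpret finite_measure \<rho> by fact
  have "emeasure \<rho> UNIV < \<infinity>" by (metis emeasure_finite infinity_ennreal_def less_top)
  then have f: "(\<integral>\<^sup>+x. u x \<partial>lborel) < \<infinity>" "emeasure \<sigma> UNIV < \<infinity>" unfolding e by auto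
  then show "(\<integral>\<^sup>+x. u x \<partial>lborel) < \<infinity>" by simp
  have sp: "space \<sigma> = UNIV" using sets_eq_imp_space_eq[OF s(1)] by simp
  show F: "finite_measure \<sigma>" by (rule finite_measureI) (use f sp in simp)
  show ae: "AE x in lborel. u x < \<infinity>"
    using nn_integral_PInf_AE[of u lborel] f(1) by (auto simp: less_top)
  then have "AE x in lborel. ennreal (enn2real (u x)) = u x" by eventually_elim simp
  then have eq: "(\<integral>\<^sup>+x. ennreal (enn2real (u x)) \<partial>lborel) = (\<integral>\<^sup>+x. u x \<partial>lborel)" by (rule nn_integral_cong_AE)
  show i: "integrable lborel (\<lambda>x. enn2real (u x))"
    by (rule integrableI_nonneg) (use eq f in auto)
  have "emeasure \<rho> UNIV = ennreal (LINT x|lborel. enn2real (u x)) + emeasure \<sigma> UNIV"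
    unfolding e eq[symmetric] using nn_integral_eq_integral[OF i] by simp
  also have "\<dots> = ennreal ((LINT x|lborel. enn2real (u x)) + measure \<sigma> UNIV)"
    using finite_measure.emeasure_eq_measure[OF F] by simp
  finally show "measure \<rho> UNIV = (LINT x|lborel. enn2real (u x)) + measure \<sigma> UNIV"
    unfolding emeasure_eq_measure
    by (subst (asm) ennreal_inj) (auto intro!: add_nonneg_nonneg Bochner_Integration.integral_nonneg)
qed

lemma lebesgue_decomposition_integral:
  fixes f :: "real \<Rightarrow> real"
  assumes d: "lebesgue_decomposition \<rho> u \<sigma>" and \<rho>: "\<rho> \<in> Mplus" and f: "integrable \<rho> f"
  shows "integrable lborel (\<lambda>x. f x * enn2real (u x))" "integrable \<sigma> f"
    "(LINT x|\<rho>. f x) = (LINT x|lborel. f x * enn2real (u x)) + (LINT x|\<sigma>. f x)"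
proof -
  have u [measurable]: "u \<in> borel_measurable borel" and s: "sets \<sigma> = sets borel" "sets \<rho> = sets borel"
    using d \<rho> by (auto simp: lebesgue_decomposition_def Mplus_def)
  note [measurable_cong] = s
  have fm [measurable]: "f \<in> borel_measurable borel"
    using borel_measurable_integrable[OF f] measurable_cong_sets[OF s(2)] by blast
  have nn: "(\<integral>\<^sup>+x. ennreal (g x) \<partial>\<rho>) = (\<integral>\<^sup>+x. ennreal (g x * enn2real (u x)) \<partial>lborel) + (\<integral>\<^sup>+x. ennreal (g x) \<partial>\<sigma>)"
    if [measurable]: "g \<in> borel_measurable borel" for g :: "real \<Rightarrow> real"
  proof -
    have "(\<integral>\<^sup>+x. ennreal (g x) * u x \<partial>lborel) = (\<integral>\<^sup>+x. ennreal (g x * enn2real (u x)) \<partial>lborel)"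
      using lebesgue_decomposition_mass(3)[OF d \<rho>]
      by (intro nn_integral_cong_AE, eventually_elim) (simp add: ennreal_mult'')
    then show ?thesis using lebesgue_decomposition_nn_integral[OF d \<rho>, of "\<lambda>x. ennreal (g x)"] by simp
  qed
  have fin: "(\<integral>\<^sup>+x. ennreal (norm (f x)) \<partial>\<rho>) < \<infinity>" using f by (simp add: integrable_iff_bounded)
  have n: "(\<integral>\<^sup>+x. ennreal (norm (f x)) \<partial>\<rho>) =
      (\<integral>\<^sup>+x. ennreal (norm (f x) * enn2real (u x)) \<partial>lborel) + (\<integral>\<^sup>+x. ennreal (norm (f x)) \<partial>\<sigma>)"
    by (rule nn) measurable
  have fin': "(\<integral>\<^sup>+x. ennreal (norm (f x) * enn2real (u x)) \<partial>lborel) < \<infinity>" "(\<integral>\<^sup>+x. ennreal (norm (f x)) \<partial>\<sigma>) < \<infinity>"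
    using fin unfolding n by auto
  show i1: "integrable lborel (\<lambda>x. f x * enn2real (u x))"
    by (rule integrableI_bounded) (use fin'(1) in \<open>auto simp: abs_mult\<close>)
  show i2: "integrable \<sigma> f"
    by (rule integrableI_bounded) (use fin'(2) in auto)
  have pn: "(LINT x|\<rho>. g x) = (LINT x|lborel. g x * enn2real (u x)) + (LINT x|\<sigma>. g x)"
    if [measurable]: "g \<in> borel_measurable borel" and g: "\<And>x. g x \<ge> 0" "integrable \<rho> g"
      "integrable lborel (\<lambda>x. g x * enn2real (u x))" "integrable \<sigma> g" for g :: "real \<Rightarrow> real"
  proof -
    have "ennreal (LINT x|\<rho>. g x) = ennreal (LINT x|lborel. g x * enn2real (u x)) + ennreal (LINT x|\<sigma>. g x)"
      using nn[of g] g by (simp add: nn_integral_eq_integral)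
    also have "\<dots> = ennreal ((LINT x|lborel. g x * enn2real (u x)) + (LINT x|\<sigma>. g x))"
      using g by (simp add: ennreal_plus)
    finally show ?thesis using g
      by (subst (asm) ennreal_inj) (auto intro!: add_nonneg_nonneg Bochner_Integration.integral_nonneg)
  qed
  define p where "p x = max 0 (f x)" for x
  define n where "n x = max 0 (- f x)" for x
  have fe: "f x = p x - n x" for x by (simp add: p_def n_def)
  have I: "integrable \<rho> p" "integrable \<rho> n" "integrable \<sigma> p" "integrable \<sigma> n"
    unfolding p_def n_def using f i2 by auto
  have "integrable lborel (\<lambda>x. max 0 (f x * enn2real (u x)))" "integrable lborel (\<lambda>x. max 0 (- (f x * enn2real (u x))))"
    using i1 by auto
  moreover have "max 0 (f x * enn2real (u x)) = p x * enn2real (u x)" "max 0 (- (f x * enn2real (u x))) = n x * enn2real (u x)" for x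
    by (simp_all add: p_def n_def max_mult_distrib_right)
  ultimately have I': "integrable lborel (\<lambda>x. p x * enn2real (u x))" "integrable lborel (\<lambda>x. n x * enn2real (u x))" by auto
  have [measurable]: "p \<in> borel_measurable borel" "n \<in> borel_measurable borel" unfolding p_def n_def by measurable
  have 0: "p x \<ge> 0" "n x \<ge> 0" for x by (auto simp: p_def n_def)
  have "(LINT x|\<rho>. p x) = (LINT x|lborel. p x * enn2real (u x)) + (LINT x|\<sigma>. p x)"
    by (rule pn[OF _ 0(1) I(1) I'(1) I(3)]) measurable
  moreover have "(LINT x|\<rho>. n x) = (LINT x|lborel. n x * enn2real (u x)) + (LINT x|\<sigma>. n x)"
    by (rule pn[OF _ 0(2) I(2) I'(2) I(4)]) measurable
  ultimately show "(LINT x|\<rho>. f x) = (LINT x|lborel. f x * enn2real (u x)) + (LINT x|\<sigma>. f x)"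
    unfolding fe using I I' by (simp add: left_diff_distrib)
qed

lemma Mplus_c_D:
  assumes "\<rho> \<in> Mplus_c"
  shows "\<rho> \<in> Mplus" "continuous_on UNIV (cont_density \<rho>)"
    "lebesgue_decomposition \<rho> (cont_density \<rho>) (singular_part \<rho>)"
    "emeasure (singular_part \<rho>) {x. cont_density \<rho> x < \<infinity>} = 0" "emeasure lborel {x. cont_density \<rho> x = \<infinity>} = 0"
proof -
  obtain u where u: "\<rho> \<in> Mplus" "continuous_on UNIV u" "lebesgue_decomposition \<rho> u (singular_part \<rho>)"
     "emeasure (singular_part \<rho>) {x. u x < \<infinity>} = 0" "emeasure lborel {x. u x = \<infinity>} = 0"
    using assms by (auto simp: Mplus_c_def)
  with cont_density_eq[OF u(2,3)]
  show "\<rho> \<in> Mplus" "continuous_on UNIV (cont_density \<rho>)"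
    "lebesgue_decomposition \<rho> (cont_density \<rho>) (singular_part \<rho>)"
    "emeasure (singular_part \<rho>) {x. cont_density \<rho> x < \<infinity>} = 0" "emeasure lborel {x. cont_density \<rho> x = \<infinity>} = 0"
    by auto
qed

lemma D_plus_open:
  assumes "continuous_on UNIV u" shows "open (D_plus u)"
proof -
  have "D_plus u = {x. 0 < u x} \<inter> {x. u x < \<infinity>}" by (auto simp: D_plus_def)
  then show ?thesis using assms by (auto intro!: open_Int open_Collect_less)
qed

section \<open>Equilibrium profiles\<close>

locale confined_pressure = saturating_pressure +
  fixes V :: "real \<Rightarrow> real"
  assumes V_C1: "V C1_differentiable_on UNIV"
    and coercive: "filterlim V at_top at_infinity"
begin

lemma DERIV_V: "(V has_real_derivative deriv V x) (at x)"
  and continuous_deriv_V: "continuous_on A (deriv V)"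
proof -
  obtain D where D: "\<And>x. (V has_vector_derivative D x) (at x)" "continuous_on UNIV D"
    using V_C1 by (auto simp: C1_differentiable_on_def)
  have r: "(V has_real_derivative D x) (at x)" for x
    using D(1) by (simp add: has_real_derivative_iff_has_vector_derivative)
  then have "deriv V = D" using DERIV_imp_deriv by blast
  then show "(V has_real_derivative deriv V x) (at x)" "continuous_on A (deriv V)"
    using r D(2) continuous_on_subset[of UNIV D A] by auto
qed

lemma continuous_V: "continuous_on A V"
  using DERIV_V DERIV_isCont continuous_at_imp_continuous_on by blast

lemma V_attains_min: "\<exists>x0. V x0 = V_min V" and V_min_le: "V_min V \<le> V x"
proof -
  have "\<forall>\<^sub>F x in at_infinity. V 0 \<le> V x" using coercive by (simp add: filterlim_at_top)
  then obtain b where b: "\<And>x. norm x \<ge> b \<Longrightarrow> V 0 \<le> V x" by (auto simp: eventually_at_infinity)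
  define B where "B = max b 1"
  obtain x0 where x0: "x0 \<in> {-B..B}" "\<And>y. y \<in> {-B..B} \<Longrightarrow> V x0 \<le> V y"
  proof -
    have "{-B..B} \<noteq> {}" by (simp add: B_def)
    then show thesis using that continuous_attains_inf[OF compact_Icc _ continuous_V, of "-B" B] by blast
  qed
  have min: "V x0 \<le> V y" for y
  proof (cases "y \<in> {-B..B}")
    case False
    then have "V 0 \<le> V y" by (intro b) (auto simp: B_def)
    moreover have "V x0 \<le> V 0" using x0(2)[of 0] by (simp add: B_def)
    ultimately show ?thesis by simp
  qed (use x0 in simp)
  then have "V_min V = V x0" unfolding V_min_def by (intro cInf_eq_minimum) auto
  then show "\<exists>x0. V x0 = V_min V" "V_min V \<le> V x" using min by auto
qed

text \<open>The common description of stationary measures and minimizers. That \<open>{V = C}\<close> is null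
restricts only the case \<open>C = min V\<close>, since this set is empty below the minimum.\<close>

definition equilibrium :: "real \<Rightarrow> real measure \<Rightarrow> bool" where
  "equilibrium C \<rho> \<longleftrightarrow> C \<le> V_min V \<and> emeasure lborel {x. V x = C} = 0 \<and>
     lebesgue_decomposition \<rho> (\<lambda>x. K (V x - C)) (singular_part \<rho>) \<and>
     emeasure (singular_part \<rho>) {x. V x \<noteq> C} = 0"

lemma continuous_K_V: "continuous_on A (\<lambda>x. K (V x - C))"
  by (intro continuous_on_compose2[OF continuous_K] continuous_intros continuous_V) auto

text \<open>The set \<open>{V = C}\<close>, where the profile is infinite, may be an uncountable closed set, so the derivative
is not computed piecewise. Raising \<open>V - C\<close> by \<open>1/(n+1)\<close> makes the profile bounded and \<open>C\<^sup>1\<close>; the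
formula for classical partial integration passes to the limit because \<open>H\<close> is decreasing, which
provides the dominating function \<open>H(V - C)\<close>.\<close>

lemma equilibrium_weak_deriv:
  assumes C: "C \<le> V_min V" and null: "emeasure lborel {x. V x = C} = 0"
    and int: "integrable lborel (\<lambda>x. enn2real (K (V x - C)))"
  shows "has_weak_deriv (\<lambda>x. beta_ext \<beta> (K (V x - C))) (\<lambda>x. - (deriv V x * enn2real (K (V x - C))))"
proof -
  let ?b = "\<lambda>x. beta_ext \<beta> (K (V x - C))" and ?u = "\<lambda>x. enn2real (K (V x - C))"
  have VC: "C \<le> V x" for x using C V_min_le[of x] by simp
  have cb: "continuous_on UNIV ?b" by (rule continuous_beta_ext[OF continuous_K_V])
  have "{x. V x = C} \<in> sets borel" using continuous_V[of UNIV] by (intro borel_closed closed_Collect_eq) auto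
  then have "{x. V x = C} \<in> null_sets lborel" using null by (auto simp: null_sets_def)
  then have "AE x in lborel. x \<notin> {x. V x = C}" by (rule AE_not_in)
  then have AEV: "AE x in lborel. V x > C"
  proof eventually_elim
    case (elim x)
    then show ?case using VC[of x] by simp
  qed
  have lg: "locally_integrable (\<lambda>x. deriv V x * ?u x)"
    by (intro locally_integrable_times_continuous locally_integrable_integrable int continuous_deriv_V)
  have "(LINT x|lborel. ?b x * deriv \<phi> x) = (LINT x|lborel. deriv V x * ?u x * \<phi> x)" if T: "test_function UNIV \<phi>" for \<phi>
  proof -
    obtain a b where ab: "a < b" and z: "\<And>x. x \<notin> {a..b} \<Longrightarrow> \<phi> x = 0" "\<And>x. x \<notin> {a..b} \<Longrightarrow> deriv \<phi> x = 0"
      and d: "\<And>x. (\<phi> has_real_derivative deriv \<phi> x) (at x)"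
      and c\<phi>: "continuous_on UNIV \<phi>" "continuous_on UNIV (deriv \<phi>)"
      using test_functionD[OF T] by blast
    define v where "v n x = V x - C + 1 / real (Suc n)" for n x
    have vp: "v n x > 0" for n x using VC[of x] by (simp add: v_def add_nonneg_pos)
    have dv: "(v n has_real_derivative deriv V x) (at x)" for n x
      unfolding v_def[abs_def] by (auto intro!: derivative_eq_intros DERIV_V)
    have cv: "continuous_on UNIV (v n)" for n unfolding v_def by (intro continuous_intros continuous_V)
    have cH: "continuous_on UNIV (\<lambda>x. H (v n x))" for n
      using isCont_H vp cv by (intro continuous_on_compose2[OF continuous_at_imp_continuous_on[of "{0<..}" H]]) auto
    have parts: "(LINT x|lborel. \<beta> (H (v n x)) * deriv \<phi> x) = - (LINT x|lborel. - H (v n x) * deriv V x * \<phi> x)" for n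
    proof (rule integral_by_parts_test_function[OF _ _ T])
      show "((\<lambda>x. \<beta> (H (v n x))) has_real_derivative - H (v n x) * deriv V x) (at x)" for x
        by (rule DERIV_chain2[OF DERIV_beta_H[OF vp] dv])
      show "continuous_on UNIV (\<lambda>x. - H (v n x) * deriv V x)" by (intro continuous_intros cH continuous_deriv_V)
    qed
    have vlim: "(\<lambda>n. v n x) \<longlonglongrightarrow> V x - C" for x
    proof -
      have "(\<lambda>n. V x - C + 1 / real (Suc n)) \<longlonglongrightarrow> V x - C + 0"
        by (intro tendsto_intros LIMSEQ_Suc[OF lim_1_over_n])
      then show ?thesis by (simp add: v_def)
    qed
    have b_eq: "\<beta> (H (v n x)) = beta_ext \<beta> (K (v n x))" for n x
      using vp[of n x] H_pos[OF vp[of n x]] by (simp add: K_def beta_ext_def less_imp_le)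
    have l1: "(\<lambda>n. LINT x|lborel. \<beta> (H (v n x)) * deriv \<phi> x) \<longlonglongrightarrow> (LINT x|lborel. ?b x * deriv \<phi> x)"
    proof (rule integral_dominated_convergence)
      show "(\<lambda>x. ?b x * deriv \<phi> x) \<in> borel_measurable lborel"
        using borel_measurable_continuous_onI[OF continuous_on_mult[OF cb c\<phi>(2)]] by simp
      have cbv: "continuous_on UNIV (\<lambda>x. \<beta> (H (v n x)) * deriv \<phi> x)" for n unfolding b_eq
        by (intro continuous_intros c\<phi>(2) continuous_on_compose2[OF continuous_beta_K cv]) auto
      show "(\<lambda>x. \<beta> (H (v n x)) * deriv \<phi> x) \<in> borel_measurable lborel" for n
        using borel_measurable_continuous_onI[OF cbv] by simp
      have "integrable lborel (\<lambda>x. deriv \<phi> x * 1)"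
        by (rule integrable_times_continuous_supported[OF _ _ c\<phi>(2) z(2)])
           (use locally_integrable_continuous[of "\<lambda>x. 1"] in \<open>auto simp: locally_integrable_def\<close>)
      then show "integrable lborel (\<lambda>x. sup_\<beta> * \<bar>deriv \<phi> x\<bar>)" by (intro integrable_mult_right integrable_abs) simp
      show "AE x in lborel. norm (\<beta> (H (v n x)) * deriv \<phi> x) \<le> sup_\<beta> * \<bar>deriv \<phi> x\<bar>" for n
        unfolding b_eq using beta_ext_le beta_ext_nonneg by (auto simp: abs_mult intro!: mult_right_mono)
      show "AE x in lborel. (\<lambda>n. \<beta> (H (v n x)) * deriv \<phi> x) \<longlonglongrightarrow> ?b x * deriv \<phi> x"
        unfolding b_eq
        by (intro AE_I2 tendsto_intros continuous_on_tendsto_compose[OF continuous_beta_K vlim]) auto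
    qed
    have l2: "(\<lambda>n. LINT x|lborel. H (v n x) * deriv V x * \<phi> x) \<longlonglongrightarrow> (LINT x|lborel. deriv V x * ?u x * \<phi> x)"
    proof (rule integral_dominated_convergence)
      have I: "integrable lborel (\<lambda>x. \<phi> x * (deriv V x * ?u x))"
        by (rule integrable_times_continuous_supported[OF _ _ c\<phi>(1) z(1)])
           (use lg in \<open>auto simp: locally_integrable_def\<close>)
      then show "integrable lborel (\<lambda>x. \<bar>\<phi> x * (deriv V x * ?u x)\<bar>)" by (rule integrable_abs)
      show "(\<lambda>x. deriv V x * ?u x * \<phi> x) \<in> borel_measurable lborel"
        using borel_measurable_integrable[OF I] by (simp add: mult.commute)
      have "continuous_on UNIV (\<lambda>x. H (v n x) * deriv V x * \<phi> x)" for n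
        by (intro continuous_intros cH continuous_deriv_V c\<phi>)
      then show "(\<lambda>x. H (v n x) * deriv V x * \<phi> x) \<in> borel_measurable lborel" for n
        using borel_measurable_continuous_onI[of "\<lambda>x. H (v n x) * deriv V x * \<phi> x"] by simp
      show "AE x in lborel. norm (H (v n x) * deriv V x * \<phi> x) \<le> \<bar>\<phi> x * (deriv V x * ?u x)\<bar>" for n
        using AEV
      proof eventually_elim
        case (elim x)
        have "H (v n x) \<le> H (V x - C)" using elim H_less[of "V x - C" "v n x"] by (simp add: v_def)
        moreover have "?u x = H (V x - C)" using elim H_pos[of "V x - C"] by (simp add: K_def less_imp_le)
        moreover have "H (v n x) > 0" using H_pos vp by simp
        ultimately have "H (v n x) * \<bar>deriv V x * \<phi> x\<bar> \<le> ?u x * \<bar>deriv V x * \<phi> x\<bar>" by (intro mult_right_mono) auto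
        then show ?case using \<open>H (v n x) > 0\<close> by (simp add: abs_mult ac_simps)
      qed
      show "AE x in lborel. (\<lambda>n. H (v n x) * deriv V x * \<phi> x) \<longlonglongrightarrow> deriv V x * ?u x * \<phi> x"
        using AEV
      proof eventually_elim
        case (elim x)
        have "(\<lambda>n. H (v n x)) \<longlonglongrightarrow> H (V x - C)"
          by (rule isCont_tendsto_compose[OF isCont_H vlim]) (use elim in simp)
        then have "(\<lambda>n. H (v n x) * deriv V x * \<phi> x) \<longlonglongrightarrow> H (V x - C) * deriv V x * \<phi> x" by (intro tendsto_intros)
        moreover have "?u x = H (V x - C)" using elim H_pos[of "V x - C"] by (simp add: K_def less_imp_le)
        ultimately show ?case by (simp add: ac_simps)
      qed
    qed
    have "(LINT x|lborel. \<beta> (H (v n x)) * deriv \<phi> x) = (LINT x|lborel. H (v n x) * deriv V x * \<phi> x)" for n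
      using parts[of n] by simp
    with l1 have "(\<lambda>n. LINT x|lborel. H (v n x) * deriv V x * \<phi> x) \<longlonglongrightarrow> (LINT x|lborel. ?b x * deriv \<phi> x)" by simp
    then show ?thesis using l2 by (rule LIMSEQ_unique)
  qed
  moreover have "locally_integrable (\<lambda>x. - (deriv V x * ?u x))"
    using lg by (auto simp: locally_integrable_def set_integrable_def)
  ultimately show ?thesis unfolding has_weak_deriv_def using locally_integrable_continuous[OF cb] by simp
qed

end

section \<open>Vanishing dissipation\<close>

context confined_pressure
begin

lemma dissipation_zero_iff:
  fixes \<rho> :: "real measure"
  defines "u \<equiv> cont_density \<rho>"
  defines "b \<equiv> \<lambda>x. beta_ext \<beta> (u x)"
  shows "dissipation \<beta> V \<rho> = 0 \<longleftrightarrow> \<rho> \<in> Mplus_c \<and> b \<in> W11_loc \<and>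
    (AE x in lborel. x \<in> D_plus u \<longrightarrow> weak_deriv b x = - (deriv V x * enn2real (u x))) \<and>
    (AE x in singular_part \<rho>. deriv V x = 0)"
proof (cases "\<rho> \<in> Mplus_c \<and> b \<in> W11_loc")
  case True
  then have c: "continuous_on UNIV u" and d: "lebesgue_decomposition \<rho> u (singular_part \<rho>)"
    using Mplus_c_D by (auto simp: u_def)
  have g [measurable]: "weak_deriv b \<in> borel_measurable borel"
    using has_weak_deriv_weak_deriv[of b] True by (intro locally_integrable_measurable) (auto simp: has_weak_deriv_def)
  have [measurable]: "deriv V \<in> borel_measurable borel" using borel_measurable_continuous_onI[OF continuous_deriv_V] .
  have u [measurable]: "u \<in> borel_measurable borel" and s: "sets (singular_part \<rho>) = sets borel"
    using d by (auto simp: lebesgue_decomposition_def)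
  have [measurable]: "D_plus u \<in> sets borel" using D_plus_open[OF c] by simp
  note [measurable_cong] = s
  let ?f = "\<lambda>x. ennreal ((weak_deriv b x / enn2real (u x) + deriv V x)\<^sup>2 * enn2real (u x)) * indicator (D_plus u) x"
  have *: "dissipation \<beta> V \<rho> = (\<integral>\<^sup>+x. ?f x \<partial>lborel) + (\<integral>\<^sup>+x. ennreal ((deriv V x)\<^sup>2) \<partial>singular_part \<rho>)"
    using True unfolding dissipation_def Let_def u_def b_def by simp
  have 1: "(\<integral>\<^sup>+x. ?f x \<partial>lborel) = 0 \<longleftrightarrow> (AE x in lborel. ?f x = 0)"
    by (rule nn_integral_0_iff_AE) measurable
  have 2: "(\<integral>\<^sup>+x. ennreal ((deriv V x)\<^sup>2) \<partial>singular_part \<rho>) = 0 \<longleftrightarrow> (AE x in singular_part \<rho>. ennreal ((deriv V x)\<^sup>2) = 0)"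
    by (rule nn_integral_0_iff_AE) measurable
  have 3: "?f x = 0 \<longleftrightarrow> (x \<in> D_plus u \<longrightarrow> weak_deriv b x = - (deriv V x * enn2real (u x)))" for x
  proof (cases "x \<in> D_plus u")
    case x: True
    then have p: "enn2real (u x) > 0" by (simp add: D_plus_def enn2real_positive_iff)
    have "?f x = 0 \<longleftrightarrow> (weak_deriv b x / enn2real (u x) + deriv V x)\<^sup>2 * enn2real (u x) \<le> 0"
      using x by (simp add: ennreal_eq_0_iff)
    also have "\<dots> \<longleftrightarrow> weak_deriv b x / enn2real (u x) + deriv V x = 0"
      using p by (simp add: mult_le_0_iff)
    also have "\<dots> \<longleftrightarrow> weak_deriv b x = - (deriv V x * enn2real (u x))"
      using p by (simp add: field_simps add_eq_0_iff2)
    finally show ?thesis using x by simp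
  qed simp
  show ?thesis unfolding * using True 1 2 3 by (simp add: ennreal_eq_0_iff)
next
  case False
  then show ?thesis unfolding dissipation_def Let_def u_def b_def by auto
qed

lemma equilibrium_properties:
  assumes eq: "equilibrium C \<rho>" and \<rho>: "\<rho> \<in> Mplus"
  shows "\<rho> \<in> Mplus_c" "cont_density \<rho> = (\<lambda>x. K (V x - C))"
    "has_weak_deriv (\<lambda>x. beta_ext \<beta> (K (V x - C))) (\<lambda>x. - (deriv V x * enn2real (K (V x - C))))"
    "AE x in singular_part \<rho>. V x = C \<and> C = V_min V"
proof -
  have C: "C \<le> V_min V" and n: "emeasure lborel {x. V x = C} = 0"
    and d: "lebesgue_decomposition \<rho> (\<lambda>x. K (V x - C)) (singular_part \<rho>)"
    and s: "emeasure (singular_part \<rho>) {x. V x \<noteq> C} = 0"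
    using eq by (auto simp: equilibrium_def)
  have VC: "C \<le> V x" for x using C V_min_le[of x] by simp
  show c: "cont_density \<rho> = (\<lambda>x. K (V x - C))" by (rule cont_density_eq[OF continuous_K_V d])
  have i: "K (V x - C) = \<infinity> \<longleftrightarrow> V x = C" for x using VC[of x] by (auto simp: K_def split: if_splits)
  have "{x. K (V x - C) < \<infinity>} = {x. V x \<noteq> C}" "{x. K (V x - C) = \<infinity>} = {x. V x = C}"
    unfolding i[symmetric] by (auto simp: less_top[symmetric])
  then show "\<rho> \<in> Mplus_c" unfolding Mplus_c_def
    using \<rho> d continuous_K_V[of UNIV C] n s by (intro CollectI conjI exI[of _ "\<lambda>x. K (V x - C)"]) simp_all
  show "has_weak_deriv (\<lambda>x. beta_ext \<beta> (K (V x - C))) (\<lambda>x. - (deriv V x * enn2real (K (V x - C))))"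
    by (rule equilibrium_weak_deriv[OF C n lebesgue_decomposition_mass(4)[OF d \<rho>]])
  have sets: "sets (singular_part \<rho>) = sets borel" using d by (simp add: lebesgue_decomposition_def)
  have "open {x. V x \<noteq> C}" by (intro open_Collect_neq continuous_V continuous_on_const)
  then have "{x. V x \<noteq> C} \<in> null_sets (singular_part \<rho>)" using s sets by (auto simp: null_sets_def)
  then have "AE x in singular_part \<rho>. x \<notin> {x. V x \<noteq> C}" by (rule AE_not_in)
  then show "AE x in singular_part \<rho>. V x = C \<and> C = V_min V"
  proof eventually_elim
    case (elim x)
    then show ?case using C V_min_le[of x] by auto
  qed
qed

lemma deriv_V_min: "V x = V_min V \<Longrightarrow> deriv V x = 0"
  using DERIV_local_min[OF DERIV_V, of 1 x] V_min_le by simp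

lemma equilibrium_imp_dissipation_zero:
  assumes eq: "equilibrium C \<rho>" and \<rho>: "\<rho> \<in> Mplus"
  shows "dissipation \<beta> V \<rho> = 0"
proof -
  note e = equilibrium_properties[OF eq \<rho>]
  let ?b = "\<lambda>x. beta_ext \<beta> (K (V x - C))"
  have b: "?b \<in> W11_loc" using e(3) by (auto simp: W11_loc_def)
  have "AE x in lborel. weak_deriv ?b x = - (deriv V x * enn2real (K (V x - C)))"
    by (rule weak_deriv_AE_unique[OF continuous_beta_ext[OF continuous_K_V] has_weak_deriv_weak_deriv[OF b] e(3)])
  then have 1: "AE x in lborel. x \<in> D_plus (\<lambda>x. K (V x - C)) \<longrightarrow> weak_deriv ?b x = - (deriv V x * enn2real (K (V x - C)))"
    by eventually_elim simp
  have 2: "AE x in singular_part \<rho>. deriv V x = 0"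
    using e(4) by eventually_elim (simp add: deriv_V_min)
  show ?thesis unfolding dissipation_zero_iff e(2) using e(1) b 1 2 by (intro conjI)
qed

text \<open>By the flux condition \<open>\<beta>(u)\<close> has the continuous derivative \<open>- u V'\<close> on \<open>{0 < u < \<infinity>}\<close>, and passing
from \<open>\<beta>\<close> to \<open>P\<close> divides it by \<open>- u\<close>.\<close>

lemma zero_flux_P_deriv:
  fixes u :: "real \<Rightarrow> ennreal"
  assumes c: "continuous_on UNIV u" and g: "g \<in> borel_measurable borel"
    and inc: "\<And>x y. x < y \<Longrightarrow> beta_ext \<beta> (u y) - beta_ext \<beta> (u x) = (LINT t:{x<..y}|lborel. g t)"
    and flux: "AE x in lborel. x \<in> D_plus u \<longrightarrow> g x = - (deriv V x * enn2real (u x))"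
    and x0: "x0 \<in> D_plus u"
  shows "((\<lambda>x. P (enn2real (u x))) has_real_derivative deriv V x0) (at x0)"
proof -
  have o: "open (D_plus u)" by (rule D_plus_open[OF c])
  have cu: "continuous_on (D_plus u) (\<lambda>x. enn2real (u x))"
    using continuous_on_subset[OF c, of "D_plus u"]
    by (auto simp: continuous_on_def D_plus_def less_top intro!: tendsto_enn2real)
  have "((\<lambda>x. beta_ext \<beta> (u x)) has_real_derivative - (deriv V x0 * enn2real (u x0))) (at x0)"
    by (rule increment_integral_imp_DERIV[OF g inc o x0 _ flux]) (auto intro!: continuous_intros continuous_deriv_V cu)
  then have "((\<lambda>x. \<beta> (enn2real (u x))) has_real_derivative - (enn2real (u x0) * deriv V x0)) (at x0)"
    unfolding mult.commute[of "deriv V x0"]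
    by (rule has_field_derivative_transform_within_open[OF _ o x0]) (auto simp: beta_ext_def D_plus_def)
  then show ?thesis
    using cu o x0
    by (intro DERIV_P_comp[OF _ o x0]) (auto simp: D_plus_def enn2real_positive_iff continuous_on_eq_continuous_at)
qed

text \<open>Take a zero \<open>s\<close> of \<open>u\<close> closest to a point where \<open>u\<close> is nonzero. On a short segment starting at \<open>s\<close> the
function \<open>P(u) - V\<close> is constant, whereas \<open>P(u)\<close> tends to infinity at \<open>s\<close>.\<close>

lemma zero_flux_no_zero:
  fixes u :: "real \<Rightarrow> ennreal"
  assumes c: "continuous_on UNIV u" and g: "g \<in> borel_measurable borel"
    and inc: "\<And>x y. x < y \<Longrightarrow> beta_ext \<beta> (u y) - beta_ext \<beta> (u x) = (LINT t:{x<..y}|lborel. g t)"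
    and flux: "AE x in lborel. x \<in> D_plus u \<longrightarrow> g x = - (deriv V x * enn2real (u x))"
    and y: "u y \<noteq> 0"
  shows "u z > 0"
proof (rule ccontr)
  assume "\<not> u z > 0"
  then have uz: "u z = 0" by simp
  define Z where "Z = {x. u x = 0}"
  have "closed Z" unfolding Z_def using c by (intro closed_Collect_eq) auto
  then obtain s where s: "s \<in> Z" "\<And>x. x \<in> Z \<Longrightarrow> dist y s \<le> dist y x"
    using distance_attains_inf[of Z y] uz by (auto simp: Z_def)
  have us: "u s = 0" "s \<noteq> y" using s(1) y by (auto simp: Z_def)
  have lim: "(u \<longlongrightarrow> 0) (at s)" using c us by (simp add: continuous_on_def) (metis UNIV_I)
  then have "\<forall>\<^sub>F x in at s. u x < \<infinity>" by (rule order_tendstoD(2)) simp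
  then obtain d where d: "d > 0" "\<And>x. x \<noteq> s \<Longrightarrow> dist x s < d \<Longrightarrow> u x < \<infinity>"
    unfolding eventually_at by auto
  \<comment> \<open>a point between \<open>s\<close> and \<open>y\<close> at distance at most \<open>d\<close> from \<open>s\<close>\<close>
  define y' where "y' = s + (y - s) * min 1 (d / \<bar>y - s\<bar>)"
  define S where "S = open_segment s y'"
  have m: "0 < min 1 (d / \<bar>y - s\<bar>)" "min 1 (d / \<bar>y - s\<bar>) \<le> 1" "\<bar>y - s\<bar> * min 1 (d / \<bar>y - s\<bar>) \<le> d"
    using d us by (auto simp: min_def field_simps)
  have y's: "y' \<noteq> s" using m us by (simp add: y'_def)
  have S: "S \<subseteq> D_plus u"
  proof
    fix x assume "x \<in> S"
    then obtain t where t: "0 < t" "t < 1" "x = (1 - t) * s + t * y'" by (auto simp: S_def in_segment)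
    define r where "r = t * min 1 (d / \<bar>y - s\<bar>)"
    have r: "0 < r" "r < 1" "\<bar>y - s\<bar> * r < d"
    proof -
      show "0 < r" using t m by (simp add: r_def)
      show "r < 1" using mult_strict_mono[of t 1 "min 1 (d / \<bar>y - s\<bar>)" 1] t m
        by (smt (verit) mult_left_le r_def)
      have "\<bar>y - s\<bar> * r = t * (\<bar>y - s\<bar> * min 1 (d / \<bar>y - s\<bar>))" by (simp add: r_def)
      also have "\<dots> \<le> t * d" using t m by (intro mult_left_mono) auto
      also have "\<dots> < d" using t d by simp
      finally show "\<bar>y - s\<bar> * r < d" .
    qed
    have x: "x = s + (y - s) * r" using t by (simp add: y'_def r_def algebra_simps)
    have "x \<noteq> s" using r us by (simp add: x)
    moreover have "dist x s < d" using r by (simp add: x dist_real_def abs_mult)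
    ultimately have "u x < \<infinity>" using d by blast
    moreover have "u x \<noteq> 0"
    proof
      assume "u x = 0"
      then have "dist y s \<le> dist y x" using s(2) by (simp add: Z_def)
      moreover have "y - x = (y - s) * (1 - r)" by (simp add: x algebra_simps)
      then have "dist y x = \<bar>y - s\<bar> * (1 - r)" using r by (simp add: dist_real_def abs_mult)
      moreover have "\<bar>y - s\<bar> * (1 - r) < \<bar>y - s\<bar> * 1" using r us by (intro mult_strict_left_mono) auto
      ultimately show False by (simp add: dist_real_def)
    qed
    ultimately show "x \<in> D_plus u" by (auto simp: D_plus_def zero_less_iff_neq_zero)
  qed
  have oS: "open S" "connected S" "S \<noteq> {}" using y's by (auto simp: S_def open_segment_eq_real_ivl)
  have dz: "((\<lambda>x. P (enn2real (u x)) - V x) has_real_derivative 0) (at x)" if "x \<in> S" for x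
    using DERIV_diff[OF zero_flux_P_deriv[OF c g inc flux subsetD[OF S that]] DERIV_V[of x]] by simp
  obtain k where k: "\<And>x. x \<in> S \<Longrightarrow> P (enn2real (u x)) - V x = k"
    using DERIV_zero_connected_constant[OF oS(2,1) finite.emptyI, of "\<lambda>x. P (enn2real (u x)) - V x"] dz
    by (metis (no_types, lifting) DERIV_isCont Diff_empty continuous_at_imp_continuous_on)
  have sS: "at s within S \<noteq> bot"
  proof -
    have "s \<in> closure S" using y's by (simp add: S_def closure_open_segment)
    moreover have "s \<notin> S" by (simp add: S_def open_segment_def)
    ultimately have "s islimpt S" by (simp add: closure_def)
    then show ?thesis by (simp add: trivial_limit_within)
  qed
  have "((\<lambda>x. V x + k) \<longlongrightarrow> V s + k) (at s within S)"
    using continuous_V[of UNIV] by (intro tendsto_intros) (auto simp: continuous_on_def intro: tendsto_within_subset)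
  then have 1: "\<forall>\<^sub>F x in at s within S. V x + k < V s + k + 1" by (rule order_tendstoD) simp
  obtain r where r: "r > 0" "P r > V s + k + 1" using P_unbounded by blast
  have "(u \<longlongrightarrow> 0) (at s within S)" using lim tendsto_within_subset by blast
  then have 2: "\<forall>\<^sub>F x in at s within S. u x < ennreal r" by (rule order_tendstoD) (use r in simp)
  have 3: "\<forall>\<^sub>F x in at s within S. x \<in> S" by (simp add: eventually_at_filter)
  have "\<forall>\<^sub>F x in at s within S. False" using 1 2 3
  proof eventually_elim
    case (elim x)
    then have "u x > 0" "u x < \<infinity>" using S by (auto simp: D_plus_def)
    then have p: "enn2real (u x) > 0" "u x = ennreal (enn2real (u x))" by (auto simp: enn2real_positive_iff less_top)
    then have "enn2real (u x) < r" using elim(2) r by (metis ennreal_less_iff less_imp_le)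
    then have "P r < P (enn2real (u x))" using P_less p by blast
    then show False using k[OF elim(3)] elim(1) r by simp
  qed
  then show False using sS by (simp add: trivial_limit_def)
qed

text \<open>The image of \<open>{0 < u < \<infinity>}\<close> under \<open>V - P(u)\<close> is countable, because every component contains a
rational point; the image of \<open>{u = \<infinity>}\<close> is null, because \<open>V\<close> maps null sets to null sets.\<close>

lemma zero_flux_imp_profile:
  fixes u :: "real \<Rightarrow> ennreal"
  assumes c: "continuous_on UNIV u" and g: "g \<in> borel_measurable borel"
    and inc: "\<And>x y. x < y \<Longrightarrow> beta_ext \<beta> (u y) - beta_ext \<beta> (u x) = (LINT t:{x<..y}|lborel. g t)"
    and flux: "AE x in lborel. x \<in> D_plus u \<longrightarrow> g x = - (deriv V x * enn2real (u x))"
    and null: "emeasure lborel {x. u x = \<infinity>} = 0"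
    and pos: "\<And>x. u x > 0"
  obtains C where "\<And>x. C \<le> V x" "u = (\<lambda>x. K (V x - C))"
proof -
  \<comment> \<open>\<open>P(u)\<close>, continuously extended by \<open>0\<close> to the points where \<open>u = \<infinity>\<close>\<close>
  define p where "p x = (if u x = \<infinity> then 0 else P (enn2real (u x)))" for x
  define f where "f x = V x - p x" for x
  have D: "D_plus u = {x. u x < \<infinity>}" using pos by (auto simp: D_plus_def)
  have oD: "open (D_plus u)" by (rule D_plus_open[OF c])
  have dp: "(p has_real_derivative deriv V x) (at x)" if "x \<in> D_plus u" for x
    using zero_flux_P_deriv[OF c g inc flux that]
    by (rule has_field_derivative_transform_within_open[OF _ oD that]) (auto simp: p_def D)
  have df: "(f has_real_derivative 0) (at x)" if "x \<in> D_plus u" for x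
    unfolding f_def using DERIV_diff[OF DERIV_V dp[OF that]] by simp
  have cp: "isCont p x" for x
  proof (cases "u x = \<infinity>")
    case False
    then show ?thesis using dp[of x] DERIV_isCont by (auto simp: D less_top)
  next
    case True
    have ux: "(u \<longlongrightarrow> \<infinity>) (at x)" using c True by (simp add: continuous_on_def) (metis UNIV_I)
    have "(p \<longlongrightarrow> 0) (at x)"
    proof (rule order_tendstoI)
      fix a :: real assume "a < 0"
      have "0 \<le> p y" for y using P_pos[of "enn2real (u y)"] pos[of y]
        by (auto simp: p_def enn2real_positive_iff less_top less_imp_le)
      then show "\<forall>\<^sub>F y in at x. a < p y" using \<open>a < 0\<close> by (intro always_eventually) (auto intro: less_le_trans)
    next
      fix a :: real assume a: "0 < a"
      define r where "r = sup_\<beta> / a + 1"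
      have r: "r > 0" using sup_pos a by (simp add: r_def add_pos_pos)
      have "P r \<le> sup_\<beta> / r" by (rule P_upper[OF r])
      also have "\<dots> < a" using a r sup_pos by (simp add: r_def field_simps)
      finally have Pr: "P r < a" .
      have "\<forall>\<^sub>F y in at x. ennreal r < u y" by (rule order_tendstoD(1)[OF ux]) simp
      then show "\<forall>\<^sub>F y in at x. p y < a"
      proof eventually_elim
        case (elim y)
        show ?case
        proof (cases "u y = \<infinity>")
          case False
          then have "u y = ennreal (enn2real (u y))" by (simp add: less_top)
          then have "r < enn2real (u y)" using elim r by (metis ennreal_less_iff less_imp_le)
          then show ?thesis using P_less[OF r] Pr False by (force simp: p_def)
        qed (simp add: p_def a)
      qed
    qed
    then show ?thesis using True by (simp add: isCont_def p_def)
  qed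
  have cf: "continuous_on UNIV f"
    unfolding f_def using cp by (intro continuous_on_diff continuous_V continuous_at_imp_continuous_on) auto
  have "f ` D_plus u \<subseteq> f ` \<rat>"
  proof
    fix w assume "w \<in> f ` D_plus u"
    then obtain x where x: "x \<in> D_plus u" "w = f x" by blast
    obtain e where e: "e > 0" "ball x e \<subseteq> D_plus u" using oD x(1) open_contains_ball by blast
    obtain q where q: "q \<in> \<rat>" "x < q" "q < x + e" using Rats_dense_in_real[of x "x + e"] e by auto
    have "f q = f x"
    proof (rule DERIV_isconst_end[OF q(2)])
      show "continuous_on {x..q} f" using cf continuous_on_subset by blast
      show "DERIV f t :> 0" if "x < t" "t < q" for t
        using df e(2) that q by (auto simp: dist_real_def ball_def subset_iff)
    qed
    then show "w \<in> f ` \<rat>" using x q by (metis image_eqI)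
  qed
  then have n1: "negligible (f ` D_plus u)"
    using countable_imp_null_set_lborel[OF countable_image[OF countable_rat, of f]] negligible_subset
    by (metis negligible_iff_null_sets null_sets_completionI)
  let ?N = "{x. u x = \<infinity>}"
  have "closed ?N" using c by (intro closed_Collect_eq) auto
  then have "?N \<in> null_sets lborel" using null by auto
  then have "negligible ?N" by (simp add: negligible_iff_null_sets null_sets_completionI)
  moreover have "V differentiable_on ?N"
    unfolding differentiable_on_def real_differentiable_def
    using has_field_derivative_at_within[OF DERIV_V] by blast
  ultimately have "negligible (V ` ?N)" by (intro negligible_differentiable_image_negligible) auto
  moreover have "f ` ?N = V ` ?N" by (auto simp: f_def p_def intro!: image_cong)
  ultimately have n2: "negligible (f ` ?N)" by simp
  have "UNIV = D_plus u \<union> ?N" by (auto simp: D less_top)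
  then have "range f = f ` D_plus u \<union> f ` ?N" by (metis image_Un)
  then have neg: "negligible (range f)" using n1 n2 by simp
  have const: "f a \<ge> f b" for a b
  proof (rule ccontr)
    assume "\<not> f a \<ge> f b"
    then have ab: "f a < f b" by simp
    have "connected (range f)" by (intro connected_continuous_image cf) simp
    then have "{f a..f b} \<subseteq> range f" by (rule connected_contains_Icc) auto
    then have "negligible {f a<..<f b}"
      using neg negligible_subset greaterThanLessThan_subseteq_atLeastAtMost_iff by (metis order_refl order_trans)
    then show False using ab open_not_negligible[of "{f a<..<f b}"] by simp
  qed
  define C where "C = f 0"
  have C: "p x = V x - C" for x using const[of x 0] const[of 0 x] by (simp add: C_def f_def)
  have u: "C \<le> V x \<and> u x = K (V x - C)" for x
  proof (cases "u x = \<infinity>")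
    case True
    then show ?thesis using C[of x] by (simp add: p_def K_def)
  next
    case False
    then have e: "enn2real (u x) > 0" "u x = ennreal (enn2real (u x))"
      using pos[of x] by (auto simp: enn2real_positive_iff less_top)
    have "P (enn2real (u x)) = V x - C" using C[of x] False by (simp add: p_def)
    then show ?thesis using H_P[OF e(1)] P_pos[OF e(1)] e(2) by (auto simp: K_def)
  qed
  then show thesis by (intro that[of C]) auto
qed

text \<open>Positive mass excludes \<open>u = 0\<close>: the singular part is carried by \<open>{u = \<infinity>}\<close>, so \<open>\<rho>\<close> would vanish.\<close>

lemma dissipation_zero_imp_equilibrium:
  assumes z: "dissipation \<beta> V \<rho> = 0" and m: "measure \<rho> UNIV > 0"
  shows "\<exists>C. equilibrium C \<rho>"
proof -
  define u where "u = cont_density \<rho>"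
  define b where "b = (\<lambda>x. beta_ext \<beta> (u x))"
  have \<rho>: "\<rho> \<in> Mplus_c" and b: "b \<in> W11_loc"
    and flux: "AE x in lborel. x \<in> D_plus u \<longrightarrow> weak_deriv b x = - (deriv V x * enn2real (u x))"
    using z unfolding dissipation_zero_iff u_def b_def by auto
  note D = Mplus_c_D[OF \<rho>, folded u_def]
  have W: "has_weak_deriv b (weak_deriv b)" by (rule has_weak_deriv_weak_deriv[OF b])
  have g: "weak_deriv b \<in> borel_measurable borel"
    using W by (intro locally_integrable_measurable) (auto simp: has_weak_deriv_def)
  have cb: "continuous_on UNIV b" unfolding b_def by (rule continuous_beta_ext[OF D(2)])
  have inc: "beta_ext \<beta> (u y) - beta_ext \<beta> (u x) = (LINT t:{x<..y}|lborel. weak_deriv b t)" if "x < y" for x y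
    using weak_deriv_imp_increment[OF W cb that] by (simp add: b_def)
  have "\<exists>y. u y \<noteq> 0"
  proof (rule ccontr)
    assume "\<not> (\<exists>y. u y \<noteq> 0)"
    then have u0: "u x = 0" for x by simp
    then have "emeasure (singular_part \<rho>) UNIV = 0" using D(4) by simp
    then have "measure (singular_part \<rho>) UNIV = 0" by (simp add: measure_def)
    then show False using m lebesgue_decomposition_mass(5)[OF D(3,1)] u0 by simp
  qed
  then obtain y where y: "u y \<noteq> 0" by blast
  obtain C where C: "\<And>x. C \<le> V x" "u = (\<lambda>x. K (V x - C))"
    using zero_flux_imp_profile[OF D(2) g inc flux D(5) zero_flux_no_zero[OF D(2) g inc flux y]] by blast
  have i: "u x = \<infinity> \<longleftrightarrow> V x = C" for x using C(1)[of x] by (auto simp: C(2) K_def split: if_splits)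
  have s: "{x. u x < \<infinity>} = {x. V x \<noteq> C}" "{x. u x = \<infinity>} = {x. V x = C}"
    unfolding i[symmetric] by (auto simp: less_top[symmetric])
  obtain x0 where "V x0 = V_min V" using V_attains_min by blast
  then have "C \<le> V_min V" using C(1)[of x0] by simp
  then have "equilibrium C \<rho>" unfolding equilibrium_def using D(3-5)[unfolded s] C(2) by simp
  then show ?thesis ..
qed

end

section \<open>Stationary solutions\<close>

lemma set_integral_positive_half_line:
  fixes f :: "real \<Rightarrow> real"
  assumes "\<And>t. t \<le> 0 \<Longrightarrow> f t = 0"
  shows "(LINT t:{0<..}|lborel. f t) = (LINT t|lborel. f t)"
proof -
  have "(\<lambda>t. indicat_real {0<..} t *\<^sub>R f t) = f" using assms by (force simp: indicator_def)
  then show ?thesis by (simp add: set_lebesgue_integral_def)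
qed

lemma has_derivative_tensor:
  fixes \<eta> \<psi> :: "real \<Rightarrow> real"
  assumes "(\<eta> has_real_derivative c) (at (fst p))" "(\<psi> has_real_derivative d) (at (snd p))"
  shows "((\<lambda>p. \<eta> (fst p) * \<psi> (snd p)) has_derivative (\<lambda>h. c * fst h * \<psi> (snd p) + \<eta> (fst p) * (d * snd h))) (at p)"
proof -
  have 1: "((\<lambda>p. \<eta> (fst p)) has_derivative (\<lambda>h. c * fst h)) (at p)"
    using has_derivative_compose[OF has_derivative_fst[OF has_derivative_ident] assms(1)[unfolded has_field_derivative_def]] .
  have 2: "((\<lambda>p. \<psi> (snd p)) has_derivative (\<lambda>h. d * snd h)) (at p)"
    using has_derivative_compose[OF has_derivative_snd[OF has_derivative_ident] assms(2)[unfolded has_field_derivative_def]] .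
  show ?thesis using has_derivative_mult[OF 1 2] by (simp add: ac_simps)
qed

lemma Ck_tensor:
  fixes \<eta> \<psi> :: "real \<Rightarrow> real"
  shows "Ck k \<eta> \<Longrightarrow> Ck k \<psi> \<Longrightarrow> Ck k (\<lambda>p. \<eta> (fst p) * \<psi> (snd p))"
proof (induction k arbitrary: \<eta> \<psi>)
  case 0
  then show ?case
    by (auto intro!: continuous_intros continuous_on_compose2[of UNIV \<eta>] continuous_on_compose2[of UNIV \<psi>])
next
  case (Suc k)
  let ?f = "\<lambda>p. \<eta> (fst p) * \<psi> (snd p)"
  have D: "(?f has_derivative (\<lambda>h. deriv \<eta> (fst p) * fst h * \<psi> (snd p) + \<eta> (fst p) * (deriv \<psi> (snd p) * snd h))) (at p)" for p
    by (intro has_derivative_tensor Ck_SucD(1)[OF Suc(2)] Ck_SucD(1)[OF Suc(3)])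
  have fd: "frechet_derivative ?f (at p) = (\<lambda>h. deriv \<eta> (fst p) * fst h * \<psi> (snd p) + \<eta> (fst p) * (deriv \<psi> (snd p) * snd h))" for p
    using frechet_derivative_at[OF D] by simp
  have B: "b = (1, 0) \<or> b = (0, 1)" if "b \<in> Basis" for b :: "real \<times> real"
    using that by (auto simp: Basis_prod_def)
  have 1: "Ck k (\<lambda>p. deriv \<eta> (fst p) * \<psi> (snd p))" "Ck k (\<lambda>p. \<eta> (fst p) * deriv \<psi> (snd p))"
    using Suc.IH[OF Ck_SucD(2)[OF Suc(2)] Ck_Suc_imp[OF Suc(3)]] Suc.IH[OF Ck_Suc_imp[OF Suc(2)] Ck_SucD(2)[OF Suc(3)]] .
  have "Ck k (\<lambda>p. frechet_derivative ?f (at p) b)" if "b \<in> Basis" for b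
    using B[OF that] 1 by (auto simp: fd)
  moreover have "?f differentiable at p" for p using D differentiable_def by blast
  ultimately show ?case by simp
qed

text \<open>Extension by zero to negative times turns time integrals over \<open>(0,\<infinity>)\<close> into integrals over the line.\<close>

lemma test_function_space_timeD:
  fixes \<phi> :: "real \<times> real \<Rightarrow> real"
  assumes T: "test_function ({0<..} \<times> UNIV) \<phi>"
  obtains B where "B > 0" and "\<And>t x :: real. t \<le> 0 \<Longrightarrow> \<phi> (t, x) = 0 \<and> frechet_derivative \<phi> (at (t, x)) = (\<lambda>h. 0)"
    and "\<And>t x. t \<notin> {-B..B} \<or> x \<notin> {-B..B} \<Longrightarrow> \<phi> (t, x) = 0 \<and> frechet_derivative \<phi> (at (t, x)) = (\<lambda>h. 0)"
    and "\<And>p. (\<phi> has_derivative frechet_derivative \<phi> (at p)) (at p)"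
    and "continuous_on UNIV (\<lambda>p. frechet_derivative \<phi> (at p) (1, 0))"
    and "continuous_on UNIV (\<lambda>p. frechet_derivative \<phi> (at p) (0, 1))"
proof -
  let ?S = "closure {p. \<phi> p \<noteq> 0}"
  have C: "Ck (Suc 0) \<phi>" and c: "compact ?S" and S: "?S \<subseteq> {0<..} \<times> UNIV"
    using T unfolding test_function_def by blast+
  have z: "\<phi> p = 0" if "p \<notin> ?S" for p using that closure_subset[of "{p. \<phi> p \<noteq> 0}"] by auto
  have dz: "frechet_derivative \<phi> (at p) = (\<lambda>h. 0)" if p: "p \<notin> ?S" for p
  proof -
    have "(\<phi> has_derivative (\<lambda>h. 0)) (at p)"
    proof (rule has_derivative_transform_within_open[where s="- ?S" and f="\<lambda>p. 0"])
      show "open (- ?S)" by (rule open_Compl) simp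
      show "p \<in> - ?S" using p by simp
      show "0 = \<phi> q" if "q \<in> - ?S" for q using z[of q] that by simp
    qed simp
    then show ?thesis by (rule frechet_derivative_at[symmetric])
  qed
  obtain B0 where B0: "\<forall>p\<in>?S. norm p \<le> B0" using compact_imp_bounded[OF c] unfolding bounded_iff by blast
  define B where "B = max B0 1"
  have out: "(t, x) \<notin> ?S" if "t \<notin> {-B..B} \<or> x \<notin> {-B..B}" for t x
  proof
    assume "(t, x) \<in> ?S"
    then have "norm (t, x) \<le> B" using B0 by (auto simp: B_def)
    then have "\<bar>t\<bar> \<le> B" "\<bar>x\<bar> \<le> B" using norm_fst_le[of t x] norm_snd_le[of x t] by auto
    then show False using that by (auto simp: abs_le_iff)
  qed
  have neg: "(t, x) \<notin> ?S" if "t \<le> 0" for t x using S that by auto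
  show thesis
  proof (rule that)
    show "B > 0" by (simp add: B_def)
    show "t \<le> 0 \<Longrightarrow> \<phi> (t, x) = 0 \<and> frechet_derivative \<phi> (at (t, x)) = (\<lambda>h. 0)" for t x
      using z[OF neg] dz[OF neg] by blast
    show "t \<notin> {-B..B} \<or> x \<notin> {-B..B} \<Longrightarrow> \<phi> (t, x) = 0 \<and> frechet_derivative \<phi> (at (t, x)) = (\<lambda>h. 0)" for t x
      using z[OF out] dz[OF out] by blast
    show "(\<phi> has_derivative frechet_derivative \<phi> (at p)) (at p)" for p
    proof -
      have "\<phi> differentiable (at p)" using C unfolding Ck.simps by blast
      then show ?thesis by (simp only: frechet_derivative_works)
    qed
    have "(1, 0) \<in> (Basis :: (real \<times> real) set)" "(0, 1) \<in> (Basis :: (real \<times> real) set)"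
      by (auto simp: Basis_prod_def)
    then show "continuous_on UNIV (\<lambda>p. frechet_derivative \<phi> (at p) (1, 0))"
      "continuous_on UNIV (\<lambda>p. frechet_derivative \<phi> (at p) (0, 1))" using C by auto
  qed
qed

text \<open>The diagonal coupling has zero cost.\<close>

lemma wasserstein2_self:
  assumes \<rho>: "sets \<rho> = sets borel"
  shows "wasserstein2 \<rho> \<rho> = 0"
proof -
  note [measurable_cong] = \<rho>
  define \<gamma> where "\<gamma> = distr \<rho> (borel \<Otimes>\<^sub>M borel) (\<lambda>x. (x, x) :: real \<times> real)"
  have m: "(\<lambda>x. (x, x)) \<in> measurable \<rho> (borel \<Otimes>\<^sub>M borel)" by measurable
  have "distr \<gamma> borel fst = \<rho>" "distr \<gamma> borel snd = \<rho>"
    unfolding \<gamma>_def using m by (simp_all add: distr_distr comp_def distr_id2 \<rho>)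
  then have "\<gamma> \<in> couplings \<rho> \<rho>" by (simp add: couplings_def) (simp add: \<gamma>_def)
  then have "(INF \<gamma>\<in>couplings \<rho> \<rho>. \<integral>\<^sup>+p. ennreal ((fst p - snd p)\<^sup>2) \<partial>\<gamma>) \<le> (\<integral>\<^sup>+p. ennreal ((fst p - snd p)\<^sup>2) \<partial>\<gamma>)"
    by (rule INF_lower)
  also have "\<dots> = 0" unfolding \<gamma>_def by (subst nn_integral_distr[OF m]) simp_all
  finally show ?thesis by (simp add: wasserstein2_def)
qed

lemma integrable_pair_compact_support:
  fixes F :: "real \<times> real \<Rightarrow> real"
  assumes \<rho>: "sets \<rho> = sets borel" "finite_measure \<rho>" and c: "continuous_on UNIV F"
    and z: "\<And>t x. t \<notin> {-B..B} \<or> x \<notin> {-B..B} \<Longrightarrow> F (t, x) = 0"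
  shows "integrable (lborel \<Otimes>\<^sub>M \<rho>) F"
proof -
  interpret R: finite_measure \<rho> by fact
  have "bounded (F ` ({-B..B} \<times> {-B..B}))"
    by (intro compact_imp_bounded compact_continuous_image continuous_on_subset[OF c] compact_Times) auto
  then obtain b where b: "\<forall>y\<in>F ` ({-B..B} \<times> {-B..B}). norm y \<le> b" unfolding bounded_iff by blast
  have s: "sets (lborel \<Otimes>\<^sub>M \<rho>) = sets (borel :: (real \<times> real) measure)"
    unfolding borel_prod[symmetric] by (rule sets_pair_measure_cong) (simp_all add: \<rho>)
  have m: "F \<in> borel_measurable (lborel \<Otimes>\<^sub>M \<rho>)"
    using borel_measurable_continuous_onI[OF c] measurable_cong_sets[OF s] by blast
  have U: "UNIV \<in> sets \<rho>" using \<rho> by simp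
  have "emeasure (lborel \<Otimes>\<^sub>M \<rho>) ({-B..B} \<times> UNIV) = emeasure lborel {-B..B} * emeasure \<rho> UNIV"
    by (rule R.emeasure_pair_measure_Times) (use U in auto)
  also have "\<dots> < \<infinity>"
  proof -
    have "emeasure \<rho> UNIV \<noteq> top" using R.emeasure_finite[of UNIV] by simp
    moreover have "emeasure lborel {-B..B} \<noteq> top" by (simp add: emeasure_lborel_Icc_eq)
    ultimately show ?thesis by (simp add: ennreal_mult_eq_top_iff less_top[symmetric])
  qed
  finally have fin: "emeasure (lborel \<Otimes>\<^sub>M \<rho>) ({-B..B} \<times> UNIV) < \<infinity>" .
  have mb: "{-B..B} \<times> UNIV \<in> sets (lborel \<Otimes>\<^sub>M \<rho>)" using U by auto
  have "integrable (lborel \<Otimes>\<^sub>M \<rho>) (\<lambda>p. b * indicat_real ({-B..B} \<times> UNIV) p)"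
    using fin mb by (intro integrable_mult_right integrable_real_indicator)
  then show ?thesis
  proof (rule Bochner_Integration.integrable_bound[OF _ m])
    show "AE p in lborel \<Otimes>\<^sub>M \<rho>. norm (F p) \<le> norm (b * indicat_real ({-B..B} \<times> UNIV) p)"
    proof (rule AE_I2)
      fix p show "norm (F p) \<le> norm (b * indicat_real ({-B..B} \<times> UNIV) p)"
      proof (cases "p \<in> {-B..B} \<times> {-B..B}")
        case True
        then have "norm (F p) \<le> b" using b by blast
        moreover have "p \<in> {-B..B} \<times> UNIV" using True by auto
        ultimately show ?thesis by simp
      next
        case False
        then have "F p = 0" using z[of "fst p" "snd p"] by (cases p) auto
        then show ?thesis by simp
      qed
    qed
  qed
qed

context confined_pressure
begin

text \<open>In an equilibrium \<open>V' \<rho> + \<beta>(u)' dx = 0\<close>, so for each time the two space integrals with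
\<open>\<partial>\<^sub>x\<phi>\<close> cancel; the remaining term \<open>\<integral>\<integral> \<partial>\<^sub>t\<phi> d\<rho> dt\<close> vanishes after exchanging the integrals.\<close>

lemma equilibrium_imp_stationary:
  assumes eq: "equilibrium C \<rho>" and \<rho>: "\<rho> \<in> M2 m"
  shows "stationary_solution \<beta> V m \<rho>"
proof -
  have M: "\<rho> \<in> Mplus" using \<rho> by (simp add: M2_def Mplus_mass_def)
  then have s: "sets \<rho> = sets borel" and f: "finite_measure \<rho>" by (auto simp: Mplus_def)
  interpret finite_measure \<rho> by fact
  interpret pair_sigma_finite lborel \<rho> ..
  note e = equilibrium_properties[OF eq M]
  let ?u = "\<lambda>x. enn2real (K (V x - C))"
  let ?b = "\<lambda>x. beta_ext \<beta> (K (V x - C))"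
  have d: "lebesgue_decomposition \<rho> (\<lambda>x. K (V x - C)) (singular_part \<rho>)" using eq by (simp add: equilibrium_def)
  have b: "?b \<in> W11_loc" using e(3) by (auto simp: W11_loc_def)
  have wm: "weak_deriv ?b \<in> borel_measurable borel"
    using has_weak_deriv_weak_deriv[OF b] by (intro locally_integrable_measurable) (auto simp: has_weak_deriv_def)
  have wd: "AE x in lborel. weak_deriv ?b x = - (deriv V x * ?u x)"
    by (rule weak_deriv_AE_unique[OF continuous_beta_ext[OF continuous_K_V] has_weak_deriv_weak_deriv[OF b] e(3)])
  have sz: "AE x in singular_part \<rho>. deriv V x = 0"
    using e(4) by eventually_elim (simp add: deriv_V_min)
  have um: "(\<lambda>x. K (V x - C)) \<in> borel_measurable borel" using d by (simp add: lebesgue_decomposition_def)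
  have Vm: "deriv V \<in> borel_measurable borel" using borel_measurable_continuous_onI[OF continuous_deriv_V] .
  have ss: "sets (singular_part \<rho>) = sets borel" using d by (simp add: lebesgue_decomposition_def)
  have weak: "(LINT t:{0<..}|lborel. LINT x|\<rho>. - frechet_derivative \<phi> (at (t, x)) (1, 0)
           + frechet_derivative \<phi> (at (t, x)) (0, 1) * deriv V x)
        + (LINT t:{0<..}|lborel. LINT x|lborel. frechet_derivative \<phi> (at (t, x)) (0, 1) * weak_deriv ?b x) = 0"
    if T: "test_function ({0<..} \<times> UNIV) \<phi>" for \<phi> :: "real \<times> real \<Rightarrow> real"
  proof -
    obtain B where B: "B > 0"
      and z0: "\<And>t x. t \<le> 0 \<Longrightarrow> \<phi> (t, x) = 0 \<and> frechet_derivative \<phi> (at (t, x)) = (\<lambda>h. 0)"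
      and z: "\<And>t x. t \<notin> {-B..B} \<or> x \<notin> {-B..B} \<Longrightarrow> \<phi> (t, x) = 0 \<and> frechet_derivative \<phi> (at (t, x)) = (\<lambda>h. 0)"
      and D: "\<And>p. (\<phi> has_derivative frechet_derivative \<phi> (at p)) (at p)"
      and c1: "continuous_on UNIV (\<lambda>p. frechet_derivative \<phi> (at p) (1, 0))"
      and c2: "continuous_on UNIV (\<lambda>p. frechet_derivative \<phi> (at p) (0, 1))"
      using test_function_space_timeD[OF T] by metis
    define ft where "ft t x = frechet_derivative \<phi> (at (t, x)) (1, 0)" for t x
    define fx where "fx t x = frechet_derivative \<phi> (at (t, x)) (0, 1)" for t x
    have ft0: "ft t x = 0" "fx t x = 0" if "t \<le> 0" for t x using z0[OF that] by (simp_all add: ft_def fx_def)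
    have ftB: "ft t x = 0" "fx t x = 0" if "t \<notin> {-B..B} \<or> x \<notin> {-B..B}" for t x
      using z[OF that] by (simp_all add: ft_def fx_def)
    have cft: "continuous_on UNIV (\<lambda>p. ft (fst p) (snd p))" using c1 by (simp add: ft_def)
    have cfx: "continuous_on UNIV (\<lambda>p. fx (fst p) (snd p) * deriv V (snd p))"
      using c2 by (auto simp: fx_def intro!: continuous_intros continuous_on_compose2[OF continuous_deriv_V[of UNIV]])
    have i1: "integrable (lborel \<Otimes>\<^sub>M \<rho>) (\<lambda>(t, x). ft t x)"
      using integrable_pair_compact_support[OF s f cft, of B] ftB by (simp add: case_prod_beta')
    have i2: "integrable (lborel \<Otimes>\<^sub>M \<rho>) (\<lambda>(t, x). fx t x * deriv V x)"
      using integrable_pair_compact_support[OF s f cfx, of B] ftB by (simp add: case_prod_beta')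
    have cP: "continuous_on UNIV (\<lambda>x :: real. (t :: real, x))" "continuous_on UNIV (\<lambda>t :: real. (t, x :: real))" for t x
      by (intro continuous_intros)+
    have cft': "continuous_on UNIV (\<lambda>x. ft t x)" "continuous_on UNIV (\<lambda>t. ft t x)" for t x
      using continuous_on_compose2[OF cft, of UNIV "\<lambda>x. (t, x)"] continuous_on_compose2[OF cft, of UNIV "\<lambda>t. (t, x)"]
      by (simp_all add: cP)
    have cfx': "continuous_on UNIV (\<lambda>x. fx t x * deriv V x)" for t
      using continuous_on_compose2[OF cfx, of UNIV "\<lambda>x. (t, x)"] by (simp add: cP)
    have fxm: "(\<lambda>x. fx t x) \<in> borel_measurable borel" for t
      using borel_measurable_continuous_onI[OF continuous_on_compose2[OF c2, of UNIV "\<lambda>x. (t, x)"]]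
      by (simp add: fx_def cP)
    have j1: "integrable \<rho> (\<lambda>x. ft t x)" for t
      by (rule integrable_locally_supported(1)[OF set_integrable_continuous_finite[OF s f cft'(1), where a="-B" and b=B]])
         (use ftB in auto)
    have j2: "integrable \<rho> (\<lambda>x. fx t x * deriv V x)" for t
      by (rule integrable_locally_supported(1)[OF set_integrable_continuous_finite[OF s f cfx', where a="-B" and b=B]])
         (use ftB in auto)
    define A where "A t = (LINT x|\<rho>. ft t x)" for t
    define G where "G t = (LINT x|\<rho>. fx t x * deriv V x)" for t
    have iA: "integrable lborel A" and iG: "integrable lborel G"
      unfolding A_def G_def using integrable_fst[OF i1] integrable_fst[OF i2] by simp_all
    have in1: "(LINT x|\<rho>. - ft t x + fx t x * deriv V x) = - A t + G t" for t
      unfolding A_def G_def using j1[of t] j2[of t] by simp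
    have in2: "(LINT x|lborel. fx t x * weak_deriv ?b x) = - G t" for t
    proof -
      have "(LINT x|singular_part \<rho>. fx t x * deriv V x) = (LINT x|singular_part \<rho>. 0)"
      proof (rule integral_cong_AE)
        show "AE x in singular_part \<rho>. fx t x * deriv V x = 0" using sz by eventually_elim simp
        show "(\<lambda>x. fx t x * deriv V x) \<in> borel_measurable (singular_part \<rho>)"
          using borel_measurable_continuous_onI[OF cfx'[of t]] measurable_cong_sets[OF ss] by blast
      qed simp
      then have "G t = (LINT x|lborel. fx t x * deriv V x * ?u x)"
        unfolding G_def using lebesgue_decomposition_integral(3)[OF d M j2[of t]] by simp
      moreover have "(LINT x|lborel. fx t x * weak_deriv ?b x) = (LINT x|lborel. - (fx t x * deriv V x * ?u x))"
      proof (rule integral_cong_AE)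
        show "AE x in lborel. fx t x * weak_deriv ?b x = - (fx t x * deriv V x * ?u x)"
          using wd by eventually_elim simp
      qed (use wm fxm[of t] Vm um in measurable)
      ultimately show ?thesis by simp
    qed
    have "(LINT t|lborel. A t) = (LINT x|\<rho>. LINT t|lborel. ft t x)"
      unfolding A_def using Fubini_integral[OF i1] by simp
    moreover have "(LINT t|lborel. ft t x) = 0" for x
    proof -
      have "((\<lambda>t. \<phi> (t, x)) has_real_derivative ft t x) (at t)" for t
      proof -
        have "((\<lambda>t. (t, x)) has_derivative (\<lambda>h. (h, 0))) (at t)" by (intro derivative_intros)
        from has_derivative_compose[OF this D]
        have *: "((\<lambda>t. \<phi> (t, x)) has_derivative (\<lambda>h. frechet_derivative \<phi> (at (t, x)) (h, 0))) (at t)" .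
        have "linear (frechet_derivative \<phi> (at (t, x)))" using D has_derivative_linear by blast
        then have l: "frechet_derivative \<phi> (at (t, x)) (h *\<^sub>R (1, 0)) = h *\<^sub>R frechet_derivative \<phi> (at (t, x)) (1, 0)" for h
          by (rule linear_scale)
        have "frechet_derivative \<phi> (at (t, x)) (h, 0) = ft t x * h" for h
          using l[of h] by (simp add: ft_def)
        then show ?thesis using * by (simp add: has_field_derivative_def)
      qed
      then have "(LINT t:{-B-1..B+1}|lborel. ft t x) = \<phi> (B + 1, x) - \<phi> (-B-1, x)"
        by (rule set_integral_deriv[OF _ cft'(2)]) (use B in simp)
      also have "\<dots> = 0" using z[of "B + 1" x] z[of "-B-1" x] by simp
      finally have "(LINT t:{-B-1..B+1}|lborel. ft t x) = 0" .
      moreover have "(LINT t:{-B-1..B+1}|lborel. ft t x) = (LINT t|lborel. ft t x)"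
        by (rule integrable_locally_supported(2))
           (use locally_integrable_continuous[OF cft'(2)] ftB in \<open>auto simp: locally_integrable_def\<close>)
      ultimately show ?thesis by simp
    qed
    ultimately have A0: "(LINT t|lborel. A t) = 0" by simp
    have AG0: "A t = 0" "G t = 0" if "t \<le> 0" for t using ft0[OF that] by (simp_all add: A_def G_def)
    have "(LINT t:{0<..}|lborel. LINT x|\<rho>. - ft t x + fx t x * deriv V x) = (LINT t|lborel. - A t + G t)"
      unfolding in1 by (rule set_integral_positive_half_line) (simp add: AG0)
    moreover have "(LINT t:{0<..}|lborel. LINT x|lborel. fx t x * weak_deriv ?b x) = (LINT t|lborel. - G t)"
      unfolding in2 by (rule set_integral_positive_half_line) (simp add: AG0)
    ultimately show ?thesis unfolding ft_def[symmetric] fx_def[symmetric] using iA iG A0 by simp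
  qed
  show ?thesis unfolding stationary_solution_def wasserstein_solution_def
    using \<rho> e(1) weak
    by (auto simp: wasserstein2_self[OF s] equilibrium_imp_dissipation_zero[OF eq M] e(2))
qed

text \<open>Test with \<open>\<eta>(t) \<psi>(x)\<close>, where \<open>\<integral> \<eta> = 1\<close> and \<open>\<integral> \<eta>' = 0\<close>.\<close>

lemma stationary_imp_balance:
  assumes st: "stationary_solution \<beta> V m \<rho>" and T: "test_function UNIV \<psi>"
  defines "g \<equiv> weak_deriv (\<lambda>y. beta_ext \<beta> (cont_density \<rho> y))"
  shows "(LINT x|\<rho>. deriv \<psi> x * deriv V x) + (LINT x|lborel. deriv \<psi> x * g x) = 0"
proof -
  have M: "\<rho> \<in> M2 m" using st by (auto simp: stationary_solution_def wasserstein_solution_def)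
  then have s: "sets \<rho> = sets borel" and f: "finite_measure \<rho>" by (auto simp: M2_def Mplus_mass_def Mplus_def)
  \<comment> \<open>a bump supported in \<open>[1,2]\<close>, that is away from time \<open>0\<close>\<close>
  define \<eta> where "\<eta> t = deriv smooth_step (1 * t + (-1))" for t
  have \<eta>C: "Ck k \<eta>" for k
    unfolding \<eta>_def by (rule Ck_affine[OF Ck_SucD(2)[OF Ck_smooth_step]])
  have \<eta>z: "\<eta> t = 0" if "t \<notin> {1..2}" for t
    unfolding \<eta>_def by (rule deriv_smooth_step_outside) (use that in auto)
  have \<eta>d: "(\<eta> has_real_derivative deriv \<eta> t) (at t)" for t by (rule Ck_SucD(1)[OF \<eta>C])
  have "test_function UNIV \<eta>" by (rule test_function_UNIV_I[OF \<eta>C \<eta>z])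
  have \<eta>1: "(LINT t|lborel. \<eta> t) = 1"
  proof -
    have "(LINT t|lborel. \<eta> t) = (LINT t|lborel. \<eta> (1 + 1 * t))"
      using lborel_integral_real_affine[of 1 \<eta> 1] by simp
    then show ?thesis using integral_deriv_smooth_step(2) by (simp add: \<eta>_def)
  qed
  have d\<eta>z: "deriv \<eta> t = 0" if "t \<notin> {1..2}" for t
  proof (rule DERIV_imp_deriv, rule has_field_derivative_transform_within_open[where S="- {1..2}"])
    show "((\<lambda>x. 0) has_real_derivative 0) (at t)" by simp
    show "open (- {1..2::real})" by (rule open_Compl) simp
    show "0 = \<eta> y" if "y \<in> - {1..2}" for y using \<eta>z[of y] that by simp
  qed (use that in simp)
  have i\<eta>: "(LINT t|lborel. deriv \<eta> t) = 0" "integrable lborel (deriv \<eta>)" "integrable lborel \<eta>"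
  proof -
    have c: "continuous_on UNIV (deriv \<eta>)" by (rule Ck_continuous[OF Ck_SucD(2)[OF \<eta>C]])
    have si: "set_integrable lborel {0..3} (deriv \<eta>)" "set_integrable lborel {0..3} \<eta>"
      using locally_integrable_continuous[OF c] locally_integrable_continuous[OF Ck_continuous[OF \<eta>C]]
      by (auto simp: locally_integrable_def)
    have "(LINT t:{0..3}|lborel. deriv \<eta> t) = \<eta> 3 - \<eta> 0"
      by (rule set_integral_deriv[OF \<eta>d c]) simp
    moreover have "(LINT t:{0..3}|lborel. deriv \<eta> t) = (LINT t|lborel. deriv \<eta> t)"
      by (rule integrable_locally_supported(2)[OF si(1) d\<eta>z]) auto
    ultimately show "(LINT t|lborel. deriv \<eta> t) = 0" using \<eta>z[of 0] \<eta>z[of 3] by simp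
    show "integrable lborel (deriv \<eta>)" by (rule integrable_locally_supported(1)[OF si(1) d\<eta>z]) auto
    show "integrable lborel \<eta>" by (rule integrable_locally_supported(1)[OF si(2) \<eta>z]) auto
  qed
  obtain a b where ab: "a < b" and z: "\<And>x. x \<notin> {a..b} \<Longrightarrow> \<psi> x = 0" "\<And>x. x \<notin> {a..b} \<Longrightarrow> deriv \<psi> x = 0"
    and d: "\<And>x. (\<psi> has_real_derivative deriv \<psi> x) (at x)"
    and c\<psi>: "continuous_on UNIV \<psi>" "continuous_on UNIV (deriv \<psi>)"
    using test_functionD[OF T] by blast
  define \<phi> where "\<phi> p = \<eta> (fst p) * \<psi> (snd p)" for p
  have "test_function ({0<..} \<times> UNIV) \<phi>"
  proof -
    have "Ck k \<phi>" for k unfolding \<phi>_def using T \<eta>C by (intro Ck_tensor) (auto simp: test_function_def)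
    moreover have S: "closure {p. \<phi> p \<noteq> 0} \<subseteq> {1..2} \<times> {a..b}"
    proof (rule closure_minimal)
      show "{p. \<phi> p \<noteq> 0} \<subseteq> {1..2} \<times> {a..b}"
        using \<eta>z z(1) by (auto simp: \<phi>_def mem_Times_iff) force+
      show "closed ({1..2::real} \<times> {a..b})" by (intro closed_Times) auto
    qed
    moreover have "compact (closure {p. \<phi> p \<noteq> 0})"
      using compact_Int_closed[OF compact_Times[OF compact_Icc compact_Icc] closed_closure, of 1 2 a b "{p. \<phi> p \<noteq> 0}"] S
      by (simp add: Int_absorb1)
    moreover have "closure {p. \<phi> p \<noteq> 0} \<subseteq> {0<..} \<times> UNIV" using S by fastforce
    ultimately show ?thesis unfolding test_function_def by blast
  qed
  then have eq: "(LINT t:{0<..}|lborel. LINT x|\<rho>. - frechet_derivative \<phi> (at (t, x)) (1, 0)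
           + frechet_derivative \<phi> (at (t, x)) (0, 1) * deriv V x)
        + (LINT t:{0<..}|lborel. LINT x|lborel. frechet_derivative \<phi> (at (t, x)) (0, 1) * g x) = 0"
    using st unfolding stationary_solution_def wasserstein_solution_def g_def by blast
  have fd: "frechet_derivative \<phi> (at (t, x)) = (\<lambda>h. deriv \<eta> t * fst h * \<psi> x + \<eta> t * (deriv \<psi> x * snd h))" for t x
    using has_derivative_tensor[of \<eta> "deriv \<eta> t" "(t, x)" \<psi> "deriv \<psi> x"] \<eta>d d
    by (auto simp: \<phi>_def[abs_def] intro!: frechet_derivative_at[symmetric])
  define A where "A = (LINT x|\<rho>. \<psi> x)"
  define G where "G = (LINT x|\<rho>. deriv \<psi> x * deriv V x)"
  define W where "W = (LINT x|lborel. deriv \<psi> x * g x)"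
  have j1: "integrable \<rho> \<psi>"
    by (rule integrable_locally_supported(1)[OF set_integrable_continuous_finite[OF s f c\<psi>(1)] z(1)])
  have j2: "integrable \<rho> (\<lambda>x. deriv \<psi> x * deriv V x)"
    by (rule integrable_times_continuous_supported[OF s set_integrable_continuous_finite[OF s f continuous_deriv_V] c\<psi>(2) z(2)])
  have 1: "(LINT x|\<rho>. - frechet_derivative \<phi> (at (t, x)) (1, 0) + frechet_derivative \<phi> (at (t, x)) (0, 1) * deriv V x)
      = - A * deriv \<eta> t + G * \<eta> t" for t
  proof -
    have "(LINT x|\<rho>. - frechet_derivative \<phi> (at (t, x)) (1, 0) + frechet_derivative \<phi> (at (t, x)) (0, 1) * deriv V x)
      = (LINT x|\<rho>. - deriv \<eta> t * \<psi> x + \<eta> t * (deriv \<psi> x * deriv V x))"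
      by (rule Bochner_Integration.integral_cong) (simp_all add: fd)
    also have "\<dots> = - deriv \<eta> t * A + \<eta> t * G" unfolding A_def G_def using j1 j2 by simp
    finally show ?thesis by simp
  qed
  have 2: "(LINT x|lborel. frechet_derivative \<phi> (at (t, x)) (0, 1) * g x) = W * \<eta> t" for t
    by (simp add: fd W_def mult.assoc)
  have "(LINT t:{0<..}|lborel. - A * deriv \<eta> t + G * \<eta> t) = (LINT t|lborel. - A * deriv \<eta> t + G * \<eta> t)"
    by (rule set_integral_positive_half_line) (simp add: d\<eta>z \<eta>z)
  also have "\<dots> = G" using i\<eta> \<eta>1 by simp
  finally have 3: "(LINT t:{0<..}|lborel. - A * deriv \<eta> t + G * \<eta> t) = G" .
  have "(LINT t:{0<..}|lborel. W * \<eta> t) = (LINT t|lborel. W * \<eta> t)"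
    by (rule set_integral_positive_half_line) (simp add: \<eta>z)
  then have 4: "(LINT t:{0<..}|lborel. W * \<eta> t) = W" using \<eta>1 by simp
  show ?thesis using eq unfolding 1 2 3 4 by (simp add: G_def W_def)
qed

lemma stationary_imp_dissipation_finite:
  assumes st: "stationary_solution \<beta> V m \<rho>"
  shows "dissipation \<beta> V \<rho> < \<infinity>"
proof -
  have "\<forall>T0 T1 :: real. 0 < T0 \<and> T0 < T1 \<longrightarrow> (\<integral>\<^sup>+t\<in>{T0..T1}. dissipation \<beta> V \<rho> \<partial>lborel) < \<infinity>"
    using st unfolding stationary_solution_def wasserstein_solution_def by (elim conjE)
  from this[rule_format, of 1 2]
  have "(\<integral>\<^sup>+t\<in>{1..2::real}. dissipation \<beta> V \<rho> \<partial>lborel) < \<infinity>" by simp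
  moreover have "(\<integral>\<^sup>+t\<in>{1..2::real}. dissipation \<beta> V \<rho> \<partial>lborel) = dissipation \<beta> V \<rho> * emeasure lborel {1..2::real}"
    by (rule nn_integral_cmult_indicator) simp
  ultimately show ?thesis by simp
qed

text \<open>The balance law makes \<open>V' \<rho> + \<beta>(u)' dx\<close> a multiple \<open>c\<close> of Lebesgue measure; finite dissipation and
finite mass force \<open>c = 0\<close>.\<close>

lemma stationary_imp_dissipation_zero:
  assumes st: "stationary_solution \<beta> V m \<rho>"
  shows "dissipation \<beta> V \<rho> = 0"
proof -
  define u where "u = cont_density \<rho>"
  define b where "b = (\<lambda>x. beta_ext \<beta> (u x))"
  define g where "g = weak_deriv b"
  define \<sigma> where "\<sigma> = singular_part \<rho>"
  let ?u = "\<lambda>x. enn2real (u x)"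
  have fin: "dissipation \<beta> V \<rho> < \<infinity>" by (rule stationary_imp_dissipation_finite[OF st])
  then have \<rho>: "\<rho> \<in> Mplus_c" and b: "b \<in> W11_loc"
    unfolding dissipation_def Let_def b_def u_def by (auto split: if_splits)
  note D = Mplus_c_D[OF \<rho>, folded u_def \<sigma>_def]
  have fin': "(\<integral>\<^sup>+x\<in>D_plus u. ennreal ((g x / ?u x + deriv V x)\<^sup>2 * ?u x) \<partial>lborel) < \<infinity>"
    using fin \<rho> b unfolding dissipation_def Let_def g_def b_def u_def by simp
  have W: "has_weak_deriv b g" unfolding g_def by (rule has_weak_deriv_weak_deriv[OF b])
  then have gl: "locally_integrable g" by (simp add: has_weak_deriv_def)
  have gm: "g \<in> borel_measurable borel" by (rule locally_integrable_measurable[OF gl])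
  have cb: "continuous_on UNIV b" unfolding b_def by (rule continuous_beta_ext[OF D(2)])
  have inc: "b y - b x = (LINT t:{x<..y}|lborel. g t)" if "x < y" for x y
    using weak_deriv_imp_increment[OF W cb that] .
  have s: "sets \<rho> = sets borel" "finite_measure \<rho>" using D(1) by (auto simp: Mplus_def)
  have s\<sigma>: "sets \<sigma> = sets borel" and f\<sigma>: "finite_measure \<sigma>"
    using D(3) lebesgue_decomposition_mass(2)[OF D(3,1)] by (auto simp: lebesgue_decomposition_def)
  have ui: "integrable lborel ?u" by (rule lebesgue_decomposition_mass(4)[OF D(3,1)])
  have Vl: "locally_integrable (\<lambda>x. deriv V x * ?u x)"
    by (intro locally_integrable_times_continuous locally_integrable_integrable ui continuous_deriv_V)
  define h where "h x = deriv V x * ?u x + g x" for x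
  have hl: "locally_integrable h"
    using Vl gl unfolding h_def locally_integrable_def by (auto intro: set_integral_add)
  have bal: "(LINT x|\<sigma>. deriv \<psi> x * deriv V x) + (LINT x|lborel. deriv \<psi> x * h x) = 0"
    if T: "test_function UNIV \<psi>" for \<psi>
  proof -
    obtain p q where pq: "p < q" and z: "\<And>x. x \<notin> {p..q} \<Longrightarrow> \<psi> x = 0" "\<And>x. x \<notin> {p..q} \<Longrightarrow> deriv \<psi> x = 0"
      and d: "\<And>x. (\<psi> has_real_derivative deriv \<psi> x) (at x)"
      and c\<psi>: "continuous_on UNIV \<psi>" "continuous_on UNIV (deriv \<psi>)"
      using test_functionD[OF T] by blast
    have j: "integrable \<rho> (\<lambda>x. deriv \<psi> x * deriv V x)"
      by (rule integrable_times_continuous_supported[OF s(1) set_integrable_continuous_finite[OF s continuous_deriv_V] c\<psi>(2) z(2)])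
    have i: "integrable lborel (\<lambda>x. deriv \<psi> x * (deriv V x * ?u x))" "integrable lborel (\<lambda>x. deriv \<psi> x * g x)"
      by (rule integrable_times_continuous_supported[OF _ _ c\<psi>(2) z(2)]; use Vl gl in \<open>simp add: locally_integrable_def\<close>)+
    have "(LINT x|\<rho>. deriv \<psi> x * deriv V x) = (LINT x|lborel. deriv \<psi> x * (deriv V x * ?u x)) + (LINT x|\<sigma>. deriv \<psi> x * deriv V x)"
      using lebesgue_decomposition_integral(3)[OF D(3,1) j] by (simp add: mult.assoc)
    moreover have "(LINT x|lborel. deriv \<psi> x * h x) = (LINT x|lborel. deriv \<psi> x * (deriv V x * ?u x)) + (LINT x|lborel. deriv \<psi> x * g x)"
      unfolding h_def distrib_left by (rule Bochner_Integration.integral_add[OF i])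
    ultimately show ?thesis
      using stationary_imp_balance[OF st T] unfolding g_def b_def u_def by simp
  qed
  obtain c where c: "\<And>a b. a < b \<Longrightarrow> (LINT x:{a<..b}|\<sigma>. deriv V x) + (LINT x:{a<..b}|lborel. h x) = c * (b - a)"
    using distribution_deriv_zero_imp_constant[OF s\<sigma> set_integrable_continuous_finite[OF s\<sigma> f\<sigma> continuous_deriv_V] hl bal] by blast
  have cl: "locally_integrable (\<lambda>x. c)" by (rule locally_integrable_continuous) simp
  obtain N where N: "N \<in> null_sets lborel" "emeasure \<sigma> (- N) = 0"
    using D(3) by (auto simp: lebesgue_decomposition_def)
  have ivl: "(LINT x:{a<..b}|\<sigma>. deriv V x) + (LINT x:{a<..b}|lborel. h x - c) = 0" if "a < b" for a b
  proof -
    have "(LINT x:{a<..b}|lborel. c) = c * (b - a)" using that by (simp add: set_lebesgue_integral_def)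
    then show ?thesis using c[OF that] interval_integral_Ioc_diff[OF hl cl, of a b] by simp
  qed
  note van = singular_pair_vanishing[OF s\<sigma> set_integrable_continuous_finite[OF s\<sigma> f\<sigma> continuous_deriv_V]
      locally_integrable_diff[OF hl cl] N]
  have Vz: "AE x in \<sigma>. deriv V x = 0" by (rule van(1)) (rule ivl)
  have "AE x in lborel. h x - c = 0" by (rule van(2)) (rule ivl)
  then have gc: "AE x in lborel. g x = c - deriv V x * ?u x"
    by eventually_elim (simp add: h_def)
  have "c = 0"
  proof (cases "\<exists>z. u z = 0")
    case True
    then obtain z where z: "u z = 0" by blast
    define S where "S = {x. u x < \<infinity>}"
    have oS: "open S" unfolding S_def using D(2) by (intro open_Collect_less) auto
    have zS: "z \<in> S" using z by (simp add: S_def)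
    have cu: "continuous_on S ?u"
      using continuous_on_subset[OF D(2), of S]
      by (auto simp: continuous_on_def S_def less_top intro!: tendsto_enn2real)
    \<comment> \<open>near \<open>z\<close> the density is finite, so the weak derivative is continuous there\<close>
    have "(b has_real_derivative (c - deriv V z * ?u z)) (at z)"
      by (rule increment_integral_imp_DERIV[OF gm inc oS zS]) (use gc cu in \<open>auto intro!: continuous_intros continuous_deriv_V elim!: eventually_mono\<close>)
    then have "(b has_real_derivative c) (at z)" using z by simp
    moreover have "b z \<le> b y" for y using z beta_ext_nonneg by (simp add: b_def beta_ext_def[of _ 0] zero)
    ultimately show ?thesis using DERIV_local_min[of b c z 1] by simp
  next
    case False
    have "{x. u x = \<infinity>} \<in> null_sets lborel"
    proof -
      have "closed {x. u x = \<infinity>}" using D(2) by (intro closed_Collect_eq) auto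
      then show ?thesis using D(5) by auto
    qed
    then have "AE x in lborel. x \<notin> {x. u x = \<infinity>}" by (rule AE_not_in)
    then have "AE x in lborel. ennreal (2 * \<bar>c\<bar>) \<le>
        ennreal ((g x / ?u x + deriv V x)\<^sup>2 * ?u x) * indicator (D_plus u) x + u x"
      using gc
    proof eventually_elim
      case (elim x)
      then have x: "x \<in> D_plus u" using False by (auto simp: D_plus_def less_top zero_less_iff_neq_zero)
      then have p: "?u x > 0" "u x = ennreal (?u x)" by (auto simp: D_plus_def enn2real_positive_iff less_top)
      have e: "(g x / ?u x + deriv V x)\<^sup>2 * ?u x = c\<^sup>2 / ?u x"
        using p elim(2) by (simp add: field_simps power2_eq_square)
      have "2 * \<bar>c\<bar> * ?u x \<le> c\<^sup>2 + (?u x)\<^sup>2"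
        using sum_squares_bound[of "\<bar>c\<bar>" "?u x"] by simp
      then have "2 * \<bar>c\<bar> \<le> c\<^sup>2 / ?u x + ?u x"
        using p(1) by (simp add: field_simps power2_eq_square)
      then have "ennreal (2 * \<bar>c\<bar>) \<le> ennreal (c\<^sup>2 / ?u x + ?u x)" by (rule ennreal_leI)
      also have "\<dots> = ennreal (c\<^sup>2 / ?u x) + u x" using p by (subst ennreal_plus) auto
      finally show ?case using x e by simp
    qed
    then have "(\<integral>\<^sup>+x. ennreal (2 * \<bar>c\<bar>) \<partial>(lborel :: real measure)) \<le>
        (\<integral>\<^sup>+x. ennreal ((g x / ?u x + deriv V x)\<^sup>2 * ?u x) * indicator (D_plus u) x + u x \<partial>lborel)"
      by (rule nn_integral_mono_AE)
    also have "\<dots> = (\<integral>\<^sup>+x\<in>D_plus u. ennreal ((g x / ?u x + deriv V x)\<^sup>2 * ?u x) \<partial>lborel) + (\<integral>\<^sup>+x. u x \<partial>lborel)"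
    proof (rule nn_integral_add)
      have [measurable]: "g \<in> borel_measurable borel" "deriv V \<in> borel_measurable borel" "u \<in> borel_measurable borel"
        "D_plus u \<in> sets borel"
        using gm borel_measurable_continuous_onI[OF continuous_deriv_V] D(3) D_plus_open[OF D(2)]
        by (auto simp: lebesgue_decomposition_def)
      show "(\<lambda>x. ennreal ((g x / ?u x + deriv V x)\<^sup>2 * ?u x) * indicator (D_plus u) x) \<in> borel_measurable lborel"
        "u \<in> borel_measurable lborel" by measurable
    qed
    also have "\<dots> < \<infinity>" using fin' lebesgue_decomposition_mass(1)[OF D(3,1)] by simp
    finally show "c = 0" by (auto simp: ennreal_mult_eq_top_iff less_top[symmetric])
  qed
  then have "AE x in lborel. x \<in> D_plus u \<longrightarrow> g x = - (deriv V x * ?u x)"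
    using gc by (auto elim!: eventually_mono)
  then show ?thesis unfolding dissipation_zero_iff
    using \<rho> b Vz unfolding g_def b_def u_def \<sigma>_def by (intro conjI)
qed

end

section \<open>Minimizers of the free energy\<close>

lemma ex_sum_measure:
  assumes s: "sets N = sets M"
  shows "\<exists>L. sets L = sets M \<and> (\<forall>A\<in>sets M. emeasure L A = emeasure M A + emeasure N A)"
proof -
  define \<mu> where "\<mu> A = emeasure M A + emeasure N A" for A
  define L where "L = measure_of (space M) (sets M) \<mu>"
  have "emeasure L A = \<mu> A" if "A \<in> sets M" for A
  proof (rule emeasure_measure_of[OF L_def])
    show "sets M \<subseteq> Pow (space M)" by (rule sets.space_closed)
    show "A \<in> sets L" using that by (simp add: L_def)
    show "positive (sets L) \<mu>" by (simp add: positive_def \<mu>_def)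
    show "countably_additive (sets L) \<mu>"
    proof (rule countably_additiveI)
      fix B :: "nat \<Rightarrow> _"
      assume B: "range B \<subseteq> sets L" "disjoint_family B"
      then have "range B \<subseteq> sets M" "range B \<subseteq> sets N" using s by (auto simp: L_def)
      then have "(\<Sum>i. emeasure M (B i)) = emeasure M (\<Union>i. B i)" "(\<Sum>i. emeasure N (B i)) = emeasure N (\<Union>i. B i)"
        using suminf_emeasure B(2) by blast+
      then show "(\<Sum>i. \<mu> (B i)) = \<mu> (\<Union>i. B i)" unfolding \<mu>_def by (subst suminf_add[symmetric]) auto
    qed
  qed
  then show ?thesis by (intro exI[of _ L]) (simp add: L_def \<mu>_def)
qed

lemma ex_point_mass:
  "\<exists>\<sigma>. sets \<sigma> = sets (borel :: real measure) \<and> (\<forall>A\<in>sets borel. emeasure \<sigma> A = r * indicator A (x0 :: real))"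
proof -
  define \<sigma> where "\<sigma> = distr (density (count_space {x0}) (\<lambda>_. r)) borel (\<lambda>x. x)"
  have "emeasure \<sigma> A = r * indicator A x0" if "A \<in> sets borel" for A
  proof -
    have "emeasure \<sigma> A = emeasure (density (count_space {x0}) (\<lambda>_. r)) (A \<inter> {x0})"
      unfolding \<sigma>_def using that by (subst emeasure_distr) auto
    also have "\<dots> = (\<integral>\<^sup>+x. r * indicator (A \<inter> {x0}) x \<partial>count_space {x0})"
      by (subst emeasure_density) auto
    also have "\<dots> = r * indicator A x0" by (simp add: nn_integral_count_space_finite indicator_def)
    finally show ?thesis .
  qed
  then show ?thesis by (intro exI[of _ \<sigma>]) (auto simp: \<sigma>_def)
qed

lemma lebesgue_decomposition_cong_AE:
  assumes d: "lebesgue_decomposition \<rho> u \<sigma>" and v: "v \<in> borel_measurable borel" and ae: "AE x in lborel. u x = v x"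
  shows "lebesgue_decomposition \<rho> v \<sigma>"
proof -
  have "(\<integral>\<^sup>+x\<in>A. v x \<partial>lborel) = (\<integral>\<^sup>+x\<in>A. u x \<partial>lborel)" for A
    by (rule nn_integral_cong_AE) (use ae in eventually_elim, simp)
  then show ?thesis using d v by (auto simp: lebesgue_decomposition_def)
qed

lemma ext_integral_integrable:
  assumes "integrable M f" shows "ext_integral M f = ereal (LINT x|M. f x)"
proof -
  have "enn2ereal a - enn2ereal b = ereal (enn2real a - enn2real b)" if "a \<noteq> \<infinity>" "b \<noteq> \<infinity>" for a b
    using that by (cases a; cases b) (auto simp: enn2ereal_ennreal)
  then show ?thesis
    using assms unfolding ext_integral_def by (subst real_lebesgue_integral_def) (auto simp: real_integrable_def)
qed

text \<open>An integrable minorant leaves only two possibilities; in particular \<open>\<infinity> - \<infinity>\<close> does not occur.\<close>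

lemma ext_integral_cases:
  assumes f: "f \<in> borel_measurable M" and l: "integrable M l" "AE x in M. l x \<le> f x"
  shows "(integrable M f \<and> ext_integral M f = ereal (LINT x|M. f x)) \<or> ext_integral M f = \<infinity>"
proof -
  have "(\<integral>\<^sup>+x. ennreal (- f x) \<partial>M) \<le> (\<integral>\<^sup>+x. ennreal (norm (l x)) \<partial>M)"
  proof (rule nn_integral_mono_AE)
    show "AE x in M. ennreal (- f x) \<le> ennreal (norm (l x))"
      using l(2) by eventually_elim (auto intro!: ennreal_leI)
  qed
  also have "\<dots> < \<infinity>" using l(1) by (simp add: integrable_iff_bounded)
  finally have n: "(\<integral>\<^sup>+x. ennreal (- f x) \<partial>M) < \<infinity>" .
  show ?thesis
  proof (cases "(\<integral>\<^sup>+x. ennreal (f x) \<partial>M) = \<infinity>")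
    case True
    have "(\<infinity> :: ereal) - y = \<infinity>" for y by (cases y) auto
    then show ?thesis using True by (simp add: ext_integral_def)
  next
    case False
    then have i: "integrable M f"
      using n f by (simp add: real_integrable_def less_top[symmetric])
    then show ?thesis using ext_integral_integrable by blast
  qed
qed

locale normalizable_pressure = confined_pressure +
  assumes integrable_H: "\<exists>Q'. open Q' \<and> bounded Q' \<and> Q_set V \<subseteq> Q' \<and>
     set_integrable lborel (- Q') (\<lambda>x. H_fun \<beta> (V x - V_min V))"
begin

lemma continuous_H_V: "C < V_min V \<Longrightarrow> continuous_on UNIV (\<lambda>x. H (V x - C))"
proof -
  assume C: "C < V_min V"
  have p: "V x - C > 0" for x using C V_min_le[of x] by simp
  show ?thesis
    using isCont_H p
    by (intro continuous_on_compose2[OF continuous_at_imp_continuous_on[of "{0<..}" H]] continuous_intros continuous_V) auto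
qed

text \<open>Outside a neighbourhood of the minimum set the profile at level \<open>C\<close> lies below the one at level
\<open>min V\<close>; inside it is bounded by \<open>H(min V - C)\<close>.\<close>

lemma integrable_H_V:
  assumes C: "C < V_min V" shows "integrable lborel (\<lambda>x. H (V x - C))"
proof -
  obtain Q' where Q: "open Q'" "bounded Q'" "Q_set V \<subseteq> Q'" "set_integrable lborel (- Q') (\<lambda>x. H (V x - V_min V))"
    using integrable_H by blast
  have p: "V x - C \<ge> V_min V - C" "V_min V - C > 0" for x using C V_min_le[of x] by auto
  have fin: "emeasure lborel Q' < \<infinity>" using emeasure_bounded_finite[OF Q(2)] .
  have "integrable lborel (\<lambda>x. H (V_min V - C) * indicat_real Q' x)"
    using Q(1) fin by (intro integrable_mult_right integrable_real_indicator) auto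
  then have "integrable lborel (\<lambda>x. indicat_real (- Q') x *\<^sub>R H (V x - V_min V) + H (V_min V - C) * indicat_real Q' x)"
    using Q(4) unfolding set_integrable_def by (intro Bochner_Integration.integrable_add)
  then show ?thesis
  proof (rule Bochner_Integration.integrable_bound)
    show "(\<lambda>x. H (V x - C)) \<in> borel_measurable lborel"
      using borel_measurable_continuous_onI[OF continuous_H_V[OF C]] by simp
    show "AE x in lborel. norm (H (V x - C)) \<le> norm (indicat_real (- Q') x *\<^sub>R H (V x - V_min V) + H (V_min V - C) * indicat_real Q' x)"
    proof (rule AE_I2)
      fix x
      have h: "H (V x - C) > 0" using H_pos p(1)[of x] p(2) by simp
      show "norm (H (V x - C)) \<le> norm (indicat_real (- Q') x *\<^sub>R H (V x - V_min V) + H (V_min V - C) * indicat_real Q' x)"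
      proof (cases "x \<in> Q'")
        case True
        have "H (V x - C) \<le> H (V_min V - C)"
          using H_less[OF p(2), of "V x - C"] p(1)[of x] by (cases "V x = V_min V") auto
        then show ?thesis using True h by simp
      next
        case False
        then have "V x \<noteq> V_min V" using Q(3) by (auto simp: Q_set_def)
        then have "H (V x - C) \<le> H (V x - V_min V)"
          using H_less[of "V x - V_min V" "V x - C"] V_min_le[of x] C by simp
        then show ?thesis using False h by simp
      qed
    qed
  qed
qed

definition mass :: "real \<Rightarrow> real" where "mass C = (LINT x|lborel. H (V x - C))"

lemma H_V_mono:
  assumes "C \<le> D" "D < V_min V"
  shows "norm (H (V x - C)) \<le> H (V x - D)"
proof -
  have "V x - D > 0" "V x - C > 0" using assms V_min_le[of x] by auto
  then show ?thesis using H_less[of "V x - D" "V x - C"] H_pos[of "V x - C"] assms by (cases "C = D") auto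
qed

lemma isCont_mass:
  assumes C: "C < V_min V" shows "isCont mass C"
  unfolding continuous_at_sequentially
proof (intro allI impI)
  fix c :: "nat \<Rightarrow> real" assume c: "c \<longlonglongrightarrow> C"
  \<comment> \<open>an integrable profile that dominates those at all levels near \<open>C\<close>\<close>
  define D where "D = (C + V_min V) / 2"
  have D: "C < D" "D < V_min V" using C by (auto simp: D_def)
  have "\<forall>\<^sub>F n in sequentially. c n < D" using order_tendstoD(2)[OF c D(1)] .
  then obtain N where N: "\<And>n. n \<ge> N \<Longrightarrow> c n < D" by (auto simp: eventually_sequentially)
  have "(\<lambda>n. mass (c (n + N))) \<longlonglongrightarrow> mass C" unfolding mass_def
  proof (rule integral_dominated_convergence)
    show "(\<lambda>x. H (V x - C)) \<in> borel_measurable lborel"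
      using borel_measurable_integrable[OF integrable_H_V[OF C]] .
    have "c (n + N) < V_min V" for n using N[of "n + N"] D by simp
    then show "(\<lambda>x. H (V x - c (n + N))) \<in> borel_measurable lborel" for n
      using borel_measurable_integrable[OF integrable_H_V] by blast
    show "integrable lborel (\<lambda>x. H (V x - D))" by (rule integrable_H_V[OF D(2)])
    show "AE x in lborel. norm (H (V x - c (n + N))) \<le> H (V x - D)" for n
      using H_V_mono[OF _ D(2)] N[of "n + N"] by (simp add: less_imp_le)
    show "AE x in lborel. (\<lambda>n. H (V x - c (n + N))) \<longlonglongrightarrow> H (V x - C)"
    proof (rule AE_I2)
      fix x
      have "V x - C > 0" using C V_min_le[of x] by simp
      moreover have "(\<lambda>n. V x - c (n + N)) \<longlonglongrightarrow> V x - C"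
        by (intro tendsto_intros LIMSEQ_ignore_initial_segment c)
      ultimately show "(\<lambda>n. H (V x - c (n + N))) \<longlonglongrightarrow> H (V x - C)"
        by (intro isCont_tendsto_compose[OF isCont_H])
    qed
  qed
  then show "(mass \<circ> c) \<longlonglongrightarrow> mass C" unfolding comp_def by (rule LIMSEQ_offset)
qed

lemma mass_small:
  assumes "m > 0" shows "\<exists>C<V_min V. mass C < m"
proof -
  define c where "c n = V_min V - 1 - real n" for n
  have c: "c n < V_min V" for n by (simp add: c_def)
  have "(\<lambda>n. mass (c n)) \<longlonglongrightarrow> (LINT x|(lborel :: real measure). 0)" unfolding mass_def
  proof (rule integral_dominated_convergence)
    show "(\<lambda>x. H (V x - c n)) \<in> borel_measurable lborel" for n
      by (rule borel_measurable_integrable[OF integrable_H_V[OF c]])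
    show "integrable lborel (\<lambda>x. H (V x - c 0))" by (rule integrable_H_V[OF c])
    show "AE x in lborel. norm (H (V x - c n)) \<le> H (V x - c 0)" for n
      using H_V_mono[OF _ c[of 0]] by (simp add: c_def)
    show "AE x in lborel. (\<lambda>n. H (V x - c n)) \<longlonglongrightarrow> 0"
    proof (rule AE_I2)
      fix x
      have "filterlim (\<lambda>n. (V x - V_min V + 1) + real n) at_top sequentially"
        by (intro filterlim_tendsto_add_at_top[OF tendsto_const] filterlim_real_sequentially)
      then have "filterlim (\<lambda>n. V x - c n) at_top sequentially" by (simp add: c_def algebra_simps)
      then show "(\<lambda>n. H (V x - c n)) \<longlonglongrightarrow> 0" by (rule filterlim_compose[OF H_tendsto_0])
    qed
  qed simp
  then have "\<forall>\<^sub>F n in sequentially. mass (c n) < m" using order_tendstoD(2) assms by fastforce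
  then show ?thesis using c by (auto simp: eventually_sequentially)
qed

lemma ex_equilibrium_with_profile:
  assumes C: "C \<le> V_min V" and null: "emeasure lborel {x. V x = C} = 0"
    and M: "(\<integral>\<^sup>+x. K (V x - C) \<partial>lborel) = ennreal M" "M \<ge> 0" and r: "r \<ge> 0" "r = 0 \<or> C = V_min V"
  shows "\<exists>\<rho>\<in>Mplus_mass (M + r). equilibrium C \<rho>"
proof -
  let ?u = "\<lambda>x. K (V x - C)"
  obtain x0 where x0: "V x0 = V_min V" using V_attains_min by blast
  have um [measurable]: "?u \<in> borel_measurable borel" using borel_measurable_continuous_onI[OF continuous_K_V] .
  obtain \<sigma> where \<sigma>: "sets \<sigma> = sets (borel :: real measure)"
     "\<And>A. A \<in> sets borel \<Longrightarrow> emeasure \<sigma> A = ennreal r * indicator A x0"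
    using ex_point_mass by metis
  obtain \<rho> where \<rho>: "sets \<rho> = sets borel"
    "\<And>A. A \<in> sets borel \<Longrightarrow> emeasure \<rho> A = emeasure (density lborel ?u) A + emeasure \<sigma> A"
    using ex_sum_measure[of \<sigma> "density lborel ?u"] \<sigma>(1) by auto
  have d: "lebesgue_decomposition \<rho> ?u \<sigma>"
    unfolding lebesgue_decomposition_def
  proof (intro conjI bexI[of _ "{x0}"] ballI)
    show "emeasure \<rho> A = (\<integral>\<^sup>+x\<in>A. ?u x \<partial>lborel) + emeasure \<sigma> A" if "A \<in> sets borel" for A
      using \<rho>(2)[OF that] that by (simp add: emeasure_density)
    show "emeasure \<sigma> (- {x0}) = 0" by (subst \<sigma>(2)) auto
  qed (use \<sigma>(1) in auto)
  have tot: "emeasure \<rho> UNIV = ennreal (M + r)"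
    using d M r \<sigma>(2)[of UNIV] by (simp add: lebesgue_decomposition_def ennreal_plus)
  have sp: "space \<rho> = UNIV" using sets_eq_imp_space_eq[OF \<rho>(1)] by simp
  have "finite_measure \<rho>" by (rule finite_measureI) (simp add: sp tot)
  moreover have "measure \<rho> UNIV = M + r" using M(2) r(1) by (simp only: measure_def tot enn2real_ennreal add_nonneg_nonneg)
  ultimately have "\<rho> \<in> Mplus_mass (M + r)" using \<rho>(1) by (simp add: Mplus_mass_def Mplus_def)
  moreover have "emeasure \<sigma> {x. V x \<noteq> C} = 0"
  proof -
    have "open {x. V x \<noteq> C}" by (intro open_Collect_neq continuous_V continuous_on_const)
    then show ?thesis using \<sigma>(2)[of "{x. V x \<noteq> C}"] r x0 by auto
  qed
  then have "equilibrium C \<rho>"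
    unfolding equilibrium_def singular_part_eq[OF d] using C null d by blast
  ultimately show ?thesis by blast
qed

text \<open>Either the intermediate value theorem yields a level below \<open>min V\<close>, or all these profiles have mass
less than \<open>m\<close>. In the second case monotone convergence shows that the profile at level \<open>min V\<close> is
integrable; as it is infinite on \<open>{V = min V}\<close>, this set is null, and a point mass can be added.\<close>

lemma ex_equilibrium:
  assumes m: "m > 0"
  shows "\<exists>C. \<exists>\<rho>\<in>Mplus_mass m. equilibrium C \<rho>"
proof (cases "\<exists>C<V_min V. mass C \<ge> m")
  case True
  then obtain C1 where C1: "C1 < V_min V" "m \<le> mass C1" by blast
  obtain C0 where C0: "C0 < V_min V" "mass C0 < m" using mass_small[OF m] by blast
  have mono: "mass C \<le> mass D" if "C \<le> D" "D < V_min V" for C D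
    unfolding mass_def
  proof (rule integral_mono[OF integrable_H_V integrable_H_V])
    show "H (V x - C) \<le> H (V x - D)" for x using H_V_mono[OF that, of x] by simp
  qed (use that in auto)
  have "C0 < C1" using mono[of C1 C0] C0 C1 by force
  then obtain C where C: "C \<le> C1" "mass C = m"
    using IVT[of mass C0 m C1] C0 C1 isCont_mass by (meson less_imp_le order_le_less_trans)
  have CV: "C < V_min V" using C C1 by simp
  have p: "V x - C > 0" for x using CV V_min_le[of x] by simp
  have "(\<integral>\<^sup>+x. K (V x - C) \<partial>lborel) = (\<integral>\<^sup>+x. ennreal (H (V x - C)) \<partial>lborel)" using p by (simp add: K_def)
  also have "\<dots> = ennreal m"
    using nn_integral_eq_integral[OF integrable_H_V[OF CV]] H_pos[OF p] C(2) by (simp add: mass_def less_imp_le)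
  finally have "(\<integral>\<^sup>+x. K (V x - C) \<partial>lborel) = ennreal m" .
  moreover have "{x. V x = C} = {}" using p by (force simp: less_le)
  ultimately show ?thesis
    using ex_equilibrium_with_profile[of C m 0] CV m by auto
next
  case False
  then have small: "mass C < m" if "C < V_min V" for C using that by (meson not_le)
  let ?C = "V_min V"
  define f where "f n x = ennreal (H (V x - (?C - 1 / real (Suc n))))" for n x
  have cn: "?C - 1 / real (Suc n) < ?C" for n by simp
  have "incseq f"
  proof (intro incseq_SucI le_funI)
    fix n x
    have "1 / real (Suc (Suc n)) \<le> 1 / real (Suc n)" by (intro divide_left_mono) auto
    then show "f n x \<le> f (Suc n) x"
      using H_V_mono[of "?C - 1 / real (Suc n)" "?C - 1 / real (Suc (Suc n))" x] cn[of "Suc n"]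
      unfolding f_def by (intro ennreal_leI) simp
  qed
  then have mc: "(\<integral>\<^sup>+x. (SUP n. f n x) \<partial>lborel) = (SUP n. \<integral>\<^sup>+x. f n x \<partial>lborel)"
  proof (rule nn_integral_monotone_convergence_SUP)
    show "f n \<in> borel_measurable lborel" for n unfolding f_def
      using borel_measurable_integrable[OF integrable_H_V[OF cn[of n]]] by measurable
  qed
  have "(\<integral>\<^sup>+x. f n x \<partial>lborel) \<le> ennreal m" for n
  proof -
    have "V x - (?C - 1 / real (Suc n)) > 0" for x using V_min_le[of x] cn[of n] by linarith
    then have "(\<integral>\<^sup>+x. f n x \<partial>lborel) = ennreal (mass (?C - 1 / real (Suc n)))"
      unfolding f_def mass_def by (intro nn_integral_eq_integral integrable_H_V cn) (simp add: H_pos less_imp_le)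
    then show ?thesis using small[OF cn[of n]] by (simp add: ennreal_leI)
  qed
  then have "(SUP n. \<integral>\<^sup>+x. f n x \<partial>lborel) \<le> ennreal m" by (intro SUP_least)
  moreover have "(SUP n. f n x) = K (V x - ?C)" for x
  proof -
    have "(\<lambda>n. V x - (?C - 1 / real (Suc n))) \<longlonglongrightarrow> V x - (?C - 0)"
      by (intro tendsto_intros LIMSEQ_Suc[OF lim_1_over_n])
    then have "(\<lambda>n. K (V x - (?C - 1 / real (Suc n)))) \<longlonglongrightarrow> K (V x - ?C)"
      by (intro continuous_on_tendsto_compose[OF continuous_K]) auto
    moreover have "K (V x - (?C - 1 / real (Suc n))) = f n x" for n
    proof -
      have "V x - (?C - 1 / real (Suc n)) > 0" using V_min_le[of x] cn[of n] by linarith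
      then show ?thesis unfolding K_def f_def by (rule if_P)
    qed
    ultimately have "(\<lambda>n. f n x) \<longlonglongrightarrow> K (V x - ?C)" by simp
    moreover have "incseq (\<lambda>n. f n x)" using \<open>incseq f\<close> by (auto simp: incseq_def le_fun_def)
    ultimately show ?thesis using LIMSEQ_SUP LIMSEQ_unique by blast
  qed
  ultimately have le: "(\<integral>\<^sup>+x. K (V x - ?C) \<partial>lborel) \<le> ennreal m" using mc by simp
  have km: "(\<lambda>x. K (V x - ?C)) \<in> borel_measurable borel" using borel_measurable_continuous_onI[OF continuous_K_V] .
  have fin: "(\<integral>\<^sup>+x. K (V x - ?C) \<partial>lborel) < \<infinity>" using le by (rule le_less_trans) simp
  then have "AE x in lborel. K (V x - ?C) \<noteq> \<infinity>" using km by (intro nn_integral_PInf_AE) auto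
  then have "AE x in lborel. x \<notin> {x. V x = ?C}" by eventually_elim (auto simp: K_def)
  moreover have "closed {x. V x = ?C}" by (intro closed_Collect_eq continuous_V continuous_on_const)
  ultimately have null: "emeasure lborel {x. V x = ?C} = 0"
    by (subst (asm) AE_iff_null_sets[symmetric]) auto
  define M where "M = enn2real (\<integral>\<^sup>+x. K (V x - ?C) \<partial>lborel)"
  have M: "(\<integral>\<^sup>+x. K (V x - ?C) \<partial>lborel) = ennreal M" "M \<ge> 0"
    using fin by (auto simp: M_def less_top)
  then have "M \<le> m" using le m by (simp add: ennreal_le_iff)
  then show ?thesis
    using ex_equilibrium_with_profile[OF order_refl null M, of "m - M"] by auto
qed

text \<open>After subtraction of \<open>C m\<close>, distributed over both parts of the measure, the free energy is
\<open>\<integral> (E(u) + (V - C) u) dx + \<integral> (V - C) d\<rho>\<^sup>\<bottom>\<close>, and both integrands are bounded below pointwise.\<close>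

lemma equilibrium_minimality:
  assumes eq: "equilibrium C \<rho>" and \<rho>: "\<rho> \<in> Mplus_mass m" and \<mu>: "\<mu> \<in> Mplus_mass m"
  shows "F_functional \<beta> V \<rho> \<le> F_functional \<beta> V \<mu>"
    and "F_functional \<beta> V \<mu> \<le> F_functional \<beta> V \<rho> \<Longrightarrow> equilibrium C \<mu>"
proof -
  have C: "C \<le> V_min V" and null: "emeasure lborel {x. V x = C} = 0"
    and d: "lebesgue_decomposition \<rho> (\<lambda>x. K (V x - C)) (singular_part \<rho>)"
    using eq by (auto simp: equilibrium_def)
  have P: "\<rho> \<in> Mplus" "measure \<rho> UNIV = m" "\<mu> \<in> Mplus" "measure \<mu> UNIV = m"
    using \<rho> \<mu> by (auto simp: Mplus_mass_def)
  have VC: "C \<le> V x" for x using C V_min_le[of x] by simp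
  have Vm [measurable]: "V \<in> borel_measurable borel" by (rule borel_measurable_continuous_onI[OF continuous_V])
  have "closed {x. V x = C}" by (intro closed_Collect_eq continuous_V continuous_on_const)
  then have "{x. V x = C} \<in> null_sets lborel" using null by auto
  then have "AE x in lborel. x \<notin> {x. V x = C}" by (rule AE_not_in)
  then have AEV: "AE x in lborel. V x - C > 0"
  proof eventually_elim
    case (elim x)
    then show ?case using VC[of x] by simp
  qed
  define h where "h x = enn2real (K (V x - C))" for x
  have hi: "integrable lborel h" unfolding h_def by (rule lebesgue_decomposition_mass(4)[OF d P(1)])
  have hH: "h x = H (V x - C)" if "V x - C > 0" for x using that H_pos[OF that] by (simp add: h_def K_def less_imp_le)
  define e where "e x = - beta_ext \<beta> (K (V x - C))" for x
  have eH: "e x = - \<beta> (H (V x - C))" if "V x - C > 0" for x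
    using that H_pos[OF that] by (simp add: e_def K_def beta_ext_def less_imp_le)
  have ei: "integrable lborel e"
  proof -
    obtain \<kappa> where \<kappa>: "\<forall>r\<ge>0. \<beta> r \<le> \<kappa> * r" using beta_linear_bound by blast
    have "integrable lborel (\<lambda>x. \<kappa> * h x)" using hi by simp
    then show ?thesis
    proof (rule Bochner_Integration.integrable_bound)
      have "continuous_on UNIV e" unfolding e_def
        by (intro continuous_intros continuous_beta_ext continuous_K_V)
      then show "e \<in> borel_measurable lborel" using borel_measurable_continuous_onI by simp
      show "AE x in lborel. norm (e x) \<le> norm (\<kappa> * h x)" using AEV
      proof eventually_elim
        case (elim x)
        have "0 < \<beta> (H (V x - C))" "\<beta> (H (V x - C)) \<le> \<kappa> * H (V x - C)"
          using beta_pos H_pos[OF elim] \<kappa> by auto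
        then show ?case using elim by (simp add: eH hH)
      qed
    qed
  qed
  \<comment> \<open>the common lower bound, attained exactly by the equilibria at level \<open>C\<close>\<close>
  define I where "I = (LINT x|lborel. e x) + C * m"
  have F: "(F_functional \<beta> V \<nu> = \<infinity> \<or> ereal I \<le> F_functional \<beta> V \<nu>) \<and>
     (F_functional \<beta> V \<nu> \<le> ereal I \<longrightarrow> equilibrium C \<nu>) \<and> (equilibrium C \<nu> \<longrightarrow> F_functional \<beta> V \<nu> = ereal I)"
    if \<nu>: "\<nu> \<in> Mplus" "measure \<nu> UNIV = m" for \<nu>
  proof -
    define v where "v x = enn2real (ac_density \<nu> x)" for x
    define \<sigma> where "\<sigma> = singular_part \<nu>"
    have dv: "lebesgue_decomposition \<nu> (ac_density \<nu>) \<sigma>"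
      unfolding \<sigma>_def by (rule lebesgue_decomposition_ac_density[OF \<nu>(1)])
    note mass = lebesgue_decomposition_mass[OF dv \<nu>(1), folded v_def]
    have s\<sigma>: "sets \<sigma> = sets borel" using dv by (simp add: lebesgue_decomposition_def)
    have sp: "space \<sigma> = UNIV" using sets_eq_imp_space_eq[OF s\<sigma>] by simp
    interpret S: finite_measure \<sigma> by (rule mass(2))
    have Vm\<sigma>: "V \<in> borel_measurable \<sigma>" using Vm measurable_cong_sets[OF s\<sigma>] by blast
    have v0: "v x \<ge> 0" for x by (simp add: v_def)
    have vm: "v \<in> borel_measurable borel" using borel_measurable_integrable[OF mass(4)] by simp
    define f where "f x = E_fun \<beta> (v x) + V x * v x" for x
    have fm: "f \<in> borel_measurable lborel"
      using E_fun_measurable[of v borel] vm v0 unfolding f_def by measurable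
    have Feq: "F_functional \<beta> V \<nu> = ext_integral lborel f + ext_integral \<sigma> V"
      by (simp add: F_functional_def Let_def f_def[abs_def] v_def \<sigma>_def)
    have low: "AE x in lborel. e x + C * v x \<le> f x \<and> (f x = e x + C * v x \<longleftrightarrow> v x = h x)"
      using AEV
    proof eventually_elim
      case (elim x)
      show ?case using legendre[OF elim v0[of x]] elim by (auto simp: f_def eH hH algebra_simps)
    qed
    have li: "integrable lborel (\<lambda>x. e x + C * v x)" using ei mass(4) by simp
    have ci: "integrable \<sigma> (\<lambda>x. C)" by simp
    have IC: "(LINT x|lborel. e x + C * v x) + (LINT x|\<sigma>. C) = I"
      using ei mass(4,5) \<nu>(2) sp by (simp add: I_def algebra_simps)
    have c1: "(integrable lborel f \<and> ext_integral lborel f = ereal (LINT x|lborel. f x)) \<or> ext_integral lborel f = \<infinity>"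
      by (rule ext_integral_cases[OF fm li]) (use low in \<open>auto elim!: eventually_mono\<close>)
    have c2: "(integrable \<sigma> V \<and> ext_integral \<sigma> V = ereal (LINT x|\<sigma>. V x)) \<or> ext_integral \<sigma> V = \<infinity>"
      by (rule ext_integral_cases[OF Vm\<sigma> ci]) (use VC in auto)
    have equil: "equilibrium C \<nu> \<longleftrightarrow> (AE x in lborel. v x = h x) \<and> (AE x in \<sigma>. V x = C)"
    proof
      assume en: "equilibrium C \<nu>"
      then have "lebesgue_decomposition \<nu> (\<lambda>x. K (V x - C)) \<sigma>" by (simp add: equilibrium_def \<sigma>_def)
      from lebesgue_decomposition_unique(2)[OF dv this]
      have "AE x in lborel. v x = h x" by eventually_elim (simp add: v_def h_def)
      moreover have "AE x in \<sigma>. V x = C"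
        using equilibrium_properties(4)[OF en \<nu>(1)] unfolding \<sigma>_def by eventually_elim simp
      ultimately show "(AE x in lborel. v x = h x) \<and> (AE x in \<sigma>. V x = C)" ..
    next
      assume a: "(AE x in lborel. v x = h x) \<and> (AE x in \<sigma>. V x = C)"
      then have "AE x in lborel. v x = h x" ..
      then have "AE x in lborel. ac_density \<nu> x = K (V x - C)" using AEV mass(3)
      proof eventually_elim
        case (elim x)
        have "ac_density \<nu> x = ennreal (v x)" using elim(3) unfolding v_def by simp
        also have "\<dots> = K (V x - C)" using elim by (simp add: hH K_def)
        finally show ?case .
      qed
      then have "lebesgue_decomposition \<nu> (\<lambda>x. K (V x - C)) \<sigma>"
        by (rule lebesgue_decomposition_cong_AE[OF dv borel_measurable_continuous_onI[OF continuous_K_V]])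
      moreover have "emeasure \<sigma> {x. V x \<noteq> C} = 0"
      proof -
        have "open {x. V x \<noteq> C}" by (intro open_Collect_neq continuous_V continuous_on_const)
        then have "{x. V x \<noteq> C} \<in> sets \<sigma>" using s\<sigma> by simp
        then have "{x. V x \<noteq> C} \<in> null_sets \<sigma>"
          using a by (subst AE_iff_null_sets) (auto elim!: eventually_mono)
        then show ?thesis by auto
      qed
      ultimately show "equilibrium C \<nu>" using C null by (simp add: equilibrium_def \<sigma>_def)
    qed
    have fge: "(LINT x|lborel. e x + C * v x) \<le> (LINT x|lborel. f x)" if "integrable lborel f"
      by (rule integral_mono_AE[OF li that]) (use low in \<open>auto elim!: eventually_mono\<close>)
    have Vge: "(LINT x|\<sigma>. C) \<le> (LINT x|\<sigma>. V x)" if "integrable \<sigma> V"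
      by (rule integral_mono[OF ci that]) (rule VC)
    have 1: "F_functional \<beta> V \<nu> = \<infinity> \<or> ereal I \<le> F_functional \<beta> V \<nu>"
    proof (cases "ext_integral lborel f = \<infinity> \<or> ext_integral \<sigma> V = \<infinity>")
      case True
      then have "F_functional \<beta> V \<nu> = \<infinity>" using c1 c2 by (auto simp: Feq)
      then show ?thesis ..
    next
      case False
      then show ?thesis using c1 c2 fge Vge IC by (auto simp: Feq)
    qed
    have 2: "equilibrium C \<nu>" if le: "F_functional \<beta> V \<nu> \<le> ereal I"
    proof -
      have "ext_integral lborel f \<noteq> \<infinity>" "ext_integral \<sigma> V \<noteq> \<infinity>" using le c1 c2 by (auto simp: Feq)
      then have i: "integrable lborel f" "integrable \<sigma> V"
        and "(LINT x|lborel. f x) + (LINT x|\<sigma>. V x) \<le> I"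
        using c1 c2 le by (auto simp: Feq)
      then have z: "(LINT x|lborel. f x - (e x + C * v x)) = 0" "(LINT x|\<sigma>. V x - C) = 0"
        using fge[OF i(1)] Vge[OF i(2)] IC li ci Bochner_Integration.integral_diff[OF i(1) li]
          Bochner_Integration.integral_diff[OF i(2) ci] by linarith+
      have "AE x in lborel. f x - (e x + C * v x) = 0"
        using z(1) by (subst (asm) integral_nonneg_eq_0_iff_AE) (use i li low in \<open>auto elim!: eventually_mono\<close>)
      then have "AE x in lborel. v x = h x" using low by eventually_elim simp
      moreover have "AE x in \<sigma>. V x - C = 0"
        using z(2) by (subst (asm) integral_nonneg_eq_0_iff_AE) (use i ci VC in auto)
      ultimately show ?thesis unfolding equil by simp
    qed
    have 3: "F_functional \<beta> V \<nu> = ereal I" if en: "equilibrium C \<nu>"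
    proof -
      have a: "AE x in lborel. v x = h x" "AE x in \<sigma>. V x = C" using en equil by auto
      have fe: "AE x in lborel. e x + C * v x = f x" using a(1) low by eventually_elim simp
      have i: "integrable lborel f" "(LINT x|lborel. f x) = (LINT x|lborel. e x + C * v x)"
        using integrable_cong_AE_imp[OF li fm fe] integral_cong_AE[OF _ _ fe] li fm by auto
      have "AE x in \<sigma>. C = V x" using a(2) by eventually_elim simp
      from integrable_cong_AE_imp[OF ci Vm\<sigma> this] integral_cong_AE[OF _ Vm\<sigma> this]
      have j: "integrable \<sigma> V" "(LINT x|\<sigma>. V x) = (LINT x|\<sigma>. C)" by auto
      show ?thesis using ext_integral_integrable[OF i(1)] ext_integral_integrable[OF j(1)] i(2) j(2) IC by (simp add: Feq)
    qed
    show ?thesis using 1 2 3 by blast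
  qed
  have R: "F_functional \<beta> V \<rho> = ereal I" using F[OF P(1,2)] eq by blast
  show "F_functional \<beta> V \<rho> \<le> F_functional \<beta> V \<mu>" using F[OF P(3,4)] unfolding R by auto
  show "F_functional \<beta> V \<mu> \<le> F_functional \<beta> V \<rho> \<Longrightarrow> equilibrium C \<mu>" using F[OF P(3,4)] unfolding R by blast
qed

lemma minimizer_iff_equilibrium:
  assumes m: "m > 0" and \<rho>: "\<rho> \<in> Mplus_mass m"
  shows "minimizer_F \<beta> V m \<rho> \<longleftrightarrow> (\<exists>C. equilibrium C \<rho>)"
proof
  assume min: "minimizer_F \<beta> V m \<rho>"
  obtain C \<nu> where \<nu>: "\<nu> \<in> Mplus_mass m" "equilibrium C \<nu>" using ex_equilibrium[OF m] by blast
  have "F_functional \<beta> V \<rho> \<le> F_functional \<beta> V \<nu>"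
    using min \<nu>(1) by (auto simp: minimizer_F_def is_arg_min_def not_less)
  then show "\<exists>C. equilibrium C \<rho>" using equilibrium_minimality(2)[OF \<nu>(2,1) \<rho>] by blast
next
  assume "\<exists>C. equilibrium C \<rho>"
  then show "minimizer_F \<beta> V m \<rho>"
    using equilibrium_minimality(1)[OF _ \<rho>] \<rho> by (auto simp: minimizer_F_def is_arg_min_def not_less)
qed

lemma dissipation_zero_iff_equilibrium:
  assumes m: "m > 0" and \<rho>: "\<rho> \<in> Mplus_mass m"
  shows "dissipation \<beta> V \<rho> = 0 \<longleftrightarrow> (\<exists>C. equilibrium C \<rho>)"
  using dissipation_zero_imp_equilibrium[of \<rho>] equilibrium_imp_dissipation_zero m \<rho>
  by (auto simp: Mplus_mass_def)

lemma stationary_iff_equilibrium: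
  assumes m: "m > 0" and \<rho>: "\<rho> \<in> M2 m"
  shows "stationary_solution \<beta> V m \<rho> \<longleftrightarrow> (\<exists>C. equilibrium C \<rho>)"
proof -
  have "\<rho> \<in> Mplus_mass m" using \<rho> by (simp add: M2_def)
  then show ?thesis
    using stationary_imp_dissipation_zero dissipation_zero_iff_equilibrium[OF m] equilibrium_imp_stationary[OF _ \<rho>] by blast
qed

end

theorem theorem2p15:
  fixes \<beta> V :: "real \<Rightarrow> real" and lam m :: real
  assumes "\<exists>\<beta>'. continuous_on {0..} \<beta>' \<and>
             (\<forall>r\<ge>0. (\<beta> has_real_derivative \<beta>' r) (at r within {0..}))"
    and "strict_mono_on {0..} \<beta>"
    and "\<beta> 0 = 0"
    and "\<exists>L. (\<beta> \<longlongrightarrow> L) at_top"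
    and "V C1_differentiable_on UNIV"
    and "deriv V C1_differentiable_on UNIV"
    and "\<forall>x. deriv (deriv V) x \<ge> lam"
    and "Liminf at_infinity (\<lambda>x. ereal (V x / \<bar>x\<bar>\<^sup>2)) \<ge> 0"
    and "filterlim V at_top at_infinity"
    and "\<exists>Q'. open Q' \<and> bounded Q' \<and> Q_set V \<subseteq> Q' \<and>
           set_integrable lborel (- Q') (\<lambda>x. H_fun \<beta> (V x - V_min V))"
    and "m > 0"
    and "d_threshold \<beta> = \<infinity>"
  shows "(\<forall>\<rho>\<in>Mplus_mass m. dissipation \<beta> V \<rho> = 0 \<longleftrightarrow> minimizer_F \<beta> V m \<rho>) \<and>
         (\<forall>\<rho>\<in>M2 m. stationary_solution \<beta> V m \<rho> \<longleftrightarrow> minimizer_F \<beta> V m \<rho>)"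
proof -
  interpret normalizable_pressure \<beta> V
    by unfold_locales (fact assms)+
  show ?thesis
    using dissipation_zero_iff_equilibrium stationary_iff_equilibrium minimizer_iff_equilibrium \<open>m > 0\<close>
    by (auto simp: M2_def)
qed

end
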